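(* For a datum $(\mathbf{c},\mathbf{d},\mathbf{B})$, the quantity $D_g(\mathbf{c},\mathbf{d},\mathbf{B})$ is finite if and only if we have the scaling condition $$\sum_{i=1}^kc_i\dim(E_i)=\sum_{j=1}^md_j\dim(E^j)$$ and the dimension condition $$\sum_{i=1}^kc_i\dim(\pi_{E_i}T)\le\sum_{j=1}^md_j\dim(B_jT)\quad\text{for all product-form subspaces }T\subseteq E_0.$$ In particular, these conditions imply that each $B_j$, $1\le j\le m$, must be surjective. Moreover, if $(\mathbf{c},\mathbf{d},\mathbf{B})$ is simple, then it is gaussian-extremizable.
   Context: Let $E_1,\dots,E_k$ and $E^1,\dots,E^m$ be Euclidean spaces (finite-dimensional real Hilbert spaces), $E_0=\bigoplus_{i=1}^kE_i$ (orthogonal direct sum, each $E_i\subseteq E_0$), and $\pi_{E_i}:E_0\to E_i$ the orthogonal projection. Let $\mathbf{B}=(B_{ij})$ with $B_{ij}:E_i\to E^j$ linear, and $B_j:E_0\to E^j$, $B_jx=\sum_{i=1}^kB_{ij}\pi_{E_i}(x)$. Let $\mathbf{c}=(c_i)_{1\le i\le k}$, $\mathbf{d}=(d_j)_{1\le j\le m}$ be positive real numbers. The triple $(\mathbf{c},\mathbf{d},\mathbf{B})$ is called a datum; by convention the numbers of a datum satisfy $\sum_ic_i\dim(E_i)=\sum_jd_j\dim(E^j)$, although the quantity $D_g$ below is defined by the same formula without this identity. $S^+(E)$ denotes the self-adjoint positive-definite operators on $E$; $A\le B$ means $B-A$ is positive-semidefinite. $\Lambda_{\mathbf c}=\bigoplus_ic_i\,\mathrm{id}_{E_i}$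 and, for $V_i\in S^+(E_i)$, $V_{\mathbf c}=\bigoplus_ic_iV_i$. Define $$D_g(\mathbf{c},\mathbf{d},\mathbf{B})=\frac12\sup\Big(\sum_{j=1}^md_j\log\det U_j-\sum_{i=1}^kc_i\log\det V_i\Big)$$ over all $V_i\in S^+(E_i)$, $U_j\in S^+(E^j)$ satisfying $\sum_jd_j\Lambda_{\mathbf c}B_j^*U_jB_j\Lambda_{\mathbf c}\le V_{\mathbf c}$. The datum is gaussian-extremizable if this supremum is finite and attained. A subspace $T\subseteq E_0$ is of product-form if $T=\bigoplus_{i=1}^k\pi_{E_i}(T)$. A critical subspace for $(\mathbf{c},\mathbf{d},\mathbf{B})$ is a non-zero proper product-form subspace $T\subset E_0$ with $\sum_ic_i\dim(\pi_{E_i}T)=\sum_jd_j\dim(B_jT)$. The datum is simple if it has no critical subspaces.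
   Formalization: The last claim (simple implies gaussian-extremizable) is stated under the scaling and dimension conditions; without the dimension condition it fails, e.g. E_1=R^2, E^1=E^2=R, B_1=B_2=first coordinate, c_1=d_1=d_2=1, which is simple with D_g infinite. *)

theory Defs
  imports "HOL-Analysis.Analysis" "Jordan_Normal_Form.Determinant"
begin

text \<open>
  The Euclidean spaces \<open>E\<^sub>1, \<dots>, E\<^sub>k\<close> are pairwise orthogonal subspaces \<open>E i\<close>, \<open>i \<in> {1..k}\<close>, of an
  arbitrary ambient Euclidean space \<open>'a\<close>, so that their orthogonal direct sum \<open>E\<^sub>0\<close> is an internal
  one; \<open>E\<^sub>0\<close> need not be all of \<open>'a\<close>.  The spaces \<open>E\<^sup>1, \<dots>, E\<^sup>m\<close> are arbitrary subspaces \<open>F j\<close>,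
  \<open>j \<in> {1..m}\<close>, of an ambient Euclidean space \<open>'b\<close>.  The dimensions of the \<open>E i\<close> and \<open>F j\<close> may
  differ and may be zero.  Operators on these subspaces are functions on the ambient space of
  which only the values on the subspace matter.
\<close>

subsection \<open>Operators on subspaces of a Euclidean space\<close>

definition linear_map_on ::
    "'a::real_vector set \<Rightarrow> 'b::real_vector set \<Rightarrow> ('a \<Rightarrow> 'b) \<Rightarrow> bool" where
  "linear_map_on S T f \<longleftrightarrow> f ` S \<subseteq> T
     \<and> (\<forall>x\<in>S. \<forall>y\<in>S. f (x + y) = f x + f y)
     \<and> (\<forall>r. \<forall>x\<in>S. f (r *\<^sub>R x) = r *\<^sub>R f x)"

definition orth_proj :: "'a::euclidean_space set \<Rightarrow> 'a \<Rightarrow> 'a" where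
  "orth_proj S x = (THE p. p \<in> S \<and> (\<forall>y\<in>S. inner (x - p) y = 0))"

definition self_adjoint_on :: "'a::euclidean_space set \<Rightarrow> ('a \<Rightarrow> 'a) \<Rightarrow> bool" where
  "self_adjoint_on S A \<longleftrightarrow> linear_map_on S S A \<and> (\<forall>x\<in>S. \<forall>y\<in>S. inner (A x) y = inner x (A y))"

definition pos_def_on :: "'a::euclidean_space set \<Rightarrow> ('a \<Rightarrow> 'a) \<Rightarrow> bool" where
  "pos_def_on S A \<longleftrightarrow> self_adjoint_on S A \<and> (\<forall>x\<in>S. x \<noteq> 0 \<longrightarrow> 0 < inner (A x) x)"

definition pos_semidef_on :: "'a::euclidean_space set \<Rightarrow> ('a \<Rightarrow> 'a) \<Rightarrow> bool" where
  "pos_semidef_on S A \<longleftrightarrow> self_adjoint_on S A \<and> (\<forall>x\<in>S. 0 \<le> inner (A x) x)"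

definition op_le_on :: "'a::euclidean_space set \<Rightarrow> ('a \<Rightarrow> 'a) \<Rightarrow> ('a \<Rightarrow> 'a) \<Rightarrow> bool" where
  "op_le_on S A C \<longleftrightarrow> pos_semidef_on S (\<lambda>x. C x - A x)"

definition orthonormal_basis_of :: "'a::euclidean_space set \<Rightarrow> 'a list \<Rightarrow> bool" where
  "orthonormal_basis_of S bs \<longleftrightarrow> distinct bs \<and> pairwise (\<lambda>x y. inner x y = 0) (set bs)
     \<and> (\<forall>b\<in>set bs. norm b = 1) \<and> span (set bs) = S"

text \<open>
  The determinant of an operator on the subspace \<open>S\<close>: the determinant of its matrix in an
  orthonormal basis of \<open>S\<close>.  The value does not depend on the basis; it is \<open>1\<close> for \<open>S = {0}\<close>.
\<close>

definition det_on :: "'a::euclidean_space set \<Rightarrow> ('a \<Rightarrow> 'a) \<Rightarrow> real" where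
  "det_on S A = (let bs = (SOME bs. orthonormal_basis_of S bs); n = length bs
     in Determinant.det (Matrix.mat n n (\<lambda>(p, q). inner (bs ! p) (A (bs ! q)))))"

subsection \<open>Product-form subspaces\<close>

definition sum_of_subspaces :: "nat \<Rightarrow> (nat \<Rightarrow> 'a::real_vector set) \<Rightarrow> 'a set" where
  "sum_of_subspaces k S = {(\<Sum>i\<in>{1..k}. x i) | x. \<forall>i\<in>{1..k}. x i \<in> S i}"

abbreviation (input) E0 :: "nat \<Rightarrow> (nat \<Rightarrow> 'a::euclidean_space set) \<Rightarrow> 'a set" where
  "E0 k E \<equiv> sum_of_subspaces k E"

text \<open>The sum below is direct, as the summands lie in the pairwise orthogonal \<open>E i\<close>.\<close>

definition product_form :: "nat \<Rightarrow> (nat \<Rightarrow> 'a::euclidean_space set) \<Rightarrow> 'a set \<Rightarrow> bool" where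
  "product_form k E T \<longleftrightarrow> subspace T \<and> T \<subseteq> E0 k E
     \<and> T = sum_of_subspaces k (\<lambda>i. orth_proj (E i) ` T)"

subsection \<open>Data\<close>

text \<open>
  \<open>Bsum k E B j\<close> is the map \<open>B\<^sub>j\<close>.  It is defined on all of \<open>'a\<close> and vanishes on the
  orthogonal complement of \<open>E\<^sub>0\<close>, so the library's \<open>adjoint\<close> of it has range in \<open>E\<^sub>0\<close> and
  agrees on \<open>F j\<close> with the adjoint of \<open>B\<^sub>j : E\<^sub>0 \<rightarrow> E\<^sup>j\<close>.
\<close>

definition Bsum :: "nat \<Rightarrow> (nat \<Rightarrow> 'a::euclidean_space set) \<Rightarrow>
    (nat \<Rightarrow> nat \<Rightarrow> 'a \<Rightarrow> 'b::euclidean_space) \<Rightarrow> nat \<Rightarrow> 'a \<Rightarrow> 'b" where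
  "Bsum k E B j x = (\<Sum>i\<in>{1..k}. B i j (orth_proj (E i) x))"

definition Lambda_c :: "nat \<Rightarrow> (nat \<Rightarrow> 'a::euclidean_space set) \<Rightarrow> (nat \<Rightarrow> real) \<Rightarrow> 'a \<Rightarrow> 'a" where
  "Lambda_c k E c x = (\<Sum>i\<in>{1..k}. c i *\<^sub>R orth_proj (E i) x)"

definition V_c :: "nat \<Rightarrow> (nat \<Rightarrow> 'a::euclidean_space set) \<Rightarrow> (nat \<Rightarrow> real) \<Rightarrow>
    (nat \<Rightarrow> 'a \<Rightarrow> 'a) \<Rightarrow> 'a \<Rightarrow> 'a" where
  "V_c k E c V x = (\<Sum>i\<in>{1..k}. c i *\<^sub>R V i (orth_proj (E i) x))"

definition admissible :: "nat \<Rightarrow> nat \<Rightarrow> (nat \<Rightarrow> 'a::euclidean_space set) \<Rightarrow>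
    (nat \<Rightarrow> 'b::euclidean_space set) \<Rightarrow> (nat \<Rightarrow> real) \<Rightarrow> (nat \<Rightarrow> real) \<Rightarrow>
    (nat \<Rightarrow> nat \<Rightarrow> 'a \<Rightarrow> 'b) \<Rightarrow> (nat \<Rightarrow> 'a \<Rightarrow> 'a) \<Rightarrow> (nat \<Rightarrow> 'b \<Rightarrow> 'b) \<Rightarrow> bool" where
  "admissible k m E F c d B V U \<longleftrightarrow>
     (\<forall>i\<in>{1..k}. pos_def_on (E i) (V i)) \<and> (\<forall>j\<in>{1..m}. pos_def_on (F j) (U j)) \<and>
     op_le_on (E0 k E)
       (\<lambda>x. \<Sum>j\<in>{1..m}. d j *\<^sub>R
          Lambda_c k E c (adjoint (Bsum k E B j) (U j (Bsum k E B j (Lambda_c k E c x)))))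
       (V_c k E c V)"

definition gaussian_functional :: "nat \<Rightarrow> nat \<Rightarrow> (nat \<Rightarrow> 'a::euclidean_space set) \<Rightarrow>
    (nat \<Rightarrow> 'b::euclidean_space set) \<Rightarrow> (nat \<Rightarrow> real) \<Rightarrow> (nat \<Rightarrow> real) \<Rightarrow>
    (nat \<Rightarrow> 'a \<Rightarrow> 'a) \<Rightarrow> (nat \<Rightarrow> 'b \<Rightarrow> 'b) \<Rightarrow> real" where
  "gaussian_functional k m E F c d V U =
     (\<Sum>j\<in>{1..m}. d j * ln (det_on (F j) (U j))) - (\<Sum>i\<in>{1..k}. c i * ln (det_on (E i) (V i)))"

definition D_g :: "nat \<Rightarrow> nat \<Rightarrow> (nat \<Rightarrow> 'a::euclidean_space set) \<Rightarrow>
    (nat \<Rightarrow> 'b::euclidean_space set) \<Rightarrow> (nat \<Rightarrow> real) \<Rightarrow> (nat \<Rightarrow> real) \<Rightarrow>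
    (nat \<Rightarrow> nat \<Rightarrow> 'a \<Rightarrow> 'b) \<Rightarrow> ereal" where
  "D_g k m E F c d B = ereal (1/2) *
     (SUP (V, U) \<in> {(V, U). admissible k m E F c d B V U}.
        ereal (gaussian_functional k m E F c d V U))"

definition gaussian_extremizable :: "nat \<Rightarrow> nat \<Rightarrow> (nat \<Rightarrow> 'a::euclidean_space set) \<Rightarrow>
    (nat \<Rightarrow> 'b::euclidean_space set) \<Rightarrow> (nat \<Rightarrow> real) \<Rightarrow> (nat \<Rightarrow> real) \<Rightarrow>
    (nat \<Rightarrow> nat \<Rightarrow> 'a \<Rightarrow> 'b) \<Rightarrow> bool" where
  "gaussian_extremizable k m E F c d B \<longleftrightarrow> \<bar>D_g k m E F c d B\<bar> \<noteq> \<infinity> \<and>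
     (\<exists>V U. admissible k m E F c d B V U \<and>
        D_g k m E F c d B = ereal (1/2 * gaussian_functional k m E F c d V U))"

definition scaling_condition :: "nat \<Rightarrow> nat \<Rightarrow> (nat \<Rightarrow> 'a::euclidean_space set) \<Rightarrow>
    (nat \<Rightarrow> 'b::euclidean_space set) \<Rightarrow> (nat \<Rightarrow> real) \<Rightarrow> (nat \<Rightarrow> real) \<Rightarrow> bool" where
  "scaling_condition k m E F c d \<longleftrightarrow>
     (\<Sum>i\<in>{1..k}. c i * real (dim (E i))) = (\<Sum>j\<in>{1..m}. d j * real (dim (F j)))"

definition dimension_condition :: "nat \<Rightarrow> nat \<Rightarrow> (nat \<Rightarrow> 'a::euclidean_space set) \<Rightarrow>
    (nat \<Rightarrow> real) \<Rightarrow> (nat \<Rightarrow> real) \<Rightarrow> (nat \<Rightarrow> nat \<Rightarrow> 'a \<Rightarrow> 'b::euclidean_space) \<Rightarrow> bool" where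
  "dimension_condition k m E c d B \<longleftrightarrow> (\<forall>T. product_form k E T \<longrightarrow>
     (\<Sum>i\<in>{1..k}. c i * real (dim (orth_proj (E i) ` T)))
       \<le> (\<Sum>j\<in>{1..m}. d j * real (dim (Bsum k E B j ` T))))"

definition critical_subspace :: "nat \<Rightarrow> nat \<Rightarrow> (nat \<Rightarrow> 'a::euclidean_space set) \<Rightarrow>
    (nat \<Rightarrow> real) \<Rightarrow> (nat \<Rightarrow> real) \<Rightarrow> (nat \<Rightarrow> nat \<Rightarrow> 'a \<Rightarrow> 'b::euclidean_space) \<Rightarrow> 'a set \<Rightarrow> bool" where
  "critical_subspace k m E c d B T \<longleftrightarrow> product_form k E T \<and> T \<noteq> {0} \<and> T \<noteq> E0 k E \<and>
     (\<Sum>i\<in>{1..k}. c i * real (dim (orth_proj (E i) ` T)))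
       = (\<Sum>j\<in>{1..m}. d j * real (dim (Bsum k E B j ` T)))"

definition simple_datum :: "nat \<Rightarrow> nat \<Rightarrow> (nat \<Rightarrow> 'a::euclidean_space set) \<Rightarrow>
    (nat \<Rightarrow> real) \<Rightarrow> (nat \<Rightarrow> real) \<Rightarrow> (nat \<Rightarrow> nat \<Rightarrow> 'a \<Rightarrow> 'b::euclidean_space) \<Rightarrow> bool" where
  "simple_datum k m E c d B \<longleftrightarrow> (\<nexists>T. critical_subspace k m E c d B T)"

end

theory Submission
  imports Defs
begin

text \<open>
  Necessity: shrinking \<open>V\<close> by \<open>\<epsilon>\<close> on a product-form \<open>T\<close> allows \<open>U\<^sub>j\<close> to be of order \<open>\<epsilon>\<close> on \<open>B\<^sub>j T\<close>
  and of order \<open>1\<close> on its complement, so letting \<open>\<epsilon> \<rightarrow> 0\<close> bounds the functional only if \<open>T\<close> satisfies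
  the dimension condition; a common dilation of \<open>V\<close> and \<open>U\<close> gives the scaling condition.

  Sufficiency: diagonalize the \<open>V\<^sub>i\<close> in an orthonormal basis \<open>e\<^sub>0, e\<^sub>1, \<dots>\<close> of \<open>E\<^sub>0\<close> with increasing
  eigenvalues \<open>l\<^sub>a\<close>.  Testing the constraint on \<open>e\<^sub>a\<close> bounds \<open>\<langle>U\<^sub>j B\<^sub>j e\<^sub>a, B\<^sub>j e\<^sub>a\<rangle>\<close> by a multiple of \<open>l\<^sub>a\<close>,
  hence by Hadamard \<open>det U\<^sub>j\<close> by a multiple of the product of the \<open>l\<^sub>a\<close> over any set \<open>I\<^sub>j\<close> for which the
  \<open>B\<^sub>j e\<^sub>a\<close> form a basis of \<open>E\<^sup>j\<close>.  The greedy choice of \<open>I\<^sub>j\<close> makes the dimension condition for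
  the flag of the \<open>e\<^sub>a\<close> exactly what summation by parts needs.  The multiple degenerates with the
  basis, so \<open>I\<^sub>j\<close> is chosen for the limit of a convergent subsequence of bases rather than for each
  basis separately.  For simple data the flag inequalities are strict, the functional tends to
  \<open>-\<infinity>\<close> with the spread of the eigenvalues, and a maximizing sequence subconverges after rescaling.
\<close>

subsection \<open>Operators on subspaces\<close>

text \<open>What makes the limit basis legitimate is that two different bases share the work. The
  eigenvalues belong to the actual eigenbases, while the index sets and the weights belong to the
  limit basis, and the dimension condition is applied only to flags of the latter. This is enough
  because a positive Gram determinant stays bounded below near the limit, and because summation by
  parts uses nothing of the eigenvalues but their order. The constant obtained depends on the
  sequence, so boundedness is proved by contradiction; the same statement about sequences then
  serves a maximizing sequence. The obstacle for extremizers is that a limit of the operators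
  \<open>U j\<close> is a priori only semidefinite, where \<open>ln\<close> of the determinant
  breaks down. The part of the functional in \<open>V\<close> converges, so the product of the
  powers \<open>det_on (F j) (U j) powr d j\<close> has a nonzero limit and no determinant can
  vanish. The upper bound on \<open>U j\<close> that gives compactness rests on the surjectivity of
  \<open>Bj j\<close>, which the two conditions provide.\<close>

lemma orth_proj_unique:
  fixes S :: "'a::euclidean_space set"
  assumes "subspace S" "p \<in> S" "\<And>y. y \<in> S \<Longrightarrow> inner (x - p) y = 0"
  shows "orth_proj S x = p"
  unfolding orth_proj_def
proof (rule the_equality)
  show "p \<in> S \<and> (\<forall>y\<in>S. inner (x - p) y = 0)" using assms by blast
next
  fix q assume q: "q \<in> S \<and> (\<forall>y\<in>S. inner (x - q) y = 0)"
  have "q - p \<in> S" using assms q by (simp add: subspace_diff)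
  then have "inner (x - p) (q - p) = 0" "inner (x - q) (q - p) = 0" using assms q by auto
  then have "inner (q - p) (q - p) = 0" by (simp add: inner_diff_left)
  then show "q = p" by simp
qed

lemma orth_proj_props:
  fixes S :: "'a::euclidean_space set"
  assumes "subspace S"
  shows orth_proj_in: "orth_proj S x \<in> S"
    and orth_proj_inner: "y \<in> S \<Longrightarrow> inner (orth_proj S x) y = inner x y"
proof -
  have sp: "span S = S" using assms by (simp add: span_eq_iff)
  obtain y z where yz: "y \<in> S" "\<And>w. w \<in> S \<Longrightarrow> real_inner_class.orthogonal z w" "x = y + z"
    using orthogonal_subspace_decomp_exists[of S x] sp by metis
  have eq: "orth_proj S x = y"
    by (rule orth_proj_unique) (use assms yz in \<open>auto simp: Linear_Algebra.orthogonal_def\<close>)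
  show "orth_proj S x \<in> S" using eq yz by simp
  show "inner (orth_proj S x) y = inner x y" if "y \<in> S" for y
    using eq yz that by (simp add: Linear_Algebra.orthogonal_def inner_add_left)
qed

lemma orth_proj_ident: "subspace S \<Longrightarrow> x \<in> S \<Longrightarrow> orth_proj S x = x"
  by (rule orth_proj_unique) auto

lemma orth_proj_zero: "subspace S \<Longrightarrow> (\<And>y. y \<in> S \<Longrightarrow> inner x y = 0) \<Longrightarrow> orth_proj S x = 0"
  by (rule orth_proj_unique) (auto simp: subspace_0)

lemma linear_orth_proj:
  fixes S :: "'a::euclidean_space set"
  assumes S: "subspace S" shows "linear (orth_proj S)"
proof (rule linearI)
  fix x y :: 'a
  show "orth_proj S (x + y) = orth_proj S x + orth_proj S y"
    by (rule orth_proj_unique)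
      (use S orth_proj_in[OF S] orth_proj_inner[OF S] in \<open>auto simp: subspace_add inner_add_left inner_diff_left\<close>)
next
  fix r and x :: 'a
  show "orth_proj S (r *\<^sub>R x) = r *\<^sub>R orth_proj S x"
    by (rule orth_proj_unique)
      (use S orth_proj_in[OF S] orth_proj_inner[OF S] in \<open>auto simp: subspace_scale inner_diff_left\<close>)
qed

lemma inner_orth_proj_commute:
  fixes S :: "'a::euclidean_space set"
  assumes S: "subspace S"
  shows "inner (orth_proj S x) y = inner x (orth_proj S y)"
  by (metis S orth_proj_in orth_proj_inner inner_commute)

text \<open>Only the values on \<open>S\<close> matter for an operator on \<open>S\<close>.
  Precomposition with the projection yields a map that is linear on the whole space, so that facts
  such as continuity of linear maps apply.\<close>

lemma linear_map_on_comp_orth_proj: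
  fixes f :: "'a::euclidean_space \<Rightarrow> 'b::real_vector"
  assumes S: "subspace S" and f: "linear_map_on S T f"
  shows "linear (\<lambda>x. f (orth_proj S x))"
  using f linear_orth_proj[OF S] orth_proj_in[OF S]
  by (auto simp: linear_map_on_def linear_iff)

lemma linear_map_on_sum:
  assumes "linear_map_on S T f" "subspace S" "finite I" "\<And>i. i \<in> I \<Longrightarrow> v i \<in> S"
  shows "f (\<Sum>i\<in>I. r i *\<^sub>R v i) = (\<Sum>i\<in>I. r i *\<^sub>R f (v i))"
  using assms(3,4)
proof (induction I rule: finite_induct)
  case empty
  have "f (0 *\<^sub>R 0) = 0 *\<^sub>R f 0"
    using assms(1,2) unfolding linear_map_on_def by (meson subspace_0)
  then show ?case by simp
next
  case (insert a I)
  have "f (r a *\<^sub>R v a + (\<Sum>i\<in>I. r i *\<^sub>R v i)) = f (r a *\<^sub>R v a) + f (\<Sum>i\<in>I. r i *\<^sub>R v i)"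
    using assms(1,2) insert.prems unfolding linear_map_on_def
    by (simp add: subspace_scale subspace_sum)
  then show ?case using insert assms(1) unfolding linear_map_on_def by simp
qed

text \<open>A family rather than a list as in \<open>orthonormal_basis_of\<close>, so that its
  indices are matrix indices. The expansion formula stands in for the spanning condition.\<close>

definition onb :: "'a::euclidean_space set \<Rightarrow> nat \<Rightarrow> (nat \<Rightarrow> 'a) \<Rightarrow> bool" where
  "onb S n b \<longleftrightarrow> subspace S \<and> (\<forall>p<n. b p \<in> S)
     \<and> (\<forall>p<n. \<forall>q<n. inner (b p) (b q) = (if p = q then 1 else 0))
     \<and> (\<forall>x\<in>S. x = (\<Sum>p<n. inner x (b p) *\<^sub>R b p))"

lemma onbD:
  assumes "onb S n b"
  shows "subspace S" "\<And>p. p < n \<Longrightarrow> b p \<in> S"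
    "\<And>p q. p < n \<Longrightarrow> q < n \<Longrightarrow> inner (b p) (b q) = (if p = q then 1 else 0)"
    "\<And>x. x \<in> S \<Longrightarrow> x = (\<Sum>p<n. inner x (b p) *\<^sub>R b p)"
  using assms unfolding onb_def by auto

lemma orthonormal_family_independent:
  fixes b :: "nat \<Rightarrow> 'a::euclidean_space"
  assumes "finite I" "\<And>p q. p \<in> I \<Longrightarrow> q \<in> I \<Longrightarrow> inner (b p) (b q) = (if p = q then 1 else 0)"
  shows "inj_on b I" "independent (b ` I)" "dim (span (b ` I)) = card I"
proof -
  show inj: "inj_on b I"
    by (rule inj_onI) (metis assms(2) zero_neq_one)
  have "pairwise real_inner_class.orthogonal (b ` I)"
    using assms by (auto simp: pairwise_def Linear_Algebra.orthogonal_def)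
  moreover have "0 \<notin> b ` I" using assms(2) by fastforce
  ultimately show ind: "independent (b ` I)" using pairwise_orthogonal_independent by blast
  show "dim (span (b ` I)) = card I"
    using ind inj by (simp add: dim_span dim_eq_card_independent card_image)
qed

lemma onb_span: assumes "onb S n b" shows "span (b ` {..<n}) = S"
proof
  show "span (b ` {..<n}) \<subseteq> S" using onbD[OF assms] by (intro span_minimal) auto
  show "S \<subseteq> span (b ` {..<n})"
  proof
    fix x assume "x \<in> S"
    then have "x = (\<Sum>p<n. inner x (b p) *\<^sub>R b p)" using onbD[OF assms] by blast
    also have "\<dots> \<in> span (b ` {..<n})"
      by (intro span_sum span_scale span_base) auto
    finally show "x \<in> span (b ` {..<n})" .
  qed
qed

lemma onb_dim: assumes "onb S n b" shows "dim S = n"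
  using orthonormal_family_independent(3)[of "{..<n}" b] onbD[OF assms] onb_span[OF assms] by simp

lemma onbI:
  fixes b :: "nat \<Rightarrow> 'a::euclidean_space"
  assumes "\<And>p q. p < n \<Longrightarrow> q < n \<Longrightarrow> inner (b p) (b q) = (if p = q then 1 else 0)"
    and "span (b ` {..<n}) = S"
  shows "onb S n b"
proof -
  have "x = (\<Sum>p<n. inner x (b p) *\<^sub>R b p)" if "x \<in> S" for x
  proof -
    from that have "x \<in> span (b ` {..<n})" using assms(2) by simp
    moreover define z where "z = x - (\<Sum>p<n. inner x (b p) *\<^sub>R b p)"
    moreover have "(\<Sum>p<n. inner x (b p) *\<^sub>R b p) \<in> span (b ` {..<n})"
      by (intro span_sum span_scale span_base) auto
    ultimately have zs: "z \<in> span (b ` {..<n})" by (simp add: span_diff)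
    have "real_inner_class.orthogonal z y" if "y \<in> b ` {..<n}" for y
    proof -
      from that obtain q where q: "q < n" "y = b q" by auto
      have "(\<Sum>p<n. inner x (b p) * inner (b p) (b q)) = (\<Sum>p<n. if p = q then inner x (b q) else 0)"
        using assms(1) q by (intro sum.cong) auto
      then show ?thesis
        using q by (simp add: Linear_Algebra.orthogonal_def z_def inner_diff_left inner_sum_left)
    qed
    with zs have "real_inner_class.orthogonal z z"
      using orthogonal_to_span by blast
    then have "z = 0" by (simp add: Linear_Algebra.orthogonal_def)
    then show ?thesis by (simp add: z_def)
  qed
  moreover have "b p \<in> S" if "p < n" for p using assms(2) that by (metis imageI lessThan_iff span_base)
  ultimately show ?thesis unfolding onb_def using assms subspace_span by blast
qed

lemma onb_subspace_dim:
  fixes b :: "nat \<Rightarrow> 'a::euclidean_space"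
  assumes "subspace S" "\<And>p. p < n \<Longrightarrow> b p \<in> S" "n = dim S"
    "\<And>p q. p < n \<Longrightarrow> q < n \<Longrightarrow> inner (b p) (b q) = (if p = q then 1 else 0)"
  shows "onb S n b"
proof (rule onbI)
  have "span (b ` {..<n}) \<subseteq> S" using assms by (intro span_minimal) auto
  moreover have "dim (span (b ` {..<n})) = n"
    using orthonormal_family_independent(3)[of "{..<n}" b] assms by auto
  ultimately show "span (b ` {..<n}) = S"
    using assms by (metis dim_span order_refl subspace_dim_equal subspace_span)
qed (use assms in auto)

section \<open>Diagonalization of self-adjoint operators\<close>

lemma linear_le_quadratic_imp_zero:
  fixes a b :: real
  assumes "\<And>t. 0 \<le> a * t + b * t\<^sup>2"
  shows "a = 0"
proof (rule ccontr)
  assume a: "a \<noteq> 0"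
  \<comment> \<open>\<open>D\<close> exceeds both 0 and \<open>b\<close>, so at
    \<open>t = - a / D\<close> the linear term wins and the value is a^2 (b - D) / D^2 < 0.\<close>
  define D where "D = \<bar>b\<bar> + 1"
  define t where "t = - a / D"
  have D: "0 < D" "b < D" by (auto simp: D_def)
  have "a * t + b * t\<^sup>2 = a\<^sup>2 * (b - D) / D\<^sup>2"
  proof -
    have "a * t + b * t\<^sup>2 = - (a\<^sup>2 / D) + b * a\<^sup>2 / D\<^sup>2"
      unfolding t_def by (simp add: power2_eq_square)
    also have "a\<^sup>2 / D = a\<^sup>2 * D / D\<^sup>2" using D by (simp add: power2_eq_square)
    finally show ?thesis by (simp add: algebra_simps diff_divide_distrib)
  qed
  moreover have "a\<^sup>2 * (b - D) / D\<^sup>2 < 0"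
    using D a by (intro divide_neg_pos mult_pos_neg) auto
  ultimately have "a * t + b * t\<^sup>2 < 0" by simp
  with assms[of t] show False by simp
qed

text \<open>The Rayleigh quotient attains its minimum on the compact unit sphere of
  \<open>S\<close>, and its first variation vanishes there. Orthogonality of \<open>A e\<close> to
  the complement of \<open>e\<close> says that \<open>e\<close> is an eigenvector, in the form that
  makes a matrix diagonal.\<close>

lemma self_adjoint_min_eigenvector:
  fixes S :: "'a::euclidean_space set"
  assumes S: "subspace S" and A: "self_adjoint_on S A" and ne: "S \<noteq> {0}"
  obtains e where "e \<in> S" "norm e = 1" "\<And>y. y \<in> S \<Longrightarrow> inner y e = 0 \<Longrightarrow> inner (A e) y = 0"
proof -
  have lin: "linear_map_on S S A" using A by (simp add: self_adjoint_on_def)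
  have sym: "\<And>x y. x \<in> S \<Longrightarrow> y \<in> S \<Longrightarrow> inner (A x) y = inner x (A y)"
    using A by (simp add: self_adjoint_on_def)
  let ?f = "\<lambda>x. inner (A (orth_proj S x)) x"
  have "linear (\<lambda>x. A (orth_proj S x))" by (rule linear_map_on_comp_orth_proj[OF S lin])
  then have cont: "continuous_on UNIV ?f"
    by (intro continuous_on_inner continuous_on_id linear_continuous_on) (simp add: linear_conv_bounded_linear)
  let ?C = "sphere 0 1 \<inter> S"
  obtain v where v: "v \<in> S" "v \<noteq> 0" using ne S subspace_0 by blast
  then have "v /\<^sub>R norm v \<in> ?C" using S by (auto simp: subspace_scale)
  moreover have "compact ?C"
    using S closed_subspace by (intro compact_Int_closed) auto
  ultimately obtain e where e: "e \<in> ?C" and min: "\<And>x. x \<in> ?C \<Longrightarrow> ?f e \<le> ?f x"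
    using continuous_attains_inf[of ?C ?f] continuous_on_subset[OF cont] by (metis empty_iff subset_UNIV)
  have eS: "e \<in> S" and e1: "norm e = 1" using e by auto
  define l where "l = inner (A e) e"
  have hom: "l * (norm x)\<^sup>2 \<le> inner (A x) x" if "x \<in> S" for x
  proof (cases "x = 0")
    case True
    then show ?thesis by simp
  next
    case False
    have 1: "x /\<^sub>R norm x \<in> ?C" using False S that by (auto simp: subspace_scale)
    have "A (x /\<^sub>R norm x) = A x /\<^sub>R norm x" using lin that by (simp add: linear_map_on_def)
    then have "l \<le> inner (A x) x / (norm x)\<^sup>2"
      using min[OF 1] 1 eS by (simp add: orth_proj_ident[OF S] l_def power2_eq_square field_simps)
    then show ?thesis using False by (simp add: field_simps)
  qed
  have "inner (A e) y = 0" if y: "y \<in> S" "inner y e = 0" for y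
  proof -
    \<comment> \<open>This is \<open>hom\<close> at \<open>e + t y\<close>; the constant terms
      cancel because \<open>e\<close> is a unit vector orthogonal to \<open>y\<close>.\<close>
    have "0 \<le> (2 * inner (A e) y) * t + (inner (A y) y - l * (norm y)\<^sup>2) * t\<^sup>2" for t
    proof -
      have xS: "e + t *\<^sub>R y \<in> S" using S eS y by (simp add: subspace_add subspace_scale)
      have "A (e + t *\<^sub>R y) = A e + t *\<^sub>R A y"
        using lin eS y S by (simp add: linear_map_on_def subspace_scale)
      then have a: "inner (A (e + t *\<^sub>R y)) (e + t *\<^sub>R y) = l + 2 * inner (A e) y * t + inner (A y) y * t\<^sup>2"
        using sym[OF y(1) eS] by (simp add: inner_add_left inner_add_right l_def inner_commute algebra_simps power2_eq_square)
      have b: "(norm (e + t *\<^sub>R y))\<^sup>2 = 1 + t\<^sup>2 * (norm y)\<^sup>2"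
        using y(2) e1 unfolding power2_norm_eq_inner
        by (simp add: inner_add_left inner_add_right inner_commute power2_eq_square norm_eq_1)
      show ?thesis using hom[OF xS] unfolding a b by (simp add: algebra_simps)
    qed
    from linear_le_quadratic_imp_zero[OF this] show ?thesis by simp
  qed
  with eS e1 that show ?thesis by blast
qed

text \<open>Induction on the dimension: by self-adjointness the orthogonal complement of an
  eigenvector is invariant. Applied to the identity, it also supplies orthonormal bases.\<close>

lemma spectral_theorem_on:
  fixes S :: "'a::euclidean_space set"
  assumes "subspace S" "self_adjoint_on S A"
  shows "\<exists>b. onb S (dim S) b \<and> (\<forall>p<dim S. \<forall>q<dim S. p \<noteq> q \<longrightarrow> inner (A (b p)) (b q) = 0)"
  using assms
proof (induction "dim S" arbitrary: S)
  case 0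
  then have "S = {0}" using subspace_0 by force
  then have "onb S (dim S) (\<lambda>_. 0)" unfolding onb_def by auto
  with 0 show ?case by auto
next
  case (Suc n)
  note S = Suc.prems(1) and A = Suc.prems(2)
  have "S \<noteq> {0}" using Suc.hyps(2) by auto
  then obtain e where e: "e \<in> S" "norm e = 1" "\<And>y. y \<in> S \<Longrightarrow> inner y e = 0 \<Longrightarrow> inner (A e) y = 0"
    using self_adjoint_min_eigenvector[OF S A] by metis
  define S' where "S' = {y \<in> S. \<forall>x\<in>{e}. real_inner_class.orthogonal x y}"
  have S': "S' = {y \<in> S. inner y e = 0}" unfolding S'_def by (auto simp: Linear_Algebra.orthogonal_def inner_commute)
  have subS': "subspace S'" using S unfolding S' subspace_def by (auto simp: inner_add_left)
  have e0: "e \<noteq> 0" using e(2) by auto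
  have "span {e} \<subseteq> span S" using e(1) by (intro span_mono) auto
  from dim_subspace_orthogonal_to_vectors[of "span {e}" S] 
  have "dim {y \<in> S. \<forall>x\<in>span {e}. real_inner_class.orthogonal x y} + dim (span {e}) = dim S"
    using S \<open>span {e} \<subseteq> span S\<close> by (simp add: span_eq_iff[THEN iffD2, OF S])
  moreover have "{y \<in> S. \<forall>x\<in>span {e}. real_inner_class.orthogonal x y} = S'"
    unfolding S'_def by (auto simp: span_singleton Linear_Algebra.orthogonal_def)
  moreover have "dim (span {e}) = 1" using e0 by (simp add: dim_span dim_insert)
  ultimately have n: "n = dim S'" using Suc.hyps(2) by simp
  have A': "self_adjoint_on S' A"
    using A e unfolding self_adjoint_on_def linear_map_on_def S' 
    by (auto simp: image_subset_iff) (metis inner_commute)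
  obtain b where b: "onb S' n b" "\<And>p q. p < n \<Longrightarrow> q < n \<Longrightarrow> p \<noteq> q \<Longrightarrow> inner (A (b p)) (b q) = 0"
    using Suc.hyps(1)[OF n subS' A'] n by metis
  define b' where "b' = (\<lambda>p. if p < n then b p else e)"
  have bS: "b p \<in> S" "inner (b p) e = 0" if "p < n" for p using onbD(2)[OF b(1) that] S' by auto
  have "onb S (dim S) b'"
  proof (rule onb_subspace_dim[OF S _ refl])
    show "b' p \<in> S" if "p < dim S" for p using bS e by (auto simp: b'_def)
    show "inner (b' p) (b' q) = (if p = q then 1 else 0)" if "p < dim S" "q < dim S" for p q
      using that Suc.hyps(2)[symmetric] bS e onbD(3)[OF b(1)]
      by (auto simp: b'_def inner_commute norm_eq_1 less_Suc_eq)
  qed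
  moreover have "inner (A (b' p)) (b' q) = 0" if "p < dim S" "q < dim S" "p \<noteq> q" for p q
  proof -
    have "inner (A (b p)) e = 0" if "p < n" for p
      using A bS[OF that] e(1) e(3)[OF bS[OF that]] unfolding self_adjoint_on_def by (metis inner_commute)
    then show ?thesis
      using that Suc.hyps(2)[symmetric] bS e b(2) by (auto simp: b'_def less_Suc_eq)
  qed
  ultimately show ?case by blast
qed

lemma linear_map_on_id: "linear_map_on S S (\<lambda>x. x)"
  by (auto simp: linear_map_on_def)

lemma onb_exists: 
  fixes S :: "'a::euclidean_space set"
  assumes "subspace S" obtains b where "onb S (dim S) b"
  using spectral_theorem_on[OF assms, of "\<lambda>x. x"] by (auto simp: self_adjoint_on_def linear_map_on_id)

subsection \<open>Determinants\<close>

text \<open>The family \<open>v\<close> may be arbitrary, even dependent. For the identity operator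
  this is the Gram determinant of \<open>v\<close>.\<close>

definition opdet :: "('a::euclidean_space \<Rightarrow> 'a) \<Rightarrow> (nat \<Rightarrow> 'a) \<Rightarrow> nat \<Rightarrow> real" where
  "opdet A v n = Determinant.det (Matrix.mat n n (\<lambda>(p, q). inner (v p) (A (v q))))"

lemma det_Leibniz:
  "Determinant.det (Matrix.mat n n f) =
     (\<Sum>s | s permutes {0..<n}. signof s * (\<Prod>i = 0..<n. f (i, s i)))"
proof -
  have "(\<Prod>i = 0..<n. Matrix.mat n n f $$ (i, s i)) = (\<Prod>i = 0..<n. f (i, s i))"
    if "s permutes {0..<n}" for s
    using permutes_in_image[OF that] by (intro prod.cong) auto
  then show ?thesis by (subst det_def'[of _ n]) (auto intro!: sum.cong)
qed

lemma det_diagonal: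
  assumes "\<And>p q. p < n \<Longrightarrow> q < n \<Longrightarrow> p \<noteq> q \<Longrightarrow> f (p, q) = (0::real)"
  shows "Determinant.det (Matrix.mat n n f) = (\<Prod>p<n. f (p, p))"
proof -
  have "Determinant.det (Matrix.mat n n f) = prod_list (diag_mat (Matrix.mat n n f))"
    by (rule det_upper_triangular[of _ n]) (use assms in auto)
  also have "\<dots> = (\<Prod>p<n. f (p, p))"
    unfolding prod_list_diag_prod by (auto intro!: prod.cong)
  finally show ?thesis .
qed

text \<open>By the Leibniz formula the determinant is a polynomial in the entries. Operator and
  vectors may both vary: \<open>det_on_tendsto\<close> fixes the vectors, and the limit of Gram
  determinants in \<open>subsequence_bound\<close> fixes the operator.\<close>

lemma opdet_tendsto:
  fixes A :: "nat \<Rightarrow> 'a::euclidean_space \<Rightarrow> 'a"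
  assumes "\<And>q. q < n \<Longrightarrow> (\<lambda>s. v s q) \<longlonglongrightarrow> w q"
    and "\<And>q. q < n \<Longrightarrow> (\<lambda>s. A s (v s q)) \<longlonglongrightarrow> L (w q)"
  shows "(\<lambda>s. opdet (A s) (v s) n) \<longlonglongrightarrow> opdet L w n"
  unfolding opdet_def det_Leibniz
proof (intro tendsto_sum tendsto_mult tendsto_const tendsto_prod)
  fix s i assume "s \<in> {s. s permutes {0..<n}}" "i \<in> {0..<n}"
  then have "i < n" "s i < n" using permutes_in_image[of s "{0..<n}" i] by auto
  then show "(\<lambda>t. case (i, s i) of (p, q) \<Rightarrow> inner (v t p) (A t (v t q)))
      \<longlonglongrightarrow> (case (i, s i) of (p, q) \<Rightarrow> inner (w p) (L (w q)))"
    using assms by (auto intro!: tendsto_inner)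
qed

lemma onb_coeff_matrix_mult:
  assumes b: "onb S n b" and A: "linear_map_on S S A" and v: "\<And>p. p < n \<Longrightarrow> v p \<in> S"
    and u: "\<And>p. p < n \<Longrightarrow> u p \<in> S"
  shows "Matrix.mat n n (\<lambda>(p, q). inner (u p) (A (v q))) =
     Matrix.mat n n (\<lambda>(p, q). inner (u p) (b q))
       * (Matrix.mat n n (\<lambda>(p, q). inner (b p) (A (b q)))
       * transpose_mat (Matrix.mat n n (\<lambda>(p, q). inner (v p) (b q))))"
proof (rule eq_matI)
  fix p q assume "p < dim_row (Matrix.mat n n (\<lambda>(p, q). inner (u p) (b q))
       * (Matrix.mat n n (\<lambda>(p, q). inner (b p) (A (b q)))
       * transpose_mat (Matrix.mat n n (\<lambda>(p, q). inner (v p) (b q)))))"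
    "q < dim_col (Matrix.mat n n (\<lambda>(p, q). inner (u p) (b q))
       * (Matrix.mat n n (\<lambda>(p, q). inner (b p) (A (b q)))
       * transpose_mat (Matrix.mat n n (\<lambda>(p, q). inner (v p) (b q)))))"
  then have pq: "p < n" "q < n" by auto
  have "A (v q) = A (\<Sum>r<n. inner (v q) (b r) *\<^sub>R b r)"
    using onbD(4)[OF b v[OF pq(2)]] by simp
  also have "\<dots> = (\<Sum>r<n. inner (v q) (b r) *\<^sub>R A (b r))"
    using onbD[OF b] by (intro linear_map_on_sum[OF A]) auto
  finally have Av: "A (v q) = (\<Sum>r<n. inner (v q) (b r) *\<^sub>R A (b r))" .
  have up: "inner (u p) y = (\<Sum>t<n. inner (u p) (b t) * inner (b t) y)" for y
  proof -
    have "inner (u p) y = inner (\<Sum>t<n. inner (u p) (b t) *\<^sub>R b t) y"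
      using onbD(4)[OF b u[OF pq(1)]] by simp
    then show ?thesis by (simp add: inner_sum_left)
  qed
  show "Matrix.mat n n (\<lambda>(p, q). inner (u p) (A (v q))) $$ (p, q) =
     (Matrix.mat n n (\<lambda>(p, q). inner (u p) (b q))
       * (Matrix.mat n n (\<lambda>(p, q). inner (b p) (A (b q)))
       * transpose_mat (Matrix.mat n n (\<lambda>(p, q). inner (v p) (b q))))) $$ (p, q)"
  proof -
    have "inner (u p) (A (v q)) = (\<Sum>t<n. inner (u p) (b t) * (\<Sum>r<n. inner (b t) (A (b r)) * inner (v q) (b r)))"
      unfolding up[of "A (v q)"] unfolding Av by (simp add: inner_sum_right mult.commute)
    then show ?thesis using pq by (simp add: scalar_prod_def atLeast0LessThan)
  qed
qed auto

lemma det_congruence: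
  fixes Q M :: "real mat"
  assumes Q: "Q \<in> carrier_mat n n" and M: "M \<in> carrier_mat n n"
  shows "Determinant.det (Q * (M * transpose_mat Q)) =
     Determinant.det Q * (Determinant.det M * Determinant.det Q)"
proof -
  have T: "transpose_mat Q \<in> carrier_mat n n" using Q by simp
  show ?thesis
    using det_mult[OF Q mult_carrier_mat[OF M T]] det_mult[OF M T] det_transpose[OF Q] by simp
qed

text \<open>If Q is the coefficient matrix of \<open>v\<close> in the basis \<open>b\<close>, the
  matrix of the form on \<open>v\<close> is Q M Q^T, with M its matrix on \<open>b\<close>. For the
  identity M is the unit matrix, which identifies the square of det Q with the Gram
  determinant.\<close>

lemma opdet_change_basis:
  assumes b: "onb S n b" and A: "linear_map_on S S A" and v: "\<And>p. p < n \<Longrightarrow> v p \<in> S"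
  shows "opdet A v n = opdet A b n * opdet (\<lambda>x. x) v n"
    and "opdet (\<lambda>x. x) v n = (Determinant.det (Matrix.mat n n (\<lambda>(p, q). inner (v p) (b q))))\<^sup>2"
proof -
  let ?Q = "Matrix.mat n n (\<lambda>(p, q). inner (v p) (b q))"
  let ?M = "\<lambda>A. Matrix.mat n n (\<lambda>(p, q). inner (b p) (A (b q)))"
  have *: "opdet A v n = opdet A b n * (Determinant.det ?Q)\<^sup>2" if "linear_map_on S S A" for A
  proof -
    have "opdet A v n = Determinant.det (?Q * (?M A * transpose_mat ?Q))"
      unfolding opdet_def by (rule arg_cong[OF onb_coeff_matrix_mult[OF b that v v]])
    also have "\<dots> = Determinant.det ?Q * (Determinant.det (?M A) * Determinant.det ?Q)"
      using det_congruence[of ?Q n "?M A"] by simp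
    finally show ?thesis by (simp add: opdet_def power2_eq_square)
  qed
  have "opdet (\<lambda>x. x) b n = 1"
    unfolding opdet_def by (subst det_diagonal) (auto simp: onbD(3)[OF b])
  with *[OF linear_map_on_id] show 1: "opdet (\<lambda>x. x) v n = (Determinant.det ?Q)\<^sup>2" by simp
  show "opdet A v n = opdet A b n * opdet (\<lambda>x. x) v n" using *[OF A] 1 by simp
qed

text \<open>The basis inside \<open>det_on\<close> is an unspecified choice. It has Gram determinant
  1, so the change-of-basis formula gives the same value in any other orthonormal basis.\<close>

lemma det_on_eq_opdet:
  fixes S :: "'a::euclidean_space set"
  assumes S: "onb S n b" and A: "linear_map_on S S A"
  shows "det_on S A = opdet A b n"
proof -
  define bs where "bs = (SOME bs. orthonormal_basis_of S bs)"
  have len: "n = dim S" using onb_dim[OF S] by simp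
  have "orthonormal_basis_of S (map b [0..<n])"
    unfolding orthonormal_basis_of_def
    using onbD[OF S] onb_span[OF S] orthonormal_family_independent(1)[of "{..<n}" b]
    by (auto simp: distinct_map atLeast0LessThan pairwise_def norm_eq_1 lessThan_def)
  then have bs: "orthonormal_basis_of S bs"
    unfolding bs_def by (rule someI)
  have "onb S (length bs) (\<lambda>p. bs ! p)"
  proof (rule onbI)
    show "inner (bs ! p) (bs ! q) = (if p = q then 1 else 0)" if "p < length bs" "q < length bs" for p q
      using bs that unfolding orthonormal_basis_of_def
      by (auto simp: pairwise_def nth_eq_iff_index_eq norm_eq_1)
    have "(\<lambda>p. bs ! p) ` {..<length bs} = set bs" by (auto simp: set_conv_nth)
    then show "span ((!) bs ` {..<length bs}) = S" using bs unfolding orthonormal_basis_of_def by simp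
  qed
  moreover from onb_dim[OF this] have "length bs = n" using len by simp
  ultimately have b: "onb S n (\<lambda>p. bs ! p)" by simp
  have one: "opdet (\<lambda>x. x) ((!) bs) n = 1"
    unfolding opdet_def by (subst det_diagonal) (auto simp: onbD(3)[OF b])
  have "det_on S A = opdet A (\<lambda>p. bs ! p) n"
    unfolding det_on_def opdet_def Let_def bs_def[symmetric] \<open>length bs = n\<close> ..
  also have "\<dots> = opdet A b n"
    using opdet_change_basis(1)[OF S A, of "(!) bs"] onbD(2)[OF b] one by simp
  finally show ?thesis .
qed

lemma opdet_eq_det_on_mult:
  fixes S :: "'a::euclidean_space set"
  assumes "subspace S" "linear_map_on S S A" "\<And>p. p < dim S \<Longrightarrow> v p \<in> S"
  shows "opdet A v (dim S) = det_on S A * opdet (\<lambda>x. x) v (dim S)"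
proof -
  obtain b where b: "onb S (dim S) b" using onb_exists[OF assms(1)] .
  show ?thesis using opdet_change_basis(1)[OF b assms(2,3)] det_on_eq_opdet[OF b assms(2)] by simp
qed

lemma det_on_diagonal:
  assumes "onb S n b" "linear_map_on S S A" "\<And>p q. p < n \<Longrightarrow> q < n \<Longrightarrow> p \<noteq> q \<Longrightarrow> inner (A (b p)) (b q) = 0"
  shows "det_on S A = (\<Prod>p<n. inner (A (b p)) (b p))"
  unfolding det_on_eq_opdet[OF assms(1,2)] opdet_def
  by (subst det_diagonal) (use assms(3) in \<open>auto simp: inner_commute\<close>)

lemma span_lessThan_explicit:
  "x \<in> span (v ` {..<n::nat}) \<Longrightarrow> \<exists>r. x = (\<Sum>q<n. r q *\<^sub>R v q)"
proof (induction n arbitrary: x)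
  case (Suc n)
  then obtain t where "x - t *\<^sub>R v n \<in> span (v ` {..<n})"
    by (auto simp: lessThan_Suc span_breakdown_eq)
  from Suc.IH[OF this] obtain r where r: "x - t *\<^sub>R v n = (\<Sum>q<n. r q *\<^sub>R v q)" by blast
  have "(\<Sum>q<n. (r(n := t)) q *\<^sub>R v q) = (\<Sum>q<n. r q *\<^sub>R v q)" by (rule sum.cong) auto
  then have "x = (\<Sum>q<Suc n. (r(n := t)) q *\<^sub>R v q)" using r by (simp add: algebra_simps)
  then show ?case by blast
qed simp

text \<open>The Gram determinant is the square of the determinant of the coefficient matrix.
  Expanding an orthonormal basis in the spanning family \<open>v\<close> provides a left inverse of
  that matrix, so the determinant is nonzero.\<close>

lemma gram_det_pos:
  fixes S :: "'a::euclidean_space set"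
  assumes S: "subspace S" and v: "span (v ` {..<dim S}) = S"
  shows "0 < opdet (\<lambda>x. x) v (dim S)"
proof -
  obtain b where b: "onb S (dim S) b" using onb_exists[OF S] .
  have vS: "v p \<in> S" if "p < dim S" for p using v that by (metis imageI lessThan_iff span_base)
  let ?n = "dim S"
  let ?Q = "Matrix.mat ?n ?n (\<lambda>(p, q). inner (v p) (b q))"
  have "\<exists>r. b p = (\<Sum>q<?n. r q *\<^sub>R v q)" if "p < ?n" for p
  proof -
    have "b p \<in> span (v ` {..<?n})" using v onbD(2)[OF b that] by simp
    then show ?thesis by (rule span_lessThan_explicit)
  qed
  then obtain r where r: "\<And>p. p < ?n \<Longrightarrow> b p = (\<Sum>q<?n. r p q *\<^sub>R v q)" by metis
  have "Matrix.mat ?n ?n (\<lambda>(p, q). r p q) * ?Q = 1\<^sub>m ?n"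
  proof (rule eq_matI)
    fix p q assume "p < dim_row (1\<^sub>m ?n)" "q < dim_col (1\<^sub>m ?n)"
    then have pq: "p < ?n" "q < ?n" by auto
    have "(\<Sum>t<?n. r p t * inner (v t) (b q)) = inner (b p) (b q)"
      using r[OF pq(1)] by (simp add: inner_sum_left)
    then show "(Matrix.mat ?n ?n (\<lambda>(p, q). r p q) * ?Q) $$ (p, q) = 1\<^sub>m ?n $$ (p, q)"
      using pq onbD(3)[OF b pq] by (simp add: scalar_prod_def atLeast0LessThan)
  qed auto
  then have "Determinant.det (Matrix.mat ?n ?n (\<lambda>(p, q). r p q)) * Determinant.det ?Q = 1"
    by (metis det_mult det_one mat_carrier)
  then have "Determinant.det ?Q \<noteq> 0" by auto
  then show ?thesis
    using opdet_change_basis(2)[OF b linear_map_on_id vS] by simp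
qed

section \<open>Inequalities for semidefinite operators\<close>

lemma pos_semidef_on_Cauchy_Schwarz:
  assumes A: "pos_semidef_on S A" and S: "subspace S" and x: "x \<in> S" and y: "y \<in> S"
  shows "(inner (A x) y)\<^sup>2 \<le> inner (A x) x * inner (A y) y"
proof -
  have lin: "linear_map_on S S A" and sym: "inner (A y) x = inner (A x) y"
    and nn: "\<And>z. z \<in> S \<Longrightarrow> 0 \<le> inner (A z) z"
    using A x y by (auto simp: pos_semidef_on_def self_adjoint_on_def inner_commute)
  have q: "0 \<le> inner (A x) x + 2 * t * inner (A x) y + t\<^sup>2 * inner (A y) y" for t
  proof -
    have "A (x + t *\<^sub>R y) = A x + t *\<^sub>R A y"
      using lin x y S by (simp add: linear_map_on_def subspace_scale)
    then have "inner (A (x + t *\<^sub>R y)) (x + t *\<^sub>R y) = inner (A x) x + 2 * t * inner (A x) y + t\<^sup>2 * inner (A y) y"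
      using sym by (simp add: inner_add_left inner_add_right algebra_simps power2_eq_square)
    then show ?thesis using nn[of "x + t *\<^sub>R y"] S x y by (simp add: subspace_add subspace_scale)
  qed
  show ?thesis
  proof (cases "inner (A y) y = 0")
    case True
    have "0 \<le> 2 * inner (A x) y * t + inner (A x) x" for t using q[of t] True by (simp add: algebra_simps)
    \<comment> \<open>The degenerate case that semidefiniteness permits: an affine function of
      \<open>t\<close> that is nowhere negative has slope 0.\<close>
    moreover have "inner (A x) y = 0"
    proof (rule ccontr)
      assume n: "inner (A x) y \<noteq> 0"
      have "2 * inner (A x) y * (- (inner (A x) x + 1) / (2 * inner (A x) y)) + inner (A x) x = -1"
        using n by (simp add: field_simps)
      with \<open>\<And>t. 0 \<le> 2 * inner (A x) y * t + inner (A x) x\<close> show False by (metis neg_0_le_iff_le not_one_le_zero)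
    qed
    ultimately show ?thesis using True by simp
  next
    case False
    then have pos: "inner (A y) y > 0" using nn[OF y] by simp
    \<comment> \<open>The minimizer of the quadratic in \<open>t\<close>.\<close>
    let ?t = "- (inner (A x) y / inner (A y) y)"
    have "0 \<le> inner (A x) x - (inner (A x) y)\<^sup>2 / inner (A y) y"
      using q[of ?t] pos by (simp add: power2_eq_square)
    then show ?thesis using pos by (simp add: field_simps)
  qed
qed

text \<open>A crude form of Hadamard's inequality; the constant \<open>n!\<close> is harmless because only
  finiteness and coercivity are at stake.\<close>

lemma opdet_le_fact_prod:
  assumes A: "pos_semidef_on S A" and S: "subspace S" and v: "\<And>p. p < n \<Longrightarrow> v p \<in> S"
  shows "opdet A v n \<le> fact n * (\<Prod>p<n. inner (A (v p)) (v p))"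
proof -
  let ?g = "\<lambda>p. inner (A (v p)) (v p)"
  have nn: "0 \<le> ?g p" if "p < n" for p using A v[OF that] by (simp add: pos_semidef_on_def)
  have entry: "\<bar>inner (v p) (A (v q))\<bar> \<le> sqrt (?g p) * sqrt (?g q)" if "p < n" "q < n" for p q
    using pos_semidef_on_Cauchy_Schwarz[OF A S v[OF that(2)] v[OF that(1)]]
    by (metis inner_commute mult.commute real_sqrt_abs real_sqrt_le_mono real_sqrt_mult)
  have "signof s * (\<Prod>i = 0..<n. inner (v i) (A (v (s i)))) \<le> (\<Prod>p<n. ?g p)"
    if s: "s permutes {0..<n}" for s
  proof -
    have "signof s * (\<Prod>i = 0..<n. inner (v i) (A (v (s i)))) \<le> \<bar>\<Prod>i = 0..<n. inner (v i) (A (v (s i)))\<bar>"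
      by (auto simp: sign_def)
    also have "\<dots> = (\<Prod>i = 0..<n. \<bar>inner (v i) (A (v (s i)))\<bar>)" by (simp add: abs_prod)
    also have "\<dots> \<le> (\<Prod>i = 0..<n. sqrt (?g i) * sqrt (?g (s i)))"
      using permutes_in_image[OF s] by (intro prod_mono conjI entry) auto
    \<comment> \<open>A permutation meets every column exactly once, so the product of the column
      factors is that of the row factors.\<close>
    also have "\<dots> = (\<Prod>i = 0..<n. sqrt (?g i)) * (\<Prod>i = 0..<n. sqrt (?g i))"
      using prod.permute[OF s, of "\<lambda>i. sqrt (?g i)"] by (simp add: prod.distrib o_def)
    also have "\<dots> = (\<Prod>i = 0..<n. ?g i)"
      using nn by (simp add: prod.distrib[symmetric])
    finally show ?thesis by (simp add: atLeast0LessThan)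
  qed
  then have "opdet A v n \<le> (\<Sum>s | s permutes {0..<n}. \<Prod>p<n. ?g p)"
    unfolding opdet_def det_Leibniz by (intro sum_mono) auto
  also have "\<dots> = fact n * (\<Prod>p<n. ?g p)"
    by (simp add: card_permutations[OF refl])
  finally show ?thesis .
qed

lemma diagonal_quadratic_form:
  assumes b: "onb S n b" and A: "linear_map_on S S A"
    and diag: "\<And>p q. p < n \<Longrightarrow> q < n \<Longrightarrow> p \<noteq> q \<Longrightarrow> inner (A (b p)) (b q) = 0" and x: "x \<in> S"
  shows "inner (A x) x = (\<Sum>p<n. (inner x (b p))\<^sup>2 * inner (A (b p)) (b p))"
proof -
  have xe: "x = (\<Sum>p<n. inner x (b p) *\<^sub>R b p)" using onbD(4)[OF b x] .
  have "A x = A (\<Sum>p<n. inner x (b p) *\<^sub>R b p)" using xe by simp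
  also have "\<dots> = (\<Sum>p<n. inner x (b p) *\<^sub>R A (b p))"
    using onbD[OF b] by (intro linear_map_on_sum[OF A]) auto
  finally have Ax: "inner (A x) x = (\<Sum>p<n. inner x (b p) * inner (A (b p)) x)"
    by (simp add: inner_sum_left)
  have "inner (A (b p)) x = inner x (b p) * inner (A (b p)) (b p)" if p: "p < n" for p
  proof -
    have "inner (A (b p)) x = (\<Sum>q<n. inner x (b q) * inner (A (b p)) (b q))"
      by (subst xe) (simp add: inner_sum_right)
    also have "\<dots> = (\<Sum>q<n. if q = p then inner x (b p) * inner (A (b p)) (b p) else 0)"
      using diag p by (intro sum.cong) auto
    finally show ?thesis using p by simp
  qed
  then show ?thesis unfolding Ax by (intro sum.cong) (auto simp: power2_eq_square)
qed

lemma pos_def_on_linear: "pos_def_on S A \<Longrightarrow> linear_map_on S S A"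
  by (simp add: pos_def_on_def self_adjoint_on_def)

lemma pos_semidef_on_linear: "pos_semidef_on S A \<Longrightarrow> linear_map_on S S A"
  by (simp add: pos_semidef_on_def self_adjoint_on_def)

lemma pos_def_on_imp_semidef: "pos_def_on S A \<Longrightarrow> pos_semidef_on S A"
  unfolding pos_def_on_def pos_semidef_on_def
  by (metis inner_zero_right less_eq_real_def)

lemma det_on_pos_def:
  assumes S: "subspace S" and A: "pos_def_on S A"
  shows "0 < det_on S A"
proof -
  obtain b where b: "onb S (dim S) b"
    and diag: "\<And>p q. p < dim S \<Longrightarrow> q < dim S \<Longrightarrow> p \<noteq> q \<Longrightarrow> inner (A (b p)) (b q) = 0"
    using spectral_theorem_on[OF S] A by (metis pos_def_on_def)
  have "0 < inner (A (b p)) (b p)" if "p < dim S" for p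
  proof -
    have "b p \<noteq> 0" using onbD(3)[OF b that that] by auto
    then show ?thesis using A onbD(2)[OF b that] by (simp add: pos_def_on_def)
  qed
  then show ?thesis
    using det_on_diagonal[OF b pos_def_on_linear[OF A] diag] by (simp, intro prod_pos) auto
qed

text \<open>Nonnegative eigenvalues with a nonzero product are positive. This upgrades limits of
  positive-definite operators, for which semidefiniteness is all that passes to the limit.\<close>

lemma pos_semidef_on_det_nonzero:
  assumes S: "subspace S" and A: "pos_semidef_on S A" and nz: "det_on S A \<noteq> 0"
  shows "pos_def_on S A"
proof -
  have lin: "linear_map_on S S A" and sa: "self_adjoint_on S A"
    using A by (auto simp: pos_semidef_on_def self_adjoint_on_def)
  obtain b where b: "onb S (dim S) b"
    and diag: "\<And>p q. p < dim S \<Longrightarrow> q < dim S \<Longrightarrow> p \<noteq> q \<Longrightarrow> inner (A (b p)) (b q) = 0"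
    using spectral_theorem_on[OF S sa] by metis
  have nn: "0 \<le> inner (A (b p)) (b p)" if "p < dim S" for p
    using A onbD(2)[OF b that] by (simp add: pos_semidef_on_def)
  have "(\<Prod>p<dim S. inner (A (b p)) (b p)) \<noteq> 0"
    using nz det_on_diagonal[OF b lin diag] by simp
  then have pos: "0 < inner (A (b p)) (b p)" if "p < dim S" for p
    using nn[OF that] that by (simp add: less_le)
  have "0 < inner (A x) x" if x: "x \<in> S" "x \<noteq> 0" for x
  proof -
    have "\<exists>p<dim S. inner x (b p) \<noteq> 0"
    proof (rule ccontr)
      assume "\<not> ?thesis"
      then have "(\<Sum>p<dim S. inner x (b p) *\<^sub>R b p) = 0" by (intro sum.neutral) auto
      with onbD(4)[OF b x(1)] x(2) show False by simp
    qed
    then obtain p where p: "p < dim S" "inner x (b p) \<noteq> 0" by blast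
    have "inner (A x) x = (\<Sum>p<dim S. (inner x (b p))\<^sup>2 * inner (A (b p)) (b p))"
      by (rule diagonal_quadratic_form[OF b lin _ x(1)]) (use diag in auto)
    then show ?thesis
      unfolding \<open>inner (A x) x = _\<close> using pos p
      by (intro sum_pos2[of _ p]) (auto intro!: mult_nonneg_nonneg less_imp_le[OF pos])
  qed
  with sa show ?thesis by (simp add: pos_def_on_def)
qed

section \<open>Dilations and operators with two eigenvalues\<close>

lemma linear_map_on_scaleR:
  "linear_map_on S T A \<Longrightarrow> subspace T \<Longrightarrow> linear_map_on S T (\<lambda>x. t *\<^sub>R A x)"
  by (auto simp: linear_map_on_def subspace_scale scaleR_add_right image_subset_iff)

lemma pos_def_on_scaleR:
  "pos_def_on S A \<Longrightarrow> subspace S \<Longrightarrow> 0 < t \<Longrightarrow> pos_def_on S (\<lambda>x. t *\<^sub>R A x)"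
  by (auto simp: pos_def_on_def self_adjoint_on_def linear_map_on_scaleR)

lemma det_on_scaleR:
  assumes S: "subspace S" and A: "linear_map_on S S A"
  shows "det_on S (\<lambda>x. t *\<^sub>R A x) = t ^ dim S * det_on S A"
proof -
  obtain b where b: "onb S (dim S) b" using onb_exists[OF S] .
  show ?thesis
    unfolding det_on_eq_opdet[OF b A] det_on_eq_opdet[OF b linear_map_on_scaleR[OF A S]]
      opdet_def det_Leibniz
    by (simp add: prod.distrib sum_distrib_left mult_ac)
qed

text \<open>Eigenvalue \<open>a\<close> on \<open>T\<close> and \<open>b\<close> on its orthogonal
  complement in the ambient space; the same formula therefore acts on every subspace containing
  \<open>T\<close>.\<close>

definition stretch :: "'a::euclidean_space set \<Rightarrow> real \<Rightarrow> real \<Rightarrow> 'a \<Rightarrow> 'a" where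
  "stretch T a b x = a *\<^sub>R orth_proj T x + b *\<^sub>R (x - orth_proj T x)"

lemma inner_stretch:
  assumes "subspace T"
  shows "inner (stretch T a b x) x = a * (norm (orth_proj T x))\<^sup>2 + b * (norm (x - orth_proj T x))\<^sup>2"
proof -
  have 1: "inner (orth_proj T x) x = (norm (orth_proj T x))\<^sup>2"
    using orth_proj_inner[OF assms orth_proj_in[OF assms], of x x]
    by (simp add: power2_norm_eq_inner inner_commute)
  then have "inner (x - orth_proj T x) x = (norm (x - orth_proj T x))\<^sup>2"
    by (simp add: power2_norm_eq_inner inner_diff_left inner_diff_right inner_commute)
  with 1 show ?thesis by (simp add: stretch_def inner_add_left)
qed

text \<open>Pythagoras, read off from the fact that \<open>stretch T 1 1\<close> is the
  identity.\<close>

lemma norm_orth_proj_le: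
  fixes T :: "'a::euclidean_space set"
  assumes T: "subspace T"
  shows "(norm (orth_proj T x))\<^sup>2 \<le> (norm x)\<^sup>2" "(norm (x - orth_proj T x))\<^sup>2 \<le> (norm x)\<^sup>2"
proof -
  have "inner (stretch T 1 1 x) x = (norm x)\<^sup>2" by (simp add: stretch_def power2_norm_eq_inner)
  with inner_stretch[OF T, where a = 1 and b = 1 and x = x]
  have "(norm x)\<^sup>2 = (norm (orth_proj T x))\<^sup>2 + (norm (x - orth_proj T x))\<^sup>2" by simp
  then show "(norm (orth_proj T x))\<^sup>2 \<le> (norm x)\<^sup>2" "(norm (x - orth_proj T x))\<^sup>2 \<le> (norm x)\<^sup>2"
    by auto
qed

lemma pos_def_on_stretch:
  assumes S: "subspace S" and T: "subspace T" "T \<subseteq> S" and ab: "0 < a" "0 < b"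
  shows "pos_def_on S (stretch T a b)"
proof -
  have "linear_map_on S S (stretch T a b)"
    using S T orth_proj_in[OF T(1)] linear_orth_proj[OF T(1)]
    unfolding linear_map_on_def stretch_def
    by (auto simp: subspace_add subspace_scale subspace_diff linear_add linear_scale subsetD algebra_simps)
  moreover have "inner (stretch T a b x) y = inner x (stretch T a b y)" for x y
    unfolding stretch_def inner_add_left inner_add_right
    by (simp add: inner_diff_left inner_diff_right inner_orth_proj_commute[OF T(1), of x y])
  moreover have "0 < inner (stretch T a b x) x" if "x \<noteq> 0" for x
    unfolding inner_stretch[OF T(1)]
  proof (cases "orth_proj T x = 0")
    case True
    then show "0 < a * (norm (orth_proj T x))\<^sup>2 + b * (norm (x - orth_proj T x))\<^sup>2" using that ab by simp
  next
    case False
    then show "0 < a * (norm (orth_proj T x))\<^sup>2 + b * (norm (x - orth_proj T x))\<^sup>2" using ab by (simp add: add_pos_nonneg)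
  qed
  ultimately show ?thesis by (simp add: pos_def_on_def self_adjoint_on_def)
qed

lemma prod_if_lessThan:
  fixes a b :: real
  assumes "t \<le> n" shows "(\<Prod>p<n. if p < t then a else b) = a ^ t * b ^ (n - t)"
  using assms by (induction n rule: dec_induct) (auto simp: Suc_diff_le)

text \<open>The operator is diagonal in an orthonormal basis of \<open>T\<close> continued by one of
  the complement of \<open>T\<close> in \<open>S\<close>.\<close>

lemma det_on_stretch:
  fixes S :: "'a::euclidean_space set"
  assumes S: "subspace S" and T: "subspace T" "T \<subseteq> S" and ab: "0 < a" "0 < b"
  shows "det_on S (stretch T a b) = a ^ dim T * b ^ (dim S - dim T)"
proof -
  define T' where "T' = {y \<in> S. \<forall>x\<in>T. real_inner_class.orthogonal x y}"
  have sT': "subspace T'"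
    using S unfolding T'_def subspace_def
    by (auto simp: Linear_Algebra.orthogonal_def inner_add_right)
  have "dim T' + dim T = dim S"
    unfolding T'_def by (rule dim_subspace_orthogonal_to_vectors) (use S T in auto)
  then have dT': "dim T' = dim S - dim T" and le: "dim T \<le> dim S" by auto
  obtain u where u: "onb T (dim T) u" using onb_exists[OF T(1)] .
  obtain w where w: "onb T' (dim T') w" using onb_exists[OF sT'] .
  define e where "e = (\<lambda>p. if p < dim T then u p else w (p - dim T))"
  have wT: "inner x (w p) = 0" "w p \<in> S" if "x \<in> T" "p < dim T'" for x p
    using onbD(2)[OF w that(2)] that(1) by (auto simp: T'_def Linear_Algebra.orthogonal_def)
  have e: "onb S (dim S) e"
  proof (rule onb_subspace_dim[OF S _ refl])
    show "e p \<in> S" if "p < dim S" for p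
      using that onbD(2)[OF u] onbD(2)[OF w] T(2) dT' by (auto simp: e_def T'_def)
    show "inner (e p) (e q) = (if p = q then 1 else 0)" if "p < dim S" "q < dim S" for p q
      using that onbD[OF u] onbD[OF w] wT dT' by (auto simp: e_def inner_commute)
  qed
  have se: "stretch T a b (e p) = (if p < dim T then a else b) *\<^sub>R e p" if "p < dim S" for p
  proof (cases "p < dim T")
    case True
    then show ?thesis using onbD(2)[OF u True] by (simp add: stretch_def e_def orth_proj_ident[OF T(1)])
  next
    case False
    then have "orth_proj T (e p) = 0"
      using that dT' wT by (intro orth_proj_zero T) (auto simp: e_def inner_commute)
    then show ?thesis using False by (simp add: stretch_def)
  qed
  have "det_on S (stretch T a b) = (\<Prod>p<dim S. inner (stretch T a b (e p)) (e p))"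
    using e pos_def_on_linear[OF pos_def_on_stretch[OF S T ab]]
    by (rule det_on_diagonal) (simp add: se onbD(3)[OF e])
  also have "\<dots> = (\<Prod>p<dim S. if p < dim T then a else b)"
    by (rule prod.cong) (auto simp: se onbD(3)[OF e])
  finally show ?thesis using prod_if_lessThan[OF le] by simp
qed

subsection \<open>Compactness\<close>

lemma common_convergent_subsequence:
  fixes f :: "'i \<Rightarrow> nat \<Rightarrow> 'a::heine_borel"
  assumes "finite I" "\<And>i. i \<in> I \<Longrightarrow> bounded (range (f i))"
  shows "\<exists>r. strict_mono r \<and> (\<forall>i\<in>I. \<exists>l. (\<lambda>s. f i (r s)) \<longlonglongrightarrow> l)"
  using assms
proof (induction I rule: finite_induct)
  case empty
  then show ?case using strict_mono_id by blast
next
  case (insert a I)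
  then obtain r where r: "strict_mono r" "\<And>i. i \<in> I \<Longrightarrow> \<exists>l. (\<lambda>s. f i (r s)) \<longlonglongrightarrow> l" by auto
  have "bounded (range (f a \<circ> r))"
    using insert.prems[of a] by (auto intro: bounded_subset)
  then obtain l q where q: "strict_mono q" "((f a \<circ> r) \<circ> q) \<longlonglongrightarrow> l"
    using bounded_imp_convergent_subsequence by blast
  have "\<exists>l. (\<lambda>s. f i ((r \<circ> q) s)) \<longlonglongrightarrow> l" if "i \<in> insert a I" for i
  proof (cases "i = a")
    case True
    then show ?thesis using q by (auto simp: o_def)
  next
    case False
    then have "i \<in> I" using that by simp
    then obtain l where "(\<lambda>s. f i (r s)) \<longlonglongrightarrow> l" using r(2) by blast
    from LIMSEQ_subseq_LIMSEQ[OF this q(1)] show ?thesis by (auto simp: o_def)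
  qed
  then show ?case using strict_mono_o[OF r(1) q(1)] by blast
qed

text \<open>Preimages of an orthonormal basis of the image are combined linearly; \<open>K\<close>
  is the sum of their norms.\<close>

lemma bounded_right_inverse:
  fixes f :: "'a::euclidean_space \<Rightarrow> 'b::euclidean_space"
  assumes f: "linear f" and S: "subspace S"
  shows "\<exists>K. \<forall>z\<in>f ` S. \<exists>y\<in>S. f y = z \<and> norm y \<le> K * norm z"
proof -
  obtain b where b: "onb (f ` S) (dim (f ` S)) b"
    using onb_exists[OF linear_subspace_image[OF f S]] .
  let ?n = "dim (f ` S)"
  have "\<exists>y\<in>S. f y = b p" if "p < ?n" for p using onbD(2)[OF b that] by force
  then obtain y where y: "\<And>p. p < ?n \<Longrightarrow> y p \<in> S \<and> f (y p) = b p" by metis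
  have "\<exists>x\<in>S. f x = z \<and> norm x \<le> (\<Sum>p<?n. norm (y p)) * norm z" if z: "z \<in> f ` S" for z
  proof (intro bexI conjI)
    let ?x = "\<Sum>p<?n. inner z (b p) *\<^sub>R y p"
    show "?x \<in> S" using y S by (intro subspace_sum subspace_scale) auto
    have "f ?x = (\<Sum>p<?n. inner z (b p) *\<^sub>R b p)"
      using y by (simp add: linear_sum[OF f] linear_scale[OF f])
    then show "f ?x = z" using onbD(4)[OF b z] by simp
    have "norm ?x \<le> (\<Sum>p<?n. norm (inner z (b p) *\<^sub>R y p))" by (rule norm_sum)
    also have "\<dots> \<le> (\<Sum>p<?n. norm (y p) * norm z)"
    proof (rule sum_mono)
      fix p assume "p \<in> {..<?n}"
      then have "norm (b p) = 1" using onbD(3)[OF b, of p p] by (simp add: norm_eq_1)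
      then have "\<bar>inner z (b p)\<bar> \<le> norm z" using Cauchy_Schwarz_ineq2[of z "b p"] by simp
      then show "norm (inner z (b p) *\<^sub>R y p) \<le> norm (y p) * norm z"
        by (simp add: mult.commute[of "norm (y p)"] mult_right_mono)
    qed
    finally show "norm ?x \<le> (\<Sum>p<?n. norm (y p)) * norm z" by (simp add: sum_distrib_right)
  qed
  then show ?thesis by blast
qed

text \<open>Cauchy-Schwarz for the form of \<open>A\<close> at \<open>z\<close> and
  \<open>A z\<close> bounds |A z|^4 by L^2 |z|^2 |A z|^2, which turns a bound on the quadratic form
  into a bound on the norm.\<close>

lemma pos_semidef_on_norm_le:
  assumes A: "pos_semidef_on S A" and S: "subspace S" and L: "0 \<le> L"
    and le: "\<And>z. z \<in> S \<Longrightarrow> inner (A z) z \<le> L * (norm z)\<^sup>2" and z: "z \<in> S"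
  shows "norm (A z) \<le> L * norm z"
proof (cases "A z = 0")
  case True
  then show ?thesis using L by simp
next
  case False
  have Az: "A z \<in> S" using A z by (auto simp: pos_semidef_on_def self_adjoint_on_def linear_map_on_def)
  have nn: "0 \<le> inner (A (A z)) (A z)" using A Az by (simp add: pos_semidef_on_def)
  have "((norm (A z))\<^sup>2)\<^sup>2 = (inner (A z) (A z))\<^sup>2" by (simp add: power2_norm_eq_inner)
  also have "\<dots> \<le> inner (A z) z * inner (A (A z)) (A z)"
    by (rule pos_semidef_on_Cauchy_Schwarz[OF A S z Az])
  also have "\<dots> \<le> (L * (norm z)\<^sup>2) * (L * (norm (A z))\<^sup>2)"
    using le[OF z] le[OF Az] nn L by (intro mult_mono) auto
  also have "\<dots> = (L * norm z)\<^sup>2 * (norm (A z))\<^sup>2" by (simp add: power2_eq_square)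
  finally have "(norm (A z))\<^sup>2 * (norm (A z))\<^sup>2 \<le> (L * norm z)\<^sup>2 * (norm (A z))\<^sup>2"
    by (simp add: power2_eq_square)
  then have "(norm (A z))\<^sup>2 \<le> (L * norm z)\<^sup>2"
    by (rule mult_right_le_imp_le) (use False in simp)
  then show ?thesis by (rule power2_le_imp_le) (use L in simp)
qed

text \<open>By linearity, convergence on bases suffices. The basis vectors of all \<open>S i\<close>
  form one finite family of sequences, so a single subsequence serves every
  \<open>i\<close>.\<close>

lemma operator_convergent_subsequence:
  fixes A :: "'i \<Rightarrow> nat \<Rightarrow> 'a::euclidean_space \<Rightarrow> 'a"
  assumes I: "finite I" and S: "\<And>i. i \<in> I \<Longrightarrow> subspace (S i)"
    and A: "\<And>i s. i \<in> I \<Longrightarrow> linear_map_on (S i) (S i) (A i s)"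
    and bd: "\<And>i s x. i \<in> I \<Longrightarrow> x \<in> S i \<Longrightarrow> norm (A i s x) \<le> L i * norm x"
  shows "\<exists>r G. strict_mono r \<and> (\<forall>i\<in>I. \<forall>x\<in>S i. (\<lambda>s. A i (r s) x) \<longlonglongrightarrow> G i x)"
proof -
  have "\<exists>b. onb (S i) (dim (S i)) b" if "i \<in> I" for i using onb_exists[OF S[OF that]] by metis
  then obtain b where b: "\<And>i. i \<in> I \<Longrightarrow> onb (S i) (dim (S i)) (b i)" by metis
  let ?P = "SIGMA i:I. {..<dim (S i)}"
  let ?f = "\<lambda>ip s. A (fst ip) s (b (fst ip) (snd ip))"
  have "bounded (range (?f ip))" if "ip \<in> ?P" for ip
  proof -
    obtain i p where ip: "ip = (i, p)" by (cases ip)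
    have i: "i \<in> I" "p < dim (S i)" using that ip by auto
    show ?thesis
      unfolding bounded_iff ip using bd[OF i(1) onbD(2)[OF b[OF i(1)] i(2)]] by auto
  qed
  moreover have "finite ?P" using I by auto
  ultimately obtain r where r: "strict_mono r" and cv: "\<forall>ip\<in>?P. \<exists>l. (\<lambda>s. ?f ip (r s)) \<longlonglongrightarrow> l"
    using common_convergent_subsequence[of ?P ?f] by blast
  have "(\<lambda>s. A i (r s) x) \<longlonglongrightarrow> lim (\<lambda>s. A i (r s) x)" if i: "i \<in> I" and x: "x \<in> S i" for i x
  proof -
    have "\<exists>l. (\<lambda>s. A i (r s) (b i p)) \<longlonglongrightarrow> l" if "p < dim (S i)" for p
    proof -
      have "(i, p) \<in> ?P" using i that by simp
      from cv[rule_format, OF this] show ?thesis by simp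
    qed
    then obtain l where l: "\<And>p. p < dim (S i) \<Longrightarrow> (\<lambda>s. A i (r s) (b i p)) \<longlonglongrightarrow> l p" by metis
    have "A i s x = (\<Sum>p<dim (S i). inner x (b i p) *\<^sub>R A i s (b i p))" for s
    proof -
      have "A i s x = A i s (\<Sum>p<dim (S i). inner x (b i p) *\<^sub>R b i p)" using onbD(4)[OF b[OF i] x] by simp
      also have "\<dots> = (\<Sum>p<dim (S i). inner x (b i p) *\<^sub>R A i s (b i p))"
        using onbD(2)[OF b[OF i]] by (intro linear_map_on_sum[OF A[OF i] S[OF i]]) auto
      finally show ?thesis .
    qed
    moreover have "(\<lambda>s. \<Sum>p<dim (S i). inner x (b i p) *\<^sub>R A i (r s) (b i p))
        \<longlonglongrightarrow> (\<Sum>p<dim (S i). inner x (b i p) *\<^sub>R l p)"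
      using l by (intro tendsto_sum tendsto_scaleR tendsto_const) auto
    ultimately have "(\<lambda>s. A i (r s) x) \<longlonglongrightarrow> (\<Sum>p<dim (S i). inner x (b i p) *\<^sub>R l p)" by simp
    then show ?thesis by (simp add: limI)
  qed
  then show ?thesis using r by (intro exI[of _ r] exI[of _ "\<lambda>i x. lim (\<lambda>s. A i (r s) x)"]) blast
qed

lemma pos_semidef_on_limit:
  fixes A :: "nat \<Rightarrow> 'a::euclidean_space \<Rightarrow> 'a"
  assumes S: "subspace S" and A: "\<And>s. pos_semidef_on S (A s)"
    and lim: "\<And>x. x \<in> S \<Longrightarrow> (\<lambda>s. A s x) \<longlonglongrightarrow> G x"
  shows "pos_semidef_on S G"
proof -
  have lin: "linear_map_on S S (A s)" for s
    using A by (simp add: pos_semidef_on_def self_adjoint_on_def)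
  have "G x \<in> S" if "x \<in> S" for x
  proof -
    have "A s x \<in> S" for s using lin[of s] that unfolding linear_map_on_def by blast
    then show ?thesis
      using closed_sequentially[OF closed_subspace[OF S], of "\<lambda>s. A s x"] lim[OF that] by blast
  qed
  moreover have "G (x + y) = G x + G y" if "x \<in> S" "y \<in> S" for x y
  proof (rule LIMSEQ_unique[OF lim])
    show "x + y \<in> S" using that S by (simp add: subspace_add)
    have "(\<lambda>s. A s x + A s y) \<longlonglongrightarrow> G x + G y" by (intro tendsto_add lim that)
    then show "(\<lambda>s. A s (x + y)) \<longlonglongrightarrow> G x + G y" using lin that by (simp add: linear_map_on_def)
  qed
  moreover have "G (r *\<^sub>R x) = r *\<^sub>R G x" if "x \<in> S" for r x
  proof (rule LIMSEQ_unique[OF lim])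
    show "r *\<^sub>R x \<in> S" using that S by (simp add: subspace_scale)
    have "(\<lambda>s. r *\<^sub>R A s x) \<longlonglongrightarrow> r *\<^sub>R G x" by (intro tendsto_scaleR tendsto_const lim that)
    then show "(\<lambda>s. A s (r *\<^sub>R x)) \<longlonglongrightarrow> r *\<^sub>R G x" using lin that by (simp add: linear_map_on_def)
  qed
  moreover have "inner (G x) y = inner x (G y)" if "x \<in> S" "y \<in> S" for x y
  proof (rule LIMSEQ_unique)
    show "(\<lambda>s. inner (A s x) y) \<longlonglongrightarrow> inner (G x) y" by (intro tendsto_inner tendsto_const lim that)
    have "(\<lambda>s. inner x (A s y)) \<longlonglongrightarrow> inner x (G y)" by (intro tendsto_inner tendsto_const lim that)
    then show "(\<lambda>s. inner (A s x) y) \<longlonglongrightarrow> inner x (G y)"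
      using A that by (simp add: pos_semidef_on_def self_adjoint_on_def)
  qed
  moreover have "0 \<le> inner (G x) x" if "x \<in> S" for x
  proof (rule LIMSEQ_le_const)
    show "(\<lambda>s. inner (A s x) x) \<longlonglongrightarrow> inner (G x) x" by (intro tendsto_inner tendsto_const lim that)
    show "\<exists>N. \<forall>s\<ge>N. 0 \<le> inner (A s x) x" using A that by (simp add: pos_semidef_on_def)
  qed
  ultimately show ?thesis
    unfolding pos_semidef_on_def self_adjoint_on_def linear_map_on_def
    by (intro conjI ballI allI image_subsetI)
qed

lemma det_on_tendsto:
  fixes A :: "nat \<Rightarrow> 'a::euclidean_space \<Rightarrow> 'a"
  assumes S: "subspace S" and A: "\<And>s. linear_map_on S S (A s)" and G: "linear_map_on S S G"
    and lim: "\<And>x. x \<in> S \<Longrightarrow> (\<lambda>s. A s x) \<longlonglongrightarrow> G x"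
  shows "(\<lambda>s. det_on S (A s)) \<longlonglongrightarrow> det_on S G"
proof -
  obtain b where b: "onb S (dim S) b" using onb_exists[OF S] .
  show ?thesis
    unfolding det_on_eq_opdet[OF b A] det_on_eq_opdet[OF b G]
    using lim onbD(2)[OF b] by (intro opdet_tendsto tendsto_const) auto
qed

text \<open>The greedy choice: the vectors \<open>v a\<close> with \<open>a\<close> a jump form a basis of the span, and they do
  so simultaneously for all initial segments.\<close>

definition jumps :: "(nat \<Rightarrow> 'a::euclidean_space) \<Rightarrow> nat \<Rightarrow> nat set" where
  "jumps v n = {a. a < n \<and> v a \<notin> span (v ` {..<a})}"

lemma jumps_Suc: "jumps v (Suc n) = (if v n \<in> span (v ` {..<n}) then jumps v n else insert n (jumps v n))"
  by (auto simp: jumps_def less_Suc_eq)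

lemma finite_jumps [simp]: "finite (jumps v n)"
  by (simp add: jumps_def)

lemma card_jumps: "card (jumps v n) = dim (v ` {..<n})"
proof (induction n)
  case 0
  then show ?case by (simp add: jumps_def)
next
  case (Suc n)
  have "n \<notin> jumps v n" by (simp add: jumps_def)
  with Suc show ?case by (simp add: jumps_Suc lessThan_Suc dim_insert)
qed

lemma span_jumps: "span (v ` jumps v n) = span (v ` {..<n})"
proof (induction n)
  case 0
  then show ?case by (simp add: jumps_def)
next
  case (Suc n)
  show ?case
  proof (cases "v n \<in> span (v ` {..<n})")
    case True
    then show ?thesis using Suc by (simp add: jumps_Suc lessThan_Suc span_redundant)
  next
    case False
    then show ?thesis using Suc by (simp add: jumps_Suc lessThan_Suc span_insert)
  qed
qed

lemma jumps_Int: "p \<le> n \<Longrightarrow> jumps v n \<inter> {..<p} = jumps v p"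
  by (auto simp: jumps_def)

text \<open>With S_p the partial sums of \<open>w\<close>, summation by parts gives S_n l_{n-1}
  minus the sum of S_p (l_p - l_{p-1}) over 0 < p < n. Here S_n = 0, each remaining S_p is at least
  \<open>\<epsilon>\<close>, and the increments of \<open>l\<close> telescope.\<close>

lemma Abel_sum_bound:
  fixes w l :: "nat \<Rightarrow> real"
  assumes mono: "\<And>a. Suc a < n \<Longrightarrow> l a \<le> l (Suc a)"
    and pos: "\<And>p. 0 < p \<Longrightarrow> p < n \<Longrightarrow> \<epsilon> \<le> (\<Sum>a<p. w a)" and zero: "(\<Sum>a<n. w a) = 0"
    and n: "0 < n"
  shows "(\<Sum>a<n. w a * l a) \<le> - \<epsilon> * (l (n - 1) - l 0)"
proof -
  \<comment> \<open>Keeping the boundary term with \<open>l p\<close> makes the claim inductive; it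
    drops out at \<open>p = n - 1\<close>, where the sum of the weights is 0.\<close>
  have "(\<Sum>a<Suc p. w a * l a) \<le> (\<Sum>a<Suc p. w a) * l p - \<epsilon> * (l p - l 0)" if "Suc p \<le> n" for p
    using that
  proof (induction p)
    case (Suc p)
    have "0 \<le> ((\<Sum>a<Suc p. w a) - \<epsilon>) * (l (Suc p) - l p)"
      using pos[of "Suc p"] mono[of p] Suc.prems by (intro mult_nonneg_nonneg) auto
    with Suc show ?case by (simp add: algebra_simps)
  qed simp
  from this[of "n - 1"] show ?thesis using zero n by simp
qed

lemma linear_compose_on:
  assumes f: "linear_map_on S T f" and g: "linear g" and "\<And>x. g x \<in> S"
  shows "linear (\<lambda>x. f (g x))"
  using assms by (auto simp: linear_map_on_def linear_iff)

lemma linear_scaleR_sum: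
  assumes "\<And>i. i \<in> I \<Longrightarrow> linear (f i)"
  shows "linear (\<lambda>x. \<Sum>i\<in>I. r i *\<^sub>R f i x)"
  using assms by (intro linear_compose_sum ballI linear_compose_scale_right) auto

subsection \<open>Admissible operators\<close>

locale fr_datum =
  fixes k m :: nat
    and E :: "nat \<Rightarrow> 'a::euclidean_space set"
    and F :: "nat \<Rightarrow> 'b::euclidean_space set"
    and c d :: "nat \<Rightarrow> real"
    and B :: "nat \<Rightarrow> nat \<Rightarrow> 'a \<Rightarrow> 'b"
  assumes subE: "\<And>i. i \<in> {1..k} \<Longrightarrow> subspace (E i)"
    and orthE: "\<And>i i' x y. i \<in> {1..k} \<Longrightarrow> i' \<in> {1..k} \<Longrightarrow> i \<noteq> i' \<Longrightarrow>
           x \<in> E i \<Longrightarrow> y \<in> E i' \<Longrightarrow> inner x y = 0"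
    and subF: "\<And>j. j \<in> {1..m} \<Longrightarrow> subspace (F j)"
    and linB: "\<And>i j. i \<in> {1..k} \<Longrightarrow> j \<in> {1..m} \<Longrightarrow> linear_map_on (E i) (F j) (B i j)"
    and cpos: "\<And>i. i \<in> {1..k} \<Longrightarrow> 0 < c i"
    and dpos: "\<And>j. j \<in> {1..m} \<Longrightarrow> 0 < d j"
begin

declare One_nat_def [simp del] and atLeastAtMost_iff [simp del]

abbreviation "EE \<equiv> sum_of_subspaces k E"
abbreviation "proj i \<equiv> orth_proj (E i)"
abbreviation "Bj \<equiv> Bsum k E B"
abbreviation "Lam \<equiv> Lambda_c k E c"
abbreviation "adm \<equiv> admissible k m E F c d B"
abbreviation "J \<equiv> gaussian_functional k m E F c d"

lemma proj_other: "i \<in> {1..k} \<Longrightarrow> i' \<in> {1..k} \<Longrightarrow> i \<noteq> i' \<Longrightarrow> y \<in> E i' \<Longrightarrow> proj i y = 0"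
  using subE orthE by (intro orth_proj_zero) (auto simp: inner_commute)

lemma proj_sum:
  assumes "\<And>i. i \<in> {1..k} \<Longrightarrow> y i \<in> E i" "i \<in> {1..k}"
  shows "proj i (\<Sum>i'\<in>{1..k}. y i') = y i"
proof -
  have "proj i (\<Sum>i'\<in>{1..k}. y i') = (\<Sum>i'\<in>{1..k}. proj i (y i'))"
    using linear_sum[OF linear_orth_proj[OF subE[OF assms(2)]]] by blast
  also have "\<dots> = (\<Sum>i'\<in>{1..k}. if i' = i then y i else 0)"
    using assms proj_other subE by (intro sum.cong) (auto simp: orth_proj_ident)
  finally show ?thesis using assms(2) by simp
qed

lemma EE_memI: "(\<And>i. i \<in> {1..k} \<Longrightarrow> y i \<in> E i) \<Longrightarrow> (\<Sum>i\<in>{1..k}. y i) \<in> EE"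
  unfolding sum_of_subspaces_def by blast

lemma EE_decomp: "x \<in> EE \<Longrightarrow> (\<Sum>i\<in>{1..k}. proj i x) = x"
  unfolding sum_of_subspaces_def by (auto simp: proj_sum intro!: sum.cong)

lemma E_subset_EE: assumes "i \<in> {1..k}" "x \<in> E i" shows "x \<in> EE"
proof -
  have "(\<Sum>i'\<in>{1..k}. if i' = i then x else 0) \<in> EE"
    by (rule EE_memI) (use assms subE subspace_0 in auto)
  then show ?thesis using assms by simp
qed

lemma subspace_EE: "subspace EE"
proof (rule subspaceI)
  show "0 \<in> EE" using EE_memI[of "\<lambda>_. 0"] subE by (simp add: subspace_0)
next
  fix x y assume "x \<in> EE" "y \<in> EE"
  then have "x + y = (\<Sum>i\<in>{1..k}. proj i x + proj i y)" by (simp add: EE_decomp sum.distrib)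
  also have "\<dots> \<in> EE" using subE by (intro EE_memI) (simp add: subspace_add orth_proj_in)
  finally show "x + y \<in> EE" .
next
  fix r x assume "x \<in> EE"
  then have "r *\<^sub>R x = (\<Sum>i\<in>{1..k}. r *\<^sub>R proj i x)" by (simp add: EE_decomp scaleR_sum_right[symmetric])
  also have "\<dots> \<in> EE" using subE by (intro EE_memI) (simp add: subspace_scale orth_proj_in)
  finally show "r *\<^sub>R x \<in> EE" .
qed

lemma linear_proj: "i \<in> {1..k} \<Longrightarrow> linear (proj i)"
  using subE linear_orth_proj by blast

lemma proj_in: "i \<in> {1..k} \<Longrightarrow> proj i x \<in> E i"
  using subE orth_proj_in by blast

lemma linear_Bj: "j \<in> {1..m} \<Longrightarrow> linear (Bj j)"
  unfolding Bsum_def[abs_def]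
  by (intro linear_compose_sum ballI linear_compose_on[OF linB linear_proj proj_in]) auto

lemma Bj_in: "j \<in> {1..m} \<Longrightarrow> Bj j x \<in> F j"
  unfolding Bsum_def using linB proj_in subF
  by (intro subspace_sum) (auto simp: linear_map_on_def image_subset_iff)

lemma linear_Lam: "linear Lam"
  unfolding Lambda_c_def[abs_def] by (intro linear_scaleR_sum linear_proj)

lemma Lam_in: "Lam x \<in> EE"
  unfolding Lambda_c_def by (intro EE_memI subspace_scale subE proj_in)

lemma inner_Lam: "inner (Lam x) y = inner x (Lam y)"
  unfolding Lambda_c_def by (simp add: inner_sum_left inner_sum_right inner_orth_proj_commute subE)

lemma proj_Lam: "i \<in> {1..k} \<Longrightarrow> proj i (Lam x) = c i *\<^sub>R proj i x"
  unfolding Lambda_c_def by (rule proj_sum) (auto intro: subspace_scale subE proj_in)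

lemma Lam_surj: assumes "y \<in> EE" shows "\<exists>x\<in>EE. Lam x = y"
proof -
  let ?x = "\<Sum>i\<in>{1..k}. (1 / c i) *\<^sub>R proj i y"
  have "proj i ?x = (1 / c i) *\<^sub>R proj i y" if "i \<in> {1..k}" for i
    using that by (intro proj_sum) (auto intro: subspace_scale subE proj_in)
  then have "Lam ?x = (\<Sum>i\<in>{1..k}. proj i y)"
    unfolding Lambda_c_def using cpos by (intro sum.cong) (auto simp: less_imp_neq[symmetric])
  also have "\<dots> = y" using EE_decomp[OF assms] .
  finally show ?thesis by (meson EE_memI subspace_scale subE proj_in)
qed

text \<open>The constraint in terms of \<open>y = \<Lambda>\<^sub>c x\<close>, which removes the operator \<open>\<Lambda>\<^sub>c\<close>.\<close>

lemma admissible_iff: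
  "adm V U \<longleftrightarrow> (\<forall>i\<in>{1..k}. pos_def_on (E i) (V i)) \<and> (\<forall>j\<in>{1..m}. pos_def_on (F j) (U j)) \<and>
     (\<forall>y\<in>EE. (\<Sum>j\<in>{1..m}. d j * inner (U j (Bj j y)) (Bj j y))
        \<le> (\<Sum>i\<in>{1..k}. inner (V i (proj i y)) (proj i y) / c i))" (is "_ \<longleftrightarrow> ?V \<and> ?U \<and> ?C")
proof (cases "?V \<and> ?U")
  case False
  then show ?thesis by (auto simp: admissible_def)
next
  case True
  let ?M = "\<lambda>x. \<Sum>j\<in>{1..m}. d j *\<^sub>R Lam (adjoint (Bj j) (U j (Bj j (Lam x))))"
  let ?W = "V_c k E c V"
  have V: "linear_map_on (E i) (E i) (V i)"
      "\<And>x y. x \<in> E i \<Longrightarrow> y \<in> E i \<Longrightarrow> inner (V i x) y = inner x (V i y)" if "i \<in> {1..k}" for i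
    using True that by (auto simp: pos_def_on_def self_adjoint_on_def)
  have U: "linear_map_on (F j) (F j) (U j)"
      "\<And>x y. x \<in> F j \<Longrightarrow> y \<in> F j \<Longrightarrow> inner (U j x) y = inner x (U j y)" if "j \<in> {1..m}" for j
    using True that by (auto simp: pos_def_on_def self_adjoint_on_def)
  have Vin: "V i (proj i x) \<in> E i" if "i \<in> {1..k}" for i x
    using V(1)[OF that] proj_in[OF that] by (auto simp: linear_map_on_def)
  have linM: "linear ?M"
  proof (rule linear_scaleR_sum)
    fix j assume j: "j \<in> {1..m}"
    have "linear (\<lambda>x. U j (Bj j x))"
      by (rule linear_compose_on[OF U(1)[OF j] linear_Bj[OF j] Bj_in[OF j]])
    from linear_compose[OF linear_compose[OF linear_compose[OF linear_Lam this] adjoint_linear[OF linear_Bj[OF j]]] linear_Lam]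
    show "linear (\<lambda>x. Lam (adjoint (Bj j) (U j (Bj j (Lam x)))))" by (simp add: o_def)
  qed
  have linW: "linear ?W"
    unfolding V_c_def[abs_def]
    by (intro linear_scaleR_sum linear_compose_on[OF V(1) linear_proj proj_in])
  have Min: "?M x \<in> EE" for x
    by (intro subspace_sum subspace_EE subspace_scale Lam_in)
  have Win: "?W x \<in> EE" for x
    unfolding V_c_def by (intro EE_memI subspace_scale subE Vin)
  have "linear (\<lambda>x. ?W x - ?M x)" by (rule linear_compose_sub[OF linW linM])
  then have lin: "linear_map_on EE EE (\<lambda>x. ?W x - ?M x)"
    using Min Win subspace_diff[OF subspace_EE] by (auto simp: linear_map_on_def linear_iff)
  have iM: "inner (?M x) y = (\<Sum>j\<in>{1..m}. d j * inner (U j (Bj j (Lam x))) (Bj j (Lam y)))" for x y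
    by (simp add: inner_sum_left inner_Lam[of _ y] adjoint_clauses(2)[OF linear_Bj])
  have iW: "inner (?W x) y = (\<Sum>i\<in>{1..k}. c i * inner (V i (proj i x)) (proj i y))" for x y
    unfolding V_c_def inner_sum_left
  proof (rule sum.cong[OF refl])
    fix i assume i: "i \<in> {1..k}"
    have "inner (V i (proj i x)) (proj i y) = inner (V i (proj i x)) y"
      using orth_proj_inner[OF subE[OF i] Vin[OF i], of y x] by (simp add: inner_commute)
    then show "inner (c i *\<^sub>R V i (proj i x)) y = c i * inner (V i (proj i x)) (proj i y)" by simp
  qed
  have "inner (?M x) y = inner (?M y) x" for x y
    unfolding iM using U(2) Bj_in by (intro sum.cong) (auto simp: inner_commute)
  moreover have "inner (?W x) y = inner (?W y) x" for x y
    unfolding iW using V(2) proj_in by (intro sum.cong) (auto simp: inner_commute)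
  ultimately have sym: "inner (?W x - ?M x) y = inner x (?W y - ?M y)" for x y
    by (simp add: inner_diff_left inner_diff_right inner_commute)
  define M where "M = ?M"
  define W where "W = ?W"
  \<comment> \<open>Self-adjointness of the difference is part of the order relation; once it is
    settled, only the quadratic form remains to be compared.\<close>
  have sa: "self_adjoint_on EE (\<lambda>x. W x - M x)"
    unfolding self_adjoint_on_def M_def W_def by (rule conjI[OF lin]) (intro ballI sym)
  define R where "R y \<longleftrightarrow> (\<Sum>j\<in>{1..m}. d j * inner (U j (Bj j y)) (Bj j y))
      \<le> (\<Sum>i\<in>{1..k}. inner (V i (proj i y)) (proj i y) / c i)" for y
  \<comment> \<open>\<open>Lam\<close> multiplies the component in \<open>E i\<close> by
    \<open>c i\<close>, so the form gains the square of \<open>c i\<close>; division by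
    \<open>c i\<close> leaves exactly the weight in \<open>V_c\<close>.\<close>
  have "inner (V i (proj i (Lam x))) (proj i (Lam x)) / c i = c i * inner (V i (proj i x)) (proj i x)"
    if "i \<in> {1..k}" for i x
    using V(1)[OF that] proj_in[OF that] cpos[OF that] by (simp add: proj_Lam that linear_map_on_def)
  then have "R (Lam x) \<longleftrightarrow> inner (M x) x \<le> inner (W x) x" for x
    unfolding R_def M_def W_def iM iW by simp
  then have R: "R (Lam x) \<longleftrightarrow> 0 \<le> inner (W x - M x) x" for x by (simp add: inner_diff_left)
  have "adm V U \<longleftrightarrow> op_le_on EE M W"
    unfolding admissible_def M_def W_def using True by blast
  also have "\<dots> \<longleftrightarrow> (\<forall>x\<in>EE. R (Lam x))"
    unfolding op_le_on_def pos_semidef_on_def R using sa by blast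
  also have "\<dots> \<longleftrightarrow> (\<forall>y\<in>EE. R y)" using Lam_surj Lam_in by metis
  finally show ?thesis using True unfolding R_def by blast
qed

lemma admissibleD:
  assumes "adm V U"
  shows "i \<in> {1..k} \<Longrightarrow> pos_def_on (E i) (V i)" "j \<in> {1..m} \<Longrightarrow> pos_def_on (F j) (U j)"
    "y \<in> EE \<Longrightarrow> (\<Sum>j\<in>{1..m}. d j * inner (U j (Bj j y)) (Bj j y))
        \<le> (\<Sum>i\<in>{1..k}. inner (V i (proj i y)) (proj i y) / c i)"
  using assms unfolding admissible_iff by auto

text \<open>The constraint is homogeneous of degree one and a determinant scales with the dimension.
  A nonzero scaling defect thus makes the functional unbounded, and a zero defect permits
  normalizing a maximizing sequence.\<close>

lemma functional_scaleR:
  assumes "adm V U" "0 < t"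
  shows "adm (\<lambda>i x. t *\<^sub>R V i x) (\<lambda>j x. t *\<^sub>R U j x)"
    and "J (\<lambda>i x. t *\<^sub>R V i x) (\<lambda>j x. t *\<^sub>R U j x) = J V U +
      ln t * ((\<Sum>j\<in>{1..m}. d j * real (dim (F j))) - (\<Sum>i\<in>{1..k}. c i * real (dim (E i))))"
proof -
  note A = admissibleD[OF assms(1)]
  have "(\<Sum>j\<in>{1..m}. d j * inner (t *\<^sub>R U j (Bj j y)) (Bj j y))
        \<le> (\<Sum>i\<in>{1..k}. inner (t *\<^sub>R V i (proj i y)) (proj i y) / c i)" if "y \<in> EE" for y
    using mult_left_mono[OF A(3)[OF that], of t] assms(2) by (simp add: sum_distrib_left mult_ac)
  then show "adm (\<lambda>i x. t *\<^sub>R V i x) (\<lambda>j x. t *\<^sub>R U j x)"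
    unfolding admissible_iff using A(1,2) subE subF assms(2) by (auto intro: pos_def_on_scaleR)
  have "c i * ln (det_on (E i) (\<lambda>x. t *\<^sub>R V i x)) = c i * ln (det_on (E i) (V i)) + ln t * (c i * real (dim (E i)))"
    if i: "i \<in> {1..k}" for i
    using det_on_scaleR[OF subE[OF i] pos_def_on_linear[OF A(1)[OF i]], of t]
      det_on_pos_def[OF subE[OF i] A(1)[OF i]] assms(2) by (simp add: ln_mult ln_realpow algebra_simps)
  moreover have "d j * ln (det_on (F j) (\<lambda>x. t *\<^sub>R U j x)) = d j * ln (det_on (F j) (U j)) + ln t * (d j * real (dim (F j)))"
    if j: "j \<in> {1..m}" for j
    using det_on_scaleR[OF subF[OF j] pos_def_on_linear[OF A(2)[OF j]], of t]
      det_on_pos_def[OF subF[OF j] A(2)[OF j]] assms(2) by (simp add: ln_mult ln_realpow algebra_simps)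
  ultimately show "J (\<lambda>i x. t *\<^sub>R V i x) (\<lambda>j x. t *\<^sub>R U j x) = J V U +
      ln t * ((\<Sum>j\<in>{1..m}. d j * real (dim (F j))) - (\<Sum>i\<in>{1..k}. c i * real (dim (E i))))"
    unfolding gaussian_functional_def
    by (simp add: sum.distrib sum_distrib_left algebra_simps)
qed

subsection \<open>Necessity of the conditions\<close>

lemma norm_sum_EE:
  assumes "\<And>i. i \<in> {1..k} \<Longrightarrow> y i \<in> E i"
  shows "(norm (\<Sum>i\<in>{1..k}. y i))\<^sup>2 = (\<Sum>i\<in>{1..k}. (norm (y i))\<^sup>2)"
proof -
  have "inner (y i) (\<Sum>i'\<in>{1..k}. y i') = inner (y i) (y i)" if i: "i \<in> {1..k}" for i
  proof -
    have "inner (y i) (\<Sum>i'\<in>{1..k}. y i') = (\<Sum>i'\<in>{1..k}. if i' = i then inner (y i) (y i) else 0)"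
      unfolding inner_sum_right using assms i orthE by (intro sum.cong) auto
    then show ?thesis using i by simp
  qed
  then show ?thesis unfolding power2_norm_eq_inner by (simp add: inner_sum_left)
qed

lemma Bj_bounded: obtains K where "0 < K" "\<And>j x. j \<in> {1..m} \<Longrightarrow> norm (Bj j x) \<le> K * norm x"
proof -
  have "\<exists>K>0. \<forall>x. norm (Bj j x) \<le> K * norm x" if "j \<in> {1..m}" for j
    using linear_bounded_pos[OF linear_Bj[OF that]] by blast
  then obtain K where K: "\<And>j. j \<in> {1..m} \<Longrightarrow> 0 < K j" "\<And>j x. j \<in> {1..m} \<Longrightarrow> norm (Bj j x) \<le> K j * norm x"
    by metis
  show ?thesis
  proof
    \<comment> \<open>The summand 1 keeps the constant positive when \<open>m = 0\<close>.\<close>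
    show "0 < 1 + (\<Sum>j\<in>{1..m}. K j)" using K(1) by (intro add_pos_nonneg sum_nonneg) (auto intro: less_imp_le)
    fix j and x :: 'a assume j: "j \<in> {1..m}"
    have "K j \<le> (\<Sum>j\<in>{1..m}. K j)" using K(1) j by (intro member_le_sum) (auto intro: less_imp_le)
    then have "K j * norm x \<le> (1 + (\<Sum>j\<in>{1..m}. K j)) * norm x" by (intro mult_right_mono) auto
    with K(2)[OF j, of x] show "norm (Bj j x) \<le> (1 + (\<Sum>j\<in>{1..m}. K j)) * norm x" by linarith
  qed
qed

lemma product_formD:
  assumes "product_form k E T"
  shows "subspace T" "T \<subseteq> EE" "i \<in> {1..k} \<Longrightarrow> subspace (proj i ` T)"
    "i \<in> {1..k} \<Longrightarrow> proj i ` T \<subseteq> E i" "j \<in> {1..m} \<Longrightarrow> subspace (Bj j ` T)"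
    "j \<in> {1..m} \<Longrightarrow> Bj j ` T \<subseteq> F j"
    "(\<And>i. i \<in> {1..k} \<Longrightarrow> y i \<in> proj i ` T) \<Longrightarrow> (\<Sum>i\<in>{1..k}. y i) \<in> T"
proof -
  have T: "subspace T" "T \<subseteq> EE" "T = sum_of_subspaces k (\<lambda>i. proj i ` T)"
    using assms by (auto simp: product_form_def)
  show "subspace T" "T \<subseteq> EE" using T by auto
  show "subspace (proj i ` T)" if "i \<in> {1..k}" for i
    using linear_subspace_image[OF linear_proj[OF that] T(1)] .
  show "proj i ` T \<subseteq> E i" if "i \<in> {1..k}" for i using proj_in[OF that] by auto
  show "subspace (Bj j ` T)" if "j \<in> {1..m}" for j
    using linear_subspace_image[OF linear_Bj[OF that] T(1)] .
  show "Bj j ` T \<subseteq> F j" if "j \<in> {1..m}" for j using Bj_in[OF that] by auto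
  show "(\<Sum>i\<in>{1..k}. y i) \<in> T" if "\<And>i. i \<in> {1..k} \<Longrightarrow> y i \<in> proj i ` T" for y
    using T(3) that unfolding sum_of_subspaces_def by blast
qed

lemma stretch_admissible:
  assumes T: "product_form k E T"
  shows "\<exists>\<delta>>0. \<forall>\<epsilon>. 0 < \<epsilon> \<longrightarrow> \<epsilon> \<le> 1 \<longrightarrow>
    adm (\<lambda>i. stretch (proj i ` T) \<epsilon> 1) (\<lambda>j. stretch (Bj j ` T) (\<delta> * \<epsilon>) \<delta>)"
proof -
  note TD = product_formD[OF T]
  obtain K where K: "0 < K" "\<And>j x. j \<in> {1..m} \<Longrightarrow> norm (Bj j x) \<le> K * norm x" using Bj_bounded by blast
  define C where "C = 1 + (\<Sum>i\<in>{1..k}. c i)"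
  define D where "D = 1 + (\<Sum>j\<in>{1..m}. d j)"
  have CC: "c i \<le> C" if "i \<in> {1..k}" for i
    unfolding C_def using member_le_sum[of i "{1..k}" c] that cpos by (force intro: less_imp_le)
  have C: "0 < C" unfolding C_def using cpos by (intro add_pos_nonneg sum_nonneg) (auto intro: less_imp_le)
  have D: "0 < D" unfolding D_def using dpos by (intro add_pos_nonneg sum_nonneg) (auto intro: less_imp_le)
  define \<delta> where "\<delta> = 1 / (3 * K\<^sup>2 * C * D)"
  have \<delta>: "0 < \<delta>" unfolding \<delta>_def using K C D by simp
  show ?thesis
  proof (intro exI[of _ \<delta>] conjI allI impI \<delta>)
    fix \<epsilon> :: real assume e: "0 < \<epsilon>" "\<epsilon> \<le> 1"
    let ?V = "\<lambda>i. stretch (proj i ` T) \<epsilon> 1" and ?U = "\<lambda>j. stretch (Bj j ` T) (\<delta> * \<epsilon>) \<delta>"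
    have "(\<Sum>j\<in>{1..m}. d j * inner (?U j (Bj j y)) (Bj j y))
        \<le> (\<Sum>i\<in>{1..k}. inner (?V i (proj i y)) (proj i y) / c i)" if y: "y \<in> EE" for y
    proof -
      define t where "t = (\<lambda>i. orth_proj (proj i ` T) (proj i y))"
      define t0 s0 where "t0 = (\<Sum>i\<in>{1..k}. t i)" and "s0 = (\<Sum>i\<in>{1..k}. proj i y - t i)"
      have tT: "t i \<in> proj i ` T" if "i \<in> {1..k}" for i
        unfolding t_def using orth_proj_in[OF TD(3)[OF that]] .
      then have tE: "t i \<in> E i" if "i \<in> {1..k}" for i using TD(4)[OF that] that by blast
      \<comment> \<open>Product form is used here: the projections of \<open>y\<close> to the pieces
        of \<open>T\<close> add up to a vector of \<open>T\<close> itself.\<close>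
      have t0: "t0 \<in> T" unfolding t0_def by (rule TD(7)[OF tT])
      have y_eq: "y = t0 + s0" unfolding t0_def s0_def using EE_decomp[OF y] by (simp add: sum_subtractf)
      define N where "N = \<epsilon> * (norm t0)\<^sup>2 + (norm s0)\<^sup>2"
      have N0: "0 \<le> N" unfolding N_def using e by simp
      have N: "N = (\<Sum>i\<in>{1..k}. inner (?V i (proj i y)) (proj i y))"
      proof -
        have "(norm t0)\<^sup>2 = (\<Sum>i\<in>{1..k}. (norm (t i))\<^sup>2)"
          unfolding t0_def by (rule norm_sum_EE[OF tE])
        moreover have "(norm s0)\<^sup>2 = (\<Sum>i\<in>{1..k}. (norm (proj i y - t i))\<^sup>2)"
          unfolding s0_def by (rule norm_sum_EE) (auto intro: subspace_diff subE proj_in tE)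
        ultimately show ?thesis
          unfolding N_def using TD(3) by (simp add: inner_stretch t_def sum.distrib sum_distrib_left)
      qed
      have lower: "N / C \<le> (\<Sum>i\<in>{1..k}. inner (?V i (proj i y)) (proj i y) / c i)"
        unfolding N sum_divide_distrib
      proof (rule sum_mono)
        fix i assume i: "i \<in> {1..k}"
        have "0 \<le> inner (?V i (proj i y)) (proj i y)" using TD(3)[OF i] e by (simp add: inner_stretch)
        then show "inner (?V i (proj i y)) (proj i y) / C \<le> inner (?V i (proj i y)) (proj i y) / c i"
          using CC[OF i] cpos[OF i] by (intro divide_left_mono) auto
      qed
      have "inner (?U j (Bj j y)) (Bj j y) \<le> 3 * \<delta> * K\<^sup>2 * N" if j: "j \<in> {1..m}" for j
      proof -
        let ?P = "orth_proj (Bj j ` T)"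
        have sT: "subspace (Bj j ` T)" using TD(5)[OF j] .
        have Bt: "Bj j t0 \<in> Bj j ` T" using t0 by simp
        have By: "Bj j y = Bj j t0 + Bj j s0" unfolding y_eq using linear_add[OF linear_Bj[OF j]] .
        have "Bj j y - ?P (Bj j y) = Bj j s0 - ?P (Bj j s0)"
          unfolding By linear_add[OF linear_orth_proj[OF sT]] orth_proj_ident[OF sT Bt] by simp
        then have 1: "(norm (Bj j y - ?P (Bj j y)))\<^sup>2 \<le> (norm (Bj j s0))\<^sup>2"
          using norm_orth_proj_le(2)[OF sT] by metis
        have "(norm (?P (Bj j y)))\<^sup>2 \<le> (norm (Bj j y))\<^sup>2" by (rule norm_orth_proj_le(1)[OF sT])
        also have "\<dots> \<le> (norm (Bj j t0) + norm (Bj j s0))\<^sup>2"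
          unfolding By by (intro power_mono norm_triangle_ineq) simp
        also have "\<dots> \<le> 2 * (norm (Bj j t0))\<^sup>2 + 2 * (norm (Bj j s0))\<^sup>2"
          using sum_squares_bound[of "norm (Bj j t0)" "norm (Bj j s0)"] by (simp add: power2_sum)
        finally have 2: "(norm (?P (Bj j y)))\<^sup>2 \<le> 2 * (norm (Bj j t0))\<^sup>2 + 2 * (norm (Bj j s0))\<^sup>2" .
        have 3: "(norm (Bj j x))\<^sup>2 \<le> K\<^sup>2 * (norm x)\<^sup>2" for x
          using power_mono[OF K(2)[OF j, of x], of 2] by (simp add: power_mult_distrib)
        have "inner (?U j (Bj j y)) (Bj j y) = \<delta> * (\<epsilon> * (norm (?P (Bj j y)))\<^sup>2 + (norm (Bj j y - ?P (Bj j y)))\<^sup>2)"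
          using sT by (simp add: inner_stretch algebra_simps)
        also have "\<dots> \<le> \<delta> * (\<epsilon> * (2 * (K\<^sup>2 * (norm t0)\<^sup>2) + 2 * (K\<^sup>2 * (norm s0)\<^sup>2)) + K\<^sup>2 * (norm s0)\<^sup>2)"
          using order_trans[OF 1 3] 2 3[of t0] 3[of s0] e \<delta>
          by (intro mult_left_mono add_mono) linarith+
        also have "\<dots> = \<delta> * K\<^sup>2 * (2 * (\<epsilon> * (norm t0)\<^sup>2) + 2 * (\<epsilon> * (norm s0)\<^sup>2) + (norm s0)\<^sup>2)"
          by (simp add: algebra_simps)
        also have "\<dots> \<le> \<delta> * K\<^sup>2 * (3 * N)"
        proof (rule mult_left_mono)
          have "\<epsilon> * (norm s0)\<^sup>2 \<le> (norm s0)\<^sup>2" using e by (simp add: mult_left_le_one_le)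
          moreover have "0 \<le> \<epsilon> * (norm t0)\<^sup>2" using e by simp
          ultimately show "2 * (\<epsilon> * (norm t0)\<^sup>2) + 2 * (\<epsilon> * (norm s0)\<^sup>2) + (norm s0)\<^sup>2 \<le> 3 * N"
            unfolding N_def by argo
        qed (use \<delta> in simp)
        finally show ?thesis by simp
      qed
      then have "(\<Sum>j\<in>{1..m}. d j * inner (?U j (Bj j y)) (Bj j y)) \<le> (\<Sum>j\<in>{1..m}. d j * (3 * \<delta> * K\<^sup>2 * N))"
        using dpos by (intro sum_mono mult_left_mono) (auto intro: less_imp_le)
      also have "\<dots> \<le> D * (3 * \<delta> * K\<^sup>2 * N)"
        unfolding sum_distrib_right[symmetric] D_def using \<delta> N0 by (intro mult_right_mono) auto
      also have "\<dots> = N / C" unfolding \<delta>_def using K C D by (simp add: field_simps)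
      finally show ?thesis using lower by linarith
    qed
    moreover have "pos_def_on (E i) (?V i)" if "i \<in> {1..k}" for i
      using that e TD by (intro pos_def_on_stretch subE) auto
    moreover have "pos_def_on (F j) (?U j)" if "j \<in> {1..m}" for j
      using that e \<delta> TD by (intro pos_def_on_stretch subF) auto
    ultimately show "adm ?V ?U" unfolding admissible_iff by blast
  qed
qed

text \<open>The coefficient of \<open>ln \<epsilon>\<close> is the defect of \<open>T\<close> in the
  dimension condition; everything else is constant in \<open>\<epsilon>\<close>.\<close>

lemma functional_stretch:
  assumes T: "product_form k E T" and pos: "0 < \<epsilon>" "0 < \<delta>"
  shows "J (\<lambda>i. stretch (proj i ` T) \<epsilon> 1) (\<lambda>j. stretch (Bj j ` T) (\<delta> * \<epsilon>) \<delta>) =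
    ln \<epsilon> * ((\<Sum>j\<in>{1..m}. d j * real (dim (Bj j ` T))) - (\<Sum>i\<in>{1..k}. c i * real (dim (proj i ` T))))
      + ln \<delta> * (\<Sum>j\<in>{1..m}. d j * real (dim (F j)))"
proof -
  note TD = product_formD[OF T]
  have v: "c i * ln (det_on (E i) (stretch (proj i ` T) \<epsilon> 1)) = ln \<epsilon> * (c i * real (dim (proj i ` T)))"
    if i: "i \<in> {1..k}" for i
    using pos by (simp add: det_on_stretch[OF subE[OF i] TD(3,4)[OF i]] ln_realpow)
  have u: "d j * ln (det_on (F j) (stretch (Bj j ` T) (\<delta> * \<epsilon>) \<delta>)) =
      ln \<epsilon> * (d j * real (dim (Bj j ` T))) + ln \<delta> * (d j * real (dim (F j)))" if j: "j \<in> {1..m}" for j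
  proof -
    have le: "dim (Bj j ` T) \<le> dim (F j)" using TD(6)[OF j] by (rule dim_subset)
    have "ln (det_on (F j) (stretch (Bj j ` T) (\<delta> * \<epsilon>) \<delta>))
      = real (dim (Bj j ` T)) * (ln \<delta> + ln \<epsilon>) + real (dim (F j) - dim (Bj j ` T)) * ln \<delta>"
      using pos by (simp add: det_on_stretch[OF subF[OF j] TD(5,6)[OF j]] ln_realpow ln_mult)
    also have "\<dots> = ln \<epsilon> * real (dim (Bj j ` T)) + ln \<delta> * real (dim (F j))"
      using le by (simp add: of_nat_diff algebra_simps)
    finally show ?thesis by (simp add: algebra_simps)
  qed
  have "(\<Sum>i\<in>{1..k}. c i * ln (det_on (E i) (stretch (proj i ` T) \<epsilon> 1))) =
      ln \<epsilon> * (\<Sum>i\<in>{1..k}. c i * real (dim (proj i ` T)))"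
    unfolding sum_distrib_left by (rule sum.cong[OF refl v])
  moreover have "(\<Sum>j\<in>{1..m}. d j * ln (det_on (F j) (stretch (Bj j ` T) (\<delta> * \<epsilon>) \<delta>))) =
      ln \<epsilon> * (\<Sum>j\<in>{1..m}. d j * real (dim (Bj j ` T))) + ln \<delta> * (\<Sum>j\<in>{1..m}. d j * real (dim (F j)))"
    unfolding sum_distrib_left sum.distrib[symmetric] by (rule sum.cong[OF refl u])
  ultimately show ?thesis
    unfolding gaussian_functional_def by (simp add: right_diff_distrib)
qed

section \<open>The full space, and what upper bounds imply\<close>

lemma proj_image_EE: assumes "i \<in> {1..k}" shows "proj i ` EE = E i"
proof
  show "proj i ` EE \<subseteq> E i" using proj_in[OF assms] by blast
  show "E i \<subseteq> proj i ` EE"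
    using E_subset_EE[OF assms] orth_proj_ident[OF subE[OF assms]] by (metis image_eqI subsetI)
qed

lemma product_form_EE: "product_form k E EE"
proof -
  have "EE = sum_of_subspaces k (\<lambda>i. proj i ` EE)"
    unfolding sum_of_subspaces_def[of k "\<lambda>i. proj i ` EE"]
    by (simp only: proj_image_EE cong: ball_cong) (simp only: sum_of_subspaces_def)
  then show ?thesis unfolding product_form_def using subspace_EE by blast
qed

text \<open>Taking \<open>\<epsilon> = 1\<close> in the test operators leaves multiples of the
  identity. A nonempty admissible set keeps the supremum away from minus infinity.\<close>

lemma admissible_exists: obtains V U where "adm V U"
proof -
  obtain \<delta> where "\<forall>\<epsilon>. 0 < \<epsilon> \<longrightarrow> \<epsilon> \<le> 1 \<longrightarrow>
    adm (\<lambda>i. stretch (proj i ` EE) \<epsilon> 1) (\<lambda>j. stretch (Bj j ` EE) (\<delta> * \<epsilon>) \<delta>)"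
    using stretch_admissible[OF product_form_EE] by blast
  from this[rule_format, of 1] that show thesis by simp
qed

lemma dimension_condition_if_bounded:
  assumes M: "\<And>V U. adm V U \<Longrightarrow> J V U \<le> M"
  shows "dimension_condition k m E c d B"
  unfolding dimension_condition_def
proof (intro allI impI)
  fix T assume T: "product_form k E T"
  obtain \<delta> where \<delta>: "0 < \<delta>" "\<And>\<epsilon>. 0 < \<epsilon> \<Longrightarrow> \<epsilon> \<le> 1 \<Longrightarrow>
    adm (\<lambda>i. stretch (proj i ` T) \<epsilon> 1) (\<lambda>j. stretch (Bj j ` T) (\<delta> * \<epsilon>) \<delta>)"
    using stretch_admissible[OF T] by blast
  let ?L = "\<Sum>i\<in>{1..k}. c i * real (dim (proj i ` T))" and ?R = "\<Sum>j\<in>{1..m}. d j * real (dim (Bj j ` T))"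
  define N where "N = M - ln \<delta> * (\<Sum>j\<in>{1..m}. d j * real (dim (F j)))"
  \<comment> \<open>Here \<open>x\<close> is \<open>- ln \<epsilon>\<close>, which sweeps the whole
    half-line; a linear function bounded above there has nonpositive slope.\<close>
  have bd: "x * (?L - ?R) \<le> N" if "0 \<le> x" for x
    using M[OF \<delta>(2)[of "exp (-x)"]] functional_stretch[OF T _ \<delta>(1), of "exp (-x)"] that
    by (simp add: N_def algebra_simps)
  show "?L \<le> ?R"
  proof (rule ccontr)
    assume "\<not> ?thesis"
    then have p: "0 < ?L - ?R" by simp
    have "(\<bar>N\<bar> + 1) / (?L - ?R) * (?L - ?R) \<le> N" using p by (intro bd) simp
    then show False using p by simp
  qed
qed

text \<open>The logarithm of the dilation factor runs over all reals, and a linear function bounded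
  above on the whole line has slope 0.\<close>

lemma scaling_condition_if_bounded:
  assumes M: "\<And>V U. adm V U \<Longrightarrow> J V U \<le> M"
  shows "scaling_condition k m E F c d"
proof -
  obtain V U where VU: "adm V U" using admissible_exists .
  define D where "D = (\<Sum>j\<in>{1..m}. d j * real (dim (F j))) - (\<Sum>i\<in>{1..k}. c i * real (dim (E i)))"
  have bd: "x * D \<le> M - J V U" for x
    using M[OF functional_scaleR(1)[OF VU], of "exp x"] functional_scaleR(2)[OF VU, of "exp x"]
    by (simp add: D_def)
  have "D = 0"
  proof (rule ccontr)
    assume "D \<noteq> 0"
    with bd[of "(\<bar>M - J V U\<bar> + 1) / D"] show False by simp
  qed
  then show ?thesis unfolding D_def scaling_condition_def by simp
qed

lemma D_g_finite_iff: "\<bar>D_g k m E F c d B\<bar> \<noteq> \<infinity> \<longleftrightarrow> (\<exists>M. \<forall>V U. adm V U \<longrightarrow> J V U \<le> M)"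
proof -
  define S where "S = (SUP (V, U) \<in> {(V, U). adm V U}. ereal (J V U))"
  have D: "D_g k m E F c d B = ereal (1/2) * S" by (simp add: D_g_def S_def)
  have up: "ereal (J V U) \<le> S" if "adm V U" for V U
    unfolding S_def using that by (intro SUP_upper2[of "(V, U)"]) auto
  obtain V0 U0 where A0: "adm V0 U0" using admissible_exists .
  have "S \<noteq> -\<infinity>" using up[OF A0] by auto
  have "\<bar>D_g k m E F c d B\<bar> \<noteq> \<infinity> \<longleftrightarrow> \<bar>S\<bar> \<noteq> \<infinity>" unfolding D by (cases S) auto
  also have "\<dots> \<longleftrightarrow> S \<noteq> \<infinity>" using \<open>S \<noteq> -\<infinity>\<close> by auto
  also have "\<dots> \<longleftrightarrow> (\<exists>M. \<forall>V U. adm V U \<longrightarrow> J V U \<le> M)"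
  proof
    assume "S \<noteq> \<infinity>"
    then obtain s where "S = ereal s" using \<open>S \<noteq> -\<infinity>\<close> by (cases S) auto
    then show "\<exists>M. \<forall>V U. adm V U \<longrightarrow> J V U \<le> M" using up by auto
  next
    assume "\<exists>M. \<forall>V U. adm V U \<longrightarrow> J V U \<le> M"
    then obtain M where "\<And>V U. adm V U \<Longrightarrow> J V U \<le> M" by blast
    then have "S \<le> ereal M" unfolding S_def by (intro SUP_least) auto
    then show "S \<noteq> \<infinity>" by auto
  qed
  finally show ?thesis .
qed

lemma gaussian_extremizableI:
  assumes "adm V U" "\<And>V' U'. adm V' U' \<Longrightarrow> J V' U' \<le> J V U"
  shows "gaussian_extremizable k m E F c d B"
proof -
  have "(SUP (V, U) \<in> {(V, U). adm V U}. ereal (J V U)) = ereal (J V U)"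
  proof (rule antisym)
    show "(SUP (V, U) \<in> {(V, U). adm V U}. ereal (J V U)) \<le> ereal (J V U)"
      using assms by (intro SUP_least) auto
    show "ereal (J V U) \<le> (SUP (V, U) \<in> {(V, U). adm V U}. ereal (J V U))"
      using assms(1) by (intro SUP_upper2[of "(V, U)"]) auto
  qed
  then have "D_g k m E F c d B = ereal (1/2 * J V U)" by (simp add: D_g_def)
  then show ?thesis unfolding gaussian_extremizable_def using assms(1) by auto
qed

lemma Bj_surj:
  assumes sc: "scaling_condition k m E F c d" and dc: "dimension_condition k m E c d B"
    and j: "j \<in> {1..m}"
  shows "Bj j ` EE = F j"
proof -
  note TD = product_formD[OF product_form_EE]
  have le: "dim (Bj j ` EE) \<le> dim (F j)" if "j \<in> {1..m}" for j
    using TD(6)[OF that] by (rule dim_subset)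
  have "(\<Sum>i\<in>{1..k}. c i * real (dim (proj i ` EE))) \<le> (\<Sum>j\<in>{1..m}. d j * real (dim (Bj j ` EE)))"
    using dc product_form_EE unfolding dimension_condition_def by blast
  then have *: "(\<Sum>j\<in>{1..m}. d j * real (dim (F j))) \<le> (\<Sum>j\<in>{1..m}. d j * real (dim (Bj j ` EE)))"
    using sc unfolding scaling_condition_def by (simp add: proj_image_EE)
  have "dim (Bj j ` EE) = dim (F j)"
  proof (rule ccontr)
    assume "\<not> ?thesis"
    then have "dim (Bj j ` EE) < dim (F j)" using le[OF j] by simp
    then have "(\<Sum>j\<in>{1..m}. d j * real (dim (Bj j ` EE))) < (\<Sum>j\<in>{1..m}. d j * real (dim (F j)))"
      using le dpos j by (intro sum_strict_mono_ex1) (auto intro!: mult_left_mono less_imp_le bexI[of _ j])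
    with * show False by simp
  qed
  then show ?thesis using TD(5,6)[OF j] subF[OF j] by (intro subspace_dim_equal) auto
qed

subsection \<open>Flags of product-form subspaces\<close>

text \<open>\<open>\<tau> a\<close> records the summand containing \<open>e a\<close>. An
  orthonormal family with \<open>dim EE\<close> members in \<open>EE\<close> is automatically a
  basis of it.\<close>

definition adapted :: "(nat \<Rightarrow> nat) \<Rightarrow> (nat \<Rightarrow> 'a) \<Rightarrow> bool" where
  "adapted \<tau> e \<longleftrightarrow> (\<forall>a<dim EE. \<tau> a \<in> {1..k} \<and> e a \<in> E (\<tau> a))
     \<and> (\<forall>a<dim EE. \<forall>b<dim EE. inner (e a) (e b) = (if a = b then 1 else 0))"

lemma adaptedD:
  assumes "adapted \<tau> e" "a < dim EE"
  shows "\<tau> a \<in> {1..k}" "e a \<in> E (\<tau> a)" "b < dim EE \<Longrightarrow> inner (e a) (e b) = (if a = b then 1 else 0)"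
    "norm (e a) = 1"
  using assms unfolding adapted_def by (auto simp: norm_eq_1)

lemma adapted_onb: assumes "adapted \<tau> e" shows "onb EE (dim EE) e"
  by (rule onb_subspace_dim[OF subspace_EE _ refl])
    (use adaptedD[OF assms] E_subset_EE in blast)+

text \<open>Eigenbases of the separate \<open>V i\<close> are pooled. The common order of the
  eigenvalues is what summation by parts needs; the bounds by the extreme eigenvalues are kept for
  compactness.\<close>

lemma sorted_eigenbasis:
  assumes V: "\<And>i. i \<in> {1..k} \<Longrightarrow> pos_def_on (E i) (V i)"
  shows "\<exists>\<tau> e l. adapted \<tau> e \<and> (\<forall>a<dim EE. l a = inner (V (\<tau> a) (e a)) (e a) \<and> 0 < l a)
     \<and> (\<forall>a b. a \<le> b \<longrightarrow> b < dim EE \<longrightarrow> l a \<le> l b)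
     \<and> (\<Sum>i\<in>{1..k}. c i * ln (det_on (E i) (V i))) = (\<Sum>a<dim EE. c (\<tau> a) * ln (l a))
     \<and> (\<forall>i\<in>{1..k}. \<forall>x\<in>E i. l 0 * (norm x)\<^sup>2 \<le> inner (V i x) x
         \<and> inner (V i x) x \<le> l (dim EE - 1) * (norm x)\<^sup>2)"
proof -
  have "\<exists>b. onb (E i) (dim (E i)) b \<and> (\<forall>p<dim (E i). \<forall>q<dim (E i). p \<noteq> q \<longrightarrow> inner (V i (b p)) (b q) = 0)"
    if "i \<in> {1..k}" for i
    using spectral_theorem_on[OF subE[OF that], of "V i"] V[OF that] unfolding pos_def_on_def by blast
  then obtain b where b: "\<And>i. i \<in> {1..k} \<Longrightarrow> onb (E i) (dim (E i)) (b i)"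
    and diag: "\<And>i p q. i \<in> {1..k} \<Longrightarrow> p < dim (E i) \<Longrightarrow> q < dim (E i) \<Longrightarrow> p \<noteq> q \<Longrightarrow> inner (V i (b i p)) (b i q) = 0"
    by metis
  define P where "P = (SIGMA i:{1..k}. {..<dim (E i)})"
  define key where "key = (\<lambda>(i, p). inner (V i (b i p)) (b i p))"
  have "finite P" unfolding P_def by auto
  then obtain xs0 where xs0: "set xs0 = P" "distinct xs0" using finite_distinct_list by blast
  \<comment> \<open>The order is by eigenvalue alone, so vectors of different summands are
    interleaved and \<open>\<tau>\<close> need not be monotone.\<close>
  define xs where "xs = sort_key key xs0"
  have xs: "set xs = P" "distinct xs" "sorted (map key xs)" using xs0 by (auto simp: xs_def)
  define N where "N = length xs"
  define \<tau> where "\<tau> = (\<lambda>a. fst (xs ! a))"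
  define e where "e = (\<lambda>a. b (fst (xs ! a)) (snd (xs ! a)))"
  define l where "l = (\<lambda>a. key (xs ! a))"
  have bij: "bij_betw ((!) xs) {..<N} P"
    using xs by (intro bij_betw_nth) (auto simp: N_def)
  have mem: "\<tau> a \<in> {1..k}" "snd (xs ! a) < dim (E (\<tau> a))" if "a < N" for a
  proof -
    obtain i p where ip: "xs ! a = (i, p)" by (cases "xs ! a")
    have "(i, p) \<in> P" using bij_betwE[OF bij] that ip by force
    then show "\<tau> a \<in> {1..k}" "snd (xs ! a) < dim (E (\<tau> a))" by (auto simp: P_def \<tau>_def ip)
  qed
  have eE: "e a \<in> E (\<tau> a)" if "a < N" for a
    using onbD(2)[OF b[OF mem(1)[OF that]] mem(2)[OF that]] by (simp add: e_def \<tau>_def)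
  have ortho: "inner (e a) (e a') = (if a = a' then 1 else 0)" if a: "a < N" "a' < N" for a a'
  proof (cases "\<tau> a = \<tau> a'")
    case True
    have "xs ! a = xs ! a' \<longleftrightarrow> a = a'" using xs(2) a by (simp add: N_def nth_eq_iff_index_eq)
    then have "snd (xs ! a) = snd (xs ! a') \<longleftrightarrow> a = a'" using True by (auto simp: \<tau>_def prod_eq_iff)
    then show ?thesis
      using onbD(3)[OF b[OF mem(1)[OF a(1)]] mem(2)[OF a(1)], of "snd (xs ! a')"] mem(2)[OF a(2)] True
      by (simp add: e_def \<tau>_def)
  next
    case False
    then show ?thesis using orthE[OF mem(1)[OF a(1)] mem(1)[OF a(2)] False eE[OF a(1)] eE[OF a(2)]] by auto
  qed
  have onb: "onb EE N e"
  proof (rule onbI[OF ortho])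
    show "span (e ` {..<N}) = EE"
    proof
      show "span (e ` {..<N}) \<subseteq> EE"
        using eE mem(1) E_subset_EE by (intro span_minimal subspace_EE) blast
      have "E i \<subseteq> span (e ` {..<N})" if i: "i \<in> {1..k}" for i
      proof -
        have "b i ` {..<dim (E i)} \<subseteq> e ` {..<N}"
        proof
          fix y assume "y \<in> b i ` {..<dim (E i)}"
          then obtain p where p: "p < dim (E i)" "y = b i p" by blast
          then have "(i, p) \<in> (!) xs ` {..<N}" using bij i by (auto simp: bij_betw_def P_def)
          then obtain a where "a < N" "xs ! a = (i, p)" by auto
          then show "y \<in> e ` {..<N}" using p by (auto simp: e_def intro!: image_eqI[of _ _ a])
        qed
        then show ?thesis using onb_span[OF b[OF i]] span_mono by blast
      qed
      then have "(\<Sum>i\<in>{1..k}. y i) \<in> span (e ` {..<N})" if "\<And>i. i \<in> {1..k} \<Longrightarrow> y i \<in> E i" for y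
        using that by (intro span_sum) blast
      then show "EE \<subseteq> span (e ` {..<N})" unfolding sum_of_subspaces_def by blast
    qed
  qed
  have N: "N = dim EE" using onb_dim[OF onb] by simp
  have ad: "adapted \<tau> e" unfolding adapted_def N[symmetric] using mem(1) eE ortho by blast
  have key_pos: "0 < key (i, p)" if "i \<in> {1..k}" "p < dim (E i)" for i p
  proof -
    have "b i p \<noteq> 0" using onbD(3)[OF b[OF that(1)] that(2) that(2)] by auto
    then show ?thesis
      using V[OF that(1)] onbD(2)[OF b[OF that(1)] that(2)] by (simp add: key_def pos_def_on_def)
  qed
  have l: "l a = inner (V (\<tau> a) (e a)) (e a)" "0 < l a" if "a < N" for a
    using key_pos[OF mem[OF that]] by (simp_all add: l_def key_def \<tau>_def e_def split_beta)
  have mono: "l a \<le> l a'" if "a \<le> a'" "a' < N" for a a'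
    using sorted_nth_mono[OF xs(3), of a a'] that by (simp add: l_def N_def)
  have sum: "(\<Sum>i\<in>{1..k}. c i * ln (det_on (E i) (V i))) = (\<Sum>a<N. c (\<tau> a) * ln (l a))"
  proof -
    have "c i * ln (det_on (E i) (V i)) = (\<Sum>p<dim (E i). c i * ln (key (i, p)))" if i: "i \<in> {1..k}" for i
    proof -
      have "det_on (E i) (V i) = (\<Prod>p<dim (E i). key (i, p))"
        using det_on_diagonal[OF b[OF i] pos_def_on_linear[OF V[OF i]]] diag[OF i] by (simp add: key_def)
      moreover have "ln (\<Prod>p<dim (E i). key (i, p)) = (\<Sum>p<dim (E i). ln (key (i, p)))"
        using less_imp_neq[OF key_pos[OF i]] by (intro ln_prod) force+
      ultimately show ?thesis by (simp add: sum_distrib_left)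
    qed
    then have "(\<Sum>i\<in>{1..k}. c i * ln (det_on (E i) (V i))) = (\<Sum>i\<in>{1..k}. \<Sum>p<dim (E i). c i * ln (key (i, p)))"
      by (rule sum.cong[OF refl])
    also have "\<dots> = (\<Sum>(i, p)\<in>P. c i * ln (key (i, p)))"
      unfolding P_def by (rule sum.Sigma) auto
    also have "\<dots> = (\<Sum>a<N. c (\<tau> a) * ln (l a))"
      unfolding sum.reindex_bij_betw[OF bij, symmetric] by (simp add: \<tau>_def l_def split_beta)
    finally show ?thesis .
  qed
  have bounds: "l 0 * (norm x)\<^sup>2 \<le> inner (V i x) x" "inner (V i x) x \<le> l (N - 1) * (norm x)\<^sup>2"
    if i: "i \<in> {1..k}" and x: "x \<in> E i" for i x
  proof -
    have Vx: "inner (V i x) x = (\<Sum>p<dim (E i). (inner x (b i p))\<^sup>2 * key (i, p))"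
      using diagonal_quadratic_form[OF b[OF i] pos_def_on_linear[OF V[OF i]] _ x] diag[OF i]
      by (simp add: key_def)
    have nx: "(norm x)\<^sup>2 = (\<Sum>p<dim (E i). (inner x (b i p))\<^sup>2)"
      using diagonal_quadratic_form[OF b[OF i] linear_map_on_id _ x] onbD(3)[OF b[OF i]]
      by (simp add: power2_norm_eq_inner)
    have kb: "l 0 \<le> key (i, p) \<and> key (i, p) \<le> l (N - 1)" if "p < dim (E i)" for p
    proof -
      have "(i, p) \<in> (!) xs ` {..<N}" using bij i that by (auto simp: bij_betw_def P_def)
      then obtain a where a: "a < N" "xs ! a = (i, p)" by auto
      then have "key (i, p) = l a" by (simp add: l_def)
      then show ?thesis using mono[of 0 a] mono[of a "N - 1"] a by simp
    qed
    show "l 0 * (norm x)\<^sup>2 \<le> inner (V i x) x"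
      unfolding Vx nx sum_distrib_left using kb
      by (intro sum_mono, subst mult.commute, intro mult_left_mono) auto
    show "inner (V i x) x \<le> l (N - 1) * (norm x)\<^sup>2"
      unfolding Vx nx sum_distrib_left using kb
      by (intro sum_mono, subst mult.commute, intro mult_right_mono) auto
  qed
  show ?thesis
    by (intro exI[of _ \<tau>] exI[of _ e] exI[of _ l] conjI allI impI ballI ad)
      (use l mono sum bounds N in auto)
qed

lemma proj_flag:
  assumes ad: "adapted \<tau> e" and p: "p \<le> dim EE" and i: "i \<in> {1..k}"
  shows "proj i ` span (e ` {..<p}) = span (e ` {a. a < p \<and> \<tau> a = i})"
proof -
  have pe: "proj i (e a) = (if \<tau> a = i then e a else 0)" if "a < p" for a
  proof -
    have a: "a < dim EE" using that p by simp
    show ?thesis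
      using proj_other[OF i adaptedD(1)[OF ad a] _ adaptedD(2)[OF ad a]]
        orth_proj_ident[OF subE[OF i], of "e a"] adaptedD(2)[OF ad a] by auto
  qed
  have "proj i ` span (e ` {..<p}) = span (proj i ` e ` {..<p})"
    using linear_span_image[OF linear_proj[OF i]] by simp
  also have "\<dots> = span (e ` {a. a < p \<and> \<tau> a = i})"
  proof
    show "span (proj i ` e ` {..<p}) \<subseteq> span (e ` {a. a < p \<and> \<tau> a = i})"
    proof (rule span_minimal)
      show "proj i ` e ` {..<p} \<subseteq> span (e ` {a. a < p \<and> \<tau> a = i})"
      proof
        fix y assume "y \<in> proj i ` e ` {..<p}"
        then obtain a where a: "a < p" "y = proj i (e a)" by blast
        show "y \<in> span (e ` {a. a < p \<and> \<tau> a = i})"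
        proof (cases "\<tau> a = i")
          case True
          then show ?thesis using a pe[OF a(1)] by (auto intro!: span_base)
        next
          case False
          then show ?thesis using a pe[OF a(1)] by (simp add: span_zero)
        qed
      qed
    qed simp
    show "span (e ` {a. a < p \<and> \<tau> a = i}) \<subseteq> span (proj i ` e ` {..<p})"
    proof (rule span_mono)
      show "e ` {a. a < p \<and> \<tau> a = i} \<subseteq> proj i ` e ` {..<p}"
      proof
        fix y assume "y \<in> e ` {a. a < p \<and> \<tau> a = i}"
        then obtain a where a: "a < p" "\<tau> a = i" "y = e a" by blast
        then have "proj i (e a) = y" using pe by simp
        then show "y \<in> proj i ` e ` {..<p}" using a(1) by blast
      qed
    qed
  qed
  finally show ?thesis .
qed

text \<open>Each basis vector lies in a single summand, so projecting a span of basis vectors just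
  selects some of them. This makes the flags legitimate test subspaces for the dimension
  condition.\<close>

lemma product_form_flag:
  assumes ad: "adapted \<tau> e" and p: "p \<le> dim EE"
  shows "product_form k E (span (e ` {..<p}))"
proof -
  let ?T = "span (e ` {..<p})"
  have sub: "?T \<subseteq> EE"
  proof (intro span_minimal subspace_EE subsetI)
    fix y assume "y \<in> e ` {..<p}"
    then show "y \<in> EE" using onbD(2)[OF adapted_onb[OF ad]] p by auto
  qed
  have "?T = sum_of_subspaces k (\<lambda>i. proj i ` ?T)"
  proof
    show "?T \<subseteq> sum_of_subspaces k (\<lambda>i. proj i ` ?T)"
    proof
      fix x assume x: "x \<in> ?T"
      then have "x = (\<Sum>i\<in>{1..k}. proj i x)" using sub EE_decomp by force
      then show "x \<in> sum_of_subspaces k (\<lambda>i. proj i ` ?T)"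
        unfolding sum_of_subspaces_def using x by blast
    qed
    have le: "proj i ` ?T \<subseteq> ?T" if "i \<in> {1..k}" for i
      unfolding proj_flag[OF ad p that] by (intro span_mono image_mono) auto
    have "(\<Sum>i\<in>{1..k}. y i) \<in> ?T" if "\<forall>i\<in>{1..k}. y i \<in> proj i ` ?T" for y
      using that le by (intro span_sum) blast
    then show "sum_of_subspaces k (\<lambda>i. proj i ` ?T) \<subseteq> ?T" unfolding sum_of_subspaces_def by blast
  qed
  then show ?thesis unfolding product_form_def using sub subspace_span by blast
qed

lemma sum_c_flag:
  assumes ad: "adapted \<tau> e" and p: "p \<le> dim EE"
  shows "(\<Sum>i\<in>{1..k}. c i * real (dim (proj i ` span (e ` {..<p})))) = (\<Sum>a<p. c (\<tau> a))"
proof -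
  have "c i * real (dim (proj i ` span (e ` {..<p}))) = (\<Sum>a\<in>{a \<in> {..<p}. \<tau> a = i}. c (\<tau> a))"
    if i: "i \<in> {1..k}" for i
  proof -
    have "dim (span (e ` {a. a < p \<and> \<tau> a = i})) = card {a. a < p \<and> \<tau> a = i}"
      using adaptedD(3)[OF ad] p by (intro orthonormal_family_independent(3)) auto
    then show ?thesis unfolding proj_flag[OF ad p i] by simp
  qed
  then have "(\<Sum>i\<in>{1..k}. c i * real (dim (proj i ` span (e ` {..<p})))) =
      (\<Sum>i\<in>{1..k}. \<Sum>a\<in>{a \<in> {..<p}. \<tau> a = i}. c (\<tau> a))"
    by (rule sum.cong[OF refl])
  also have "\<dots> = (\<Sum>a<p. c (\<tau> a))"
    using adaptedD(1)[OF ad] p by (intro sum.group) auto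
  finally show ?thesis .
qed

section \<open>Jump sets and weights along a flag\<close>

definition Jumps :: "(nat \<Rightarrow> 'a) \<Rightarrow> nat \<Rightarrow> nat set" where
  "Jumps e j = jumps (\<lambda>a. Bj j (e a)) (dim EE)"

lemma Bj_flag:
  assumes j: "j \<in> {1..m}" and p: "p \<le> dim EE"
  shows "dim (Bj j ` span (e ` {..<p})) = card (Jumps e j \<inter> {..<p})"
    and "Bj j ` span (e ` {..<p}) = span ((\<lambda>a. Bj j (e a)) ` (Jumps e j \<inter> {..<p}))"
proof -
  have *: "Bj j ` span (e ` {..<p}) = span ((\<lambda>a. Bj j (e a)) ` {..<p})"
    using linear_span_image[OF linear_Bj[OF j], of "e ` {..<p}"] by (simp add: image_image)
  show "dim (Bj j ` span (e ` {..<p})) = card (Jumps e j \<inter> {..<p})"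
    unfolding * Jumps_def jumps_Int[OF p] card_jumps by (rule dim_span)
  show "Bj j ` span (e ` {..<p}) = span ((\<lambda>a. Bj j (e a)) ` (Jumps e j \<inter> {..<p}))"
    unfolding * Jumps_def jumps_Int[OF p] span_jumps ..
qed

lemma Jumps_subset: "Jumps e j \<subseteq> {..<dim EE}"
  by (auto simp: Jumps_def jumps_def)

text \<open>The coefficient of \<open>ln (l a)\<close> in the upper bound for the functional; its partial sums are
  the defects in the dimension condition for the flag spanned by \<open>e\<close>.\<close>

definition weight :: "(nat \<Rightarrow> nat) \<Rightarrow> (nat \<Rightarrow> 'a) \<Rightarrow> nat \<Rightarrow> real" where
  "weight \<tau> e a = (\<Sum>j\<in>{1..m}. d j * of_bool (a \<in> Jumps e j)) - c (\<tau> a)"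

text \<open>One and the same jump set serves every \<open>p\<close>: the number of jumps below
  \<open>p\<close> is the dimension of the image of the \<open>p\<close>-th flag member, and
  grouping by \<open>\<tau>\<close> counts its projections.\<close>

lemma sum_weight:
  assumes ad: "adapted \<tau> e" and p: "p \<le> dim EE"
  shows "(\<Sum>a<p. weight \<tau> e a) =
    (\<Sum>j\<in>{1..m}. d j * real (dim (Bj j ` span (e ` {..<p}))))
      - (\<Sum>i\<in>{1..k}. c i * real (dim (proj i ` span (e ` {..<p}))))"
proof -
  have "(\<Sum>a<p. \<Sum>j\<in>{1..m}. d j * of_bool (a \<in> Jumps e j)) =
      (\<Sum>j\<in>{1..m}. \<Sum>a<p. d j * of_bool (a \<in> Jumps e j))" by (rule sum.swap)
  also have "\<dots> = (\<Sum>j\<in>{1..m}. d j * real (dim (Bj j ` span (e ` {..<p}))))"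
  proof (rule sum.cong[OF refl])
    fix j assume j: "j \<in> {1..m}"
    have "(\<Sum>a<p. d j * of_bool (a \<in> Jumps e j)) = d j * (\<Sum>a<p. of_bool (a \<in> Jumps e j))"
      by (rule sum_distrib_left[symmetric])
    also have "(\<Sum>a<p. of_bool (a \<in> Jumps e j)) = real (card (Jumps e j \<inter> {..<p}))"
      by (simp add: Int_commute Int_def)
    finally show "(\<Sum>a<p. d j * of_bool (a \<in> Jumps e j)) = d j * real (dim (Bj j ` span (e ` {..<p})))"
      unfolding Bj_flag(1)[OF j p] .
  qed
  finally show ?thesis unfolding weight_def sum_subtractf sum_c_flag[OF ad p] by simp
qed

lemma flag_top: "adapted \<tau> e \<Longrightarrow> span (e ` {..<dim EE}) = EE"
  using onb_span[OF adapted_onb] by blast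

text \<open>The top of the flag is \<open>EE\<close>, where scaling and surjectivity give 0. The
  intermediate members are nonzero and proper, so for simple data none of the finitely many partial
  sums vanishes, which yields a common positive \<open>\<epsilon>\<close>.\<close>

lemma weight_bounds:
  assumes sc: "scaling_condition k m E F c d" and dc: "dimension_condition k m E c d B"
    and ad: "adapted \<tau> e"
  shows "(\<Sum>a<dim EE. weight \<tau> e a) = 0"
    and "\<exists>\<epsilon>\<ge>0. (simple_datum k m E c d B \<longrightarrow> 0 < \<epsilon>) \<and>
      (\<forall>p. 0 < p \<longrightarrow> p < dim EE \<longrightarrow> \<epsilon> \<le> (\<Sum>a<p. weight \<tau> e a))"
proof -
  show "(\<Sum>a<dim EE. weight \<tau> e a) = 0"
    using sc sum_weight[OF ad order_refl] unfolding flag_top[OF ad] scaling_condition_def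
    by (simp add: proj_image_EE Bj_surj[OF sc dc])
  let ?S = "\<lambda>p. \<Sum>a<p. weight \<tau> e a"
  have nonneg: "0 \<le> ?S p" if "p < dim EE" for p
  proof -
    have p: "p \<le> dim EE" using that by simp
    show ?thesis
      using dc product_form_flag[OF ad p] unfolding dimension_condition_def sum_weight[OF ad p] by simp
  qed
  show "\<exists>\<epsilon>\<ge>0. (simple_datum k m E c d B \<longrightarrow> 0 < \<epsilon>) \<and> (\<forall>p. 0 < p \<longrightarrow> p < dim EE \<longrightarrow> \<epsilon> \<le> ?S p)"
  proof (cases "simple_datum k m E c d B")
    case False
    then show ?thesis using nonneg by (intro exI[of _ 0]) simp
  next
    case simple: True
    have pos: "0 < ?S p" if p: "0 < p" "p < dim EE" for p
    proof -
      let ?T = "span (e ` {..<p})"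
      have ple: "p \<le> dim EE" using p by simp
      have dT: "dim ?T = p"
        using orthonormal_family_independent(3)[of "{..<p}" e] adaptedD(3)[OF ad] p by simp
      have "?T \<noteq> {0}"
      proof
        assume h: "?T = {0}"
        have "dim ?T = 0" unfolding h by simp
        with dT p(1) show False by linarith
      qed
      moreover have "?T \<noteq> EE"
      proof
        assume h: "?T = EE"
        have "dim ?T = dim EE" unfolding h ..
        with dT p(2) show False by linarith
      qed
      moreover have "\<not> critical_subspace k m E c d B ?T" using simple by (simp add: simple_datum_def)
      ultimately have "?S p \<noteq> 0"
        unfolding critical_subspace_def sum_weight[OF ad ple] using product_form_flag[OF ad ple] by argo
      then show ?thesis using nonneg[OF p(2)] by simp
    qed
    \<comment> \<open>The inserted 1 covers \<open>dim EE \<le> 1\<close>, where there are no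
      intermediate flag members.\<close>
    define \<epsilon> where "\<epsilon> = Min (insert 1 (?S ` {0<..<dim EE}))"
    have "0 < \<epsilon>" unfolding \<epsilon>_def using pos by (subst Min_gr_iff) auto
    moreover have "\<epsilon> \<le> ?S p" if "0 < p" "p < dim EE" for p
      unfolding \<epsilon>_def using that by (intro Min_le) auto
    ultimately show ?thesis using less_imp_le by blast
  qed
qed

subsection \<open>Finiteness\<close>

lemma admissible_on_E:
  assumes adm: "adm V U" and i: "i \<in> {1..k}" and x: "x \<in> E i" and j: "j \<in> {1..m}"
  shows "inner (U j (Bj j x)) (Bj j x) \<le> inner (V i x) x / (c i * d j)"
proof -
  note A = admissibleD[OF adm]
  have nn: "0 \<le> inner (U j (Bj j x)) (Bj j x)" if "j \<in> {1..m}" for j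
    using pos_def_on_imp_semidef[OF A(2)[OF that]] Bj_in[OF that] by (simp add: pos_semidef_on_def)
  have "d j * inner (U j (Bj j x)) (Bj j x) \<le> (\<Sum>j\<in>{1..m}. d j * inner (U j (Bj j x)) (Bj j x))"
    using nn dpos j by (intro member_le_sum) (auto intro: mult_nonneg_nonneg less_imp_le)
  also have "\<dots> \<le> (\<Sum>i'\<in>{1..k}. inner (V i' (proj i' x)) (proj i' x) / c i')"
    by (rule A(3)[OF E_subset_EE[OF i x]])
  also have "\<dots> = (\<Sum>i'\<in>{1..k}. if i' = i then inner (V i x) x / c i else 0)"
    using proj_other[OF _ i _ x] orth_proj_ident[OF subE[OF i] x] by (intro sum.cong) auto
  also have "\<dots> = inner (V i x) x / c i" using i by simp
  finally show ?thesis using dpos[OF j] cpos[OF i] by (simp add: field_simps)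
qed

text \<open>The determinant times the Gram determinant of the images is the determinant of the form
  on them, which Hadamard bounds by diagonal entries. Degeneration of the basis enters only through
  the lower bound \<open>g\<close>.\<close>

lemma ln_det_le:
  assumes adm: "adm V U" and ad: "adapted \<tau> e" and j: "j \<in> {1..m}"
    and I: "I \<subseteq> {..<dim EE}" and h: "bij_betw h {..<dim (F j)} I"
    and l: "\<And>a. a < dim EE \<Longrightarrow> l a = inner (V (\<tau> a) (e a)) (e a)" "\<And>a. a < dim EE \<Longrightarrow> 0 < l a"
    and g: "0 < g" "g \<le> opdet (\<lambda>x. x) (\<lambda>p. Bj j (e (h p))) (dim (F j))"
  shows "ln (det_on (F j) (U j)) \<le> ln (fact (dim (F j))) - ln g + (\<Sum>a\<in>I. ln (l a) - ln (c (\<tau> a) * d j))"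
proof -
  let ?n = "dim (F j)" and ?v = "\<lambda>p. Bj j (e (h p))"
  note Uj = admissibleD(2)[OF adm j]
  have D: "0 < det_on (F j) (U j)" by (rule det_on_pos_def[OF subF[OF j] Uj])
  have hI: "h p < dim EE" if "p < ?n" for p using bij_betwE[OF h] I that by auto
  have frac: "0 < l a / (c (\<tau> a) * d j)" if "a < dim EE" for a
    using l(2)[OF that] cpos[OF adaptedD(1)[OF ad that]] dpos[OF j] by simp
  have "det_on (F j) (U j) * g \<le> det_on (F j) (U j) * opdet (\<lambda>x. x) ?v ?n"
    using g D by (intro mult_left_mono) auto
  also have "\<dots> = opdet (U j) ?v ?n"
    by (rule opdet_eq_det_on_mult[OF subF[OF j] pos_def_on_linear[OF Uj] Bj_in[OF j], symmetric])
  also have "\<dots> \<le> fact ?n * (\<Prod>p<?n. inner (U j (?v p)) (?v p))"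
    by (rule opdet_le_fact_prod[OF pos_def_on_imp_semidef[OF Uj] subF[OF j] Bj_in[OF j]])
  also have "\<dots> \<le> fact ?n * (\<Prod>p<?n. l (h p) / (c (\<tau> (h p)) * d j))"
  proof (intro mult_left_mono prod_mono conjI)
    fix p assume "p \<in> {..<?n}"
    then have p: "h p < dim EE" using hI by simp
    show "0 \<le> inner (U j (?v p)) (?v p)"
      using pos_def_on_imp_semidef[OF Uj] Bj_in[OF j] by (simp add: pos_semidef_on_def)
    show "inner (U j (?v p)) (?v p) \<le> l (h p) / (c (\<tau> (h p)) * d j)"
      using admissible_on_E[OF adm adaptedD(1)[OF ad p] adaptedD(2)[OF ad p] j] l(1)[OF p] by simp
  qed simp
  also have "(\<Prod>p<?n. l (h p) / (c (\<tau> (h p)) * d j)) = (\<Prod>a\<in>I. l a / (c (\<tau> a) * d j))"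
    by (rule prod.reindex_bij_betw[OF h])
  finally have le: "det_on (F j) (U j) * g \<le> fact ?n * (\<Prod>a\<in>I. l a / (c (\<tau> a) * d j))" .
  have Ppos: "0 < (\<Prod>a\<in>I. l a / (c (\<tau> a) * d j))"
    using frac I by (intro prod_pos) auto
  have "ln (det_on (F j) (U j) * g) \<le> ln (fact ?n * (\<Prod>a\<in>I. l a / (c (\<tau> a) * d j)))"
    using le D g by (subst ln_le_cancel_iff) (auto intro!: mult_pos_pos Ppos)
  then have "ln (det_on (F j) (U j)) + ln g \<le> ln (fact ?n) + ln (\<Prod>a\<in>I. l a / (c (\<tau> a) * d j))"
    using D g(1) Ppos by (simp add: ln_mult_pos)
  also have "ln (\<Prod>a\<in>I. l a / (c (\<tau> a) * d j)) = (\<Sum>a\<in>I. ln (l a / (c (\<tau> a) * d j)))"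
  proof (rule ln_prod)
    show "finite I" using I finite_subset by blast
    show "l a / (c (\<tau> a) * d j) \<noteq> 0" if "a \<in> I" for a
    proof -
      have "a < dim EE" using I that by blast
      from frac[OF this] show ?thesis by (rule less_imp_neq[symmetric])
    qed
  qed
  also have "\<dots> = (\<Sum>a\<in>I. ln (l a) - ln (c (\<tau> a) * d j))"
  proof (rule sum.cong[OF refl])
    fix a assume "a \<in> I"
    then have a: "a < dim EE" using I by blast
    have "0 < c (\<tau> a) * d j" using cpos[OF adaptedD(1)[OF ad a]] dpos[OF j] by simp
    then show "ln (l a / (c (\<tau> a) * d j)) = ln (l a) - ln (c (\<tau> a) * d j)"
      using l(2)[OF a] unfolding ln_div by (metis less_imp_neq)
  qed
  finally show ?thesis by simp
qed

text \<open>The pigeonhole principle makes \<open>\<tau>\<close> constant and compactness makes the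
  unit vectors converge; closed subspaces and orthonormality survive the limit.\<close>

lemma adapted_subsequence:
  fixes \<tau> :: "nat \<Rightarrow> nat \<Rightarrow> nat" and e :: "nat \<Rightarrow> nat \<Rightarrow> 'a"
  assumes ad: "\<And>s. adapted (\<tau> s) (e s)"
  shows "\<exists>(r :: nat \<Rightarrow> nat) \<tau>' e'. strict_mono r \<and> adapted \<tau>' e' \<and> (\<forall>s. \<forall>a<dim EE. \<tau> (r s) a = \<tau>' a)
    \<and> (\<forall>a<dim EE. (\<lambda>s. e (r s) a) \<longlonglongrightarrow> e' a)"
proof -
  let ?n = "dim EE"
  \<comment> \<open>Values of \<open>\<tau> s\<close> beyond \<open>dim EE\<close> are arbitrary, so
    only the restrictions form a finite set.\<close>
  let ?R = "\<lambda>s. restrict (\<tau> s) {..<?n}"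
  have "?R s \<in> {..<?n} \<rightarrow>\<^sub>E {1..k}" for s using adaptedD(1)[OF ad] by auto
  then have "range ?R \<subseteq> {..<?n} \<rightarrow>\<^sub>E {1..k}" by blast
  then have "finite (range ?R)" by (rule finite_subset) (intro finite_PiE; simp)
  then obtain s0 where inf: "infinite {s. ?R s = ?R s0}"
    using pigeonhole_infinite[of "UNIV :: nat set" ?R] by auto
  define \<tau>' where "\<tau>' = \<tau> s0"
  obtain r1 :: "nat \<Rightarrow> nat" where r1: "strict_mono r1" "\<And>s. r1 s \<in> {s. ?R s = ?R s0}"
    using infinite_enumerate[OF inf] by blast
  have \<tau>': "\<tau> (r1 s) a = \<tau>' a" if "a < ?n" for s a
  proof -
    have "?R (r1 s) = ?R s0" using r1(2) by simp
    from fun_cong[OF this, of a] show ?thesis using that by (simp add: \<tau>'_def)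
  qed
  have "bounded (range (\<lambda>s. e (r1 s) a))" if "a \<in> {..<?n}" for a
    unfolding bounded_iff using adaptedD(4)[OF ad] that by auto
  then obtain r2 where r2: "strict_mono r2" "\<And>a. a < ?n \<Longrightarrow> \<exists>l. (\<lambda>s. e (r1 (r2 s)) a) \<longlonglongrightarrow> l"
    using common_convergent_subsequence[of "{..<?n}" "\<lambda>a s. e (r1 s) a"] by auto
  then obtain e' where e': "\<And>a. a < ?n \<Longrightarrow> (\<lambda>s. e (r1 (r2 s)) a) \<longlonglongrightarrow> e' a" by metis
  have "adapted \<tau>' e'"
    unfolding adapted_def
  proof (intro conjI allI impI)
    fix a assume a: "a < ?n"
    show t: "\<tau>' a \<in> {1..k}" using adaptedD(1)[OF ad a] unfolding \<tau>'_def .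
    have "e (r1 (r2 s)) a \<in> E (\<tau>' a)" for s using adaptedD(2)[OF ad a, of "r1 (r2 s)"] \<tau>'[OF a] by simp
    then show "e' a \<in> E (\<tau>' a)"
      using closed_sequentially[OF closed_subspace[OF subE[OF t]], of "\<lambda>s. e (r1 (r2 s)) a"] e'[OF a] by blast
  next
    fix a b assume ab: "a < ?n" "b < ?n"
    have "(\<lambda>s. inner (e (r1 (r2 s)) a) (e (r1 (r2 s)) b)) \<longlonglongrightarrow> inner (e' a) (e' b)"
      by (intro tendsto_inner e' ab)
    moreover have "(\<lambda>s. inner (e (r1 (r2 s)) a) (e (r1 (r2 s)) b)) = (\<lambda>s. if a = b then 1 else 0)"
      using adaptedD(3)[OF ad ab] by (intro ext)
    ultimately have "(\<lambda>s. if a = b then 1 else 0) \<longlonglongrightarrow> inner (e' a) (e' b)" by (simp only:)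
    from LIMSEQ_unique[OF this tendsto_const] show "inner (e' a) (e' b) = (if a = b then 1 else 0)" .
  qed
  moreover have "strict_mono (r1 \<circ> r2)" by (rule strict_mono_o[OF r1(1) r2(1)])
  ultimately show ?thesis
    using \<tau>' e' by (intro exI[of _ "r1 \<circ> r2"] exI[of _ \<tau>'] exI[of _ e']) simp
qed

text \<open>Rescaled to \<open>l0 = 1\<close>, this bound confines a maximizing sequence to a compact set
  when \<open>\<epsilon> > 0\<close>.\<close>

definition controlled :: "(nat \<Rightarrow> 'a \<Rightarrow> 'a) \<Rightarrow> (nat \<Rightarrow> 'b \<Rightarrow> 'b) \<Rightarrow> real \<Rightarrow> real \<Rightarrow> bool" where
  "controlled V U C \<epsilon> \<longleftrightarrow> (\<exists>l0 l1. 0 < l0 \<and> l0 \<le> l1 \<and> J V U \<le> C - \<epsilon> * (ln l1 - ln l0) \<and>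
      (\<forall>i\<in>{1..k}. \<forall>x\<in>E i. l0 * (norm x)\<^sup>2 \<le> inner (V i x) x \<and> inner (V i x) x \<le> l1 * (norm x)\<^sup>2))"

text \<open>Along the subsequence the index sets, the Gram bound, \<open>C\<close> and
  \<open>\<epsilon>\<close> are all dictated by the limit basis and hence uniform, although the
  eigenvalues are those of the individual operators. With \<open>\<epsilon> = 0\<close> it gives
  finiteness, with \<open>\<epsilon> > 0\<close> coercivity.\<close>

lemma subsequence_bound:
  fixes V :: "nat \<Rightarrow> nat \<Rightarrow> 'a \<Rightarrow> 'a" and U :: "nat \<Rightarrow> nat \<Rightarrow> 'b \<Rightarrow> 'b"
  assumes sc: "scaling_condition k m E F c d" and dc: "dimension_condition k m E c d B"
    and adm: "\<And>s. adm (V s) (U s)"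
  shows "\<exists>(r :: nat \<Rightarrow> nat) C \<epsilon>. strict_mono r \<and> 0 \<le> \<epsilon> \<and> (simple_datum k m E c d B \<longrightarrow> 0 < \<epsilon>) \<and>
    (\<forall>s. controlled (V (r s)) (U (r s)) C \<epsilon>)"
proof -
  let ?n = "dim EE"
  define Q where "Q = (\<lambda>s \<tau> e l. adapted \<tau> e \<and> (\<forall>a<?n. l a = inner (V s (\<tau> a) (e a)) (e a) \<and> 0 < l a)
     \<and> (\<forall>a b. a \<le> b \<longrightarrow> b < ?n \<longrightarrow> l a \<le> l b)
     \<and> (\<Sum>i\<in>{1..k}. c i * ln (det_on (E i) (V s i))) = (\<Sum>a<?n. c (\<tau> a) * ln (l a))
     \<and> (\<forall>i\<in>{1..k}. \<forall>x\<in>E i. l 0 * (norm x)\<^sup>2 \<le> inner (V s i x) x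
         \<and> inner (V s i x) x \<le> l (?n - 1) * (norm x)\<^sup>2))"
  have "\<exists>\<tau> e l. Q s \<tau> e l" for s
    unfolding Q_def by (rule sorted_eigenbasis) (rule admissibleD(1)[OF adm])
  then obtain \<tau> e l where Q: "\<And>s. Q s (\<tau> s) (e s) (l s)" by metis
  have ad: "adapted (\<tau> s) (e s)" for s using Q[of s] unfolding Q_def by (elim conjE)
  have "\<forall>a<?n. l s a = inner (V s (\<tau> s a) (e s a)) (e s a) \<and> 0 < l s a" for s
    using Q[of s] unfolding Q_def by (elim conjE)
  then have l: "l s a = inner (V s (\<tau> s a) (e s a)) (e s a)" "0 < l s a" if "a < ?n" for s a
    using that by blast+
  have "\<forall>a b. a \<le> b \<longrightarrow> b < ?n \<longrightarrow> l s a \<le> l s b" for s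
    using Q[of s] unfolding Q_def by (elim conjE)
  then have mono: "l s a \<le> l s b" if "a \<le> b" "b < ?n" for s a b
    using that by blast
  have sumV: "(\<Sum>i\<in>{1..k}. c i * ln (det_on (E i) (V s i))) = (\<Sum>a<?n. c (\<tau> s a) * ln (l s a))" for s
    using Q[of s] unfolding Q_def by (elim conjE)
  have "\<forall>i\<in>{1..k}. \<forall>x\<in>E i. l s 0 * (norm x)\<^sup>2 \<le> inner (V s i x) x
      \<and> inner (V s i x) x \<le> l s (?n - 1) * (norm x)\<^sup>2" for s
    using Q[of s] unfolding Q_def by (elim conjE)
  then have bounds: "l s 0 * (norm x)\<^sup>2 \<le> inner (V s i x) x"
      "inner (V s i x) x \<le> l s (?n - 1) * (norm x)\<^sup>2" if "i \<in> {1..k}" "x \<in> E i" for s i x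
    using that by blast+
  obtain r \<tau>' e' where r: "strict_mono r" and ad': "adapted \<tau>' e'"
    and \<tau>': "\<And>s a. a < ?n \<Longrightarrow> \<tau> (r s) a = \<tau>' a"
    and lim: "\<And>a. a < ?n \<Longrightarrow> (\<lambda>s. e (r s) a) \<longlonglongrightarrow> e' a"
    using adapted_subsequence[of \<tau> e, OF ad] by blast
  define I where "I = Jumps e'"
  have Isub: "I j \<subseteq> {..<?n}" for j unfolding I_def by (rule Jumps_subset)
  have finI: "finite (I j)" for j using Isub finite_subset by blast
  have Iint: "I j \<inter> {..<?n} = I j" for j using Isub by blast
  have cardI: "card (I j) = dim (F j)" and spanI: "span ((\<lambda>a. Bj j (e' a)) ` I j) = F j" if j: "j \<in> {1..m}" for j
    using Bj_flag[OF j order_refl, of e'] Bj_surj[OF sc dc j]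
    unfolding flag_top[OF ad'] I_def[symmetric] Iint by simp_all
  have "\<exists>h. bij_betw h {..<dim (F j)} (I j)" if "j \<in> {1..m}" for j
    using cardI[OF that] finI by (intro finite_same_card_bij) auto
  then obtain h where h: "\<And>j. j \<in> {1..m} \<Longrightarrow> bij_betw (h j) {..<dim (F j)} (I j)" by metis
  define G where "G = (\<lambda>e j. opdet (\<lambda>x. x) (\<lambda>p. Bj j (e (h j p))) (dim (F j)))"
  have Gpos: "0 < G e' j" if j: "j \<in> {1..m}" for j
  proof -
    have "(\<lambda>p. Bj j (e' (h j p))) ` {..<dim (F j)} = (\<lambda>a. Bj j (e' a)) ` I j"
      unfolding bij_betw_imp_surj_on[OF h[OF j], symmetric] by (simp only: image_image)
    then show ?thesis
      unfolding G_def using spanI[OF j] by (intro gram_det_pos[OF subF[OF j]]) simp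
  qed
  have Glim: "(\<lambda>s. G (e (r s)) j) \<longlonglongrightarrow> G e' j" if j: "j \<in> {1..m}" for j
    unfolding G_def
  proof (rule opdet_tendsto)
    fix q assume "q < dim (F j)"
    then have "h j q < ?n" using bij_betwE[OF h[OF j]] Isub by blast
    from lim[OF this] show "(\<lambda>s. Bj j (e (r s) (h j q))) \<longlonglongrightarrow> Bj j (e' (h j q))"
      by (rule bounded_linear.tendsto[OF linear_conv_bounded_linear[THEN iffD1, OF linear_Bj[OF j]]])
    then show "(\<lambda>s. Bj j (e (r s) (h j q))) \<longlonglongrightarrow> Bj j (e' (h j q))" .
  qed
  \<comment> \<open>Half the positive limit is a uniform lower bound for the Gram determinants, once
    finitely many terms are discarded by \<open>r'\<close>.\<close>
  have "\<forall>\<^sub>F s in sequentially. \<forall>j\<in>{1..m}. G e' j / 2 < G (e (r s)) j"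
  proof (intro eventually_ball_finite ballI)
    fix j assume j: "j \<in> {1..m}"
    show "\<forall>\<^sub>F s in sequentially. G e' j / 2 < G (e (r s)) j"
      by (rule order_tendstoD(1)[OF Glim[OF j]]) (use Gpos[OF j] in simp)
  qed simp
  then obtain s0 where s0: "\<And>s j. s0 \<le> s \<Longrightarrow> j \<in> {1..m} \<Longrightarrow> G e' j / 2 < G (e (r s)) j"
    unfolding eventually_sequentially by blast
  obtain \<epsilon> where e0: "0 \<le> \<epsilon>" "simple_datum k m E c d B \<longrightarrow> 0 < \<epsilon>"
    and eS: "\<And>p. 0 < p \<Longrightarrow> p < ?n \<Longrightarrow> \<epsilon> \<le> (\<Sum>a<p. weight \<tau>' e' a)"
    using weight_bounds(2)[OF sc dc ad'] by blast
  define C where "C = (\<Sum>j\<in>{1..m}. d j * (ln (fact (dim (F j))) - ln (G e' j / 2) - (\<Sum>a\<in>I j. ln (c (\<tau>' a) * d j))))"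
  define r' where "r' = (\<lambda>s. r (s + s0))"
  have r': "strict_mono r'" using r unfolding r'_def strict_mono_def by simp
  have main: "J (V (r' s)) (U (r' s)) \<le> C + (\<Sum>a<?n. weight \<tau>' e' a * ln (l (r' s) a))" for s
  proof -
    let ?t = "r' s"
    have "d j * ln (det_on (F j) (U ?t j)) \<le>
        d j * (ln (fact (dim (F j))) - ln (G e' j / 2) - (\<Sum>a\<in>I j. ln (c (\<tau>' a) * d j)))
        + (\<Sum>a<?n. d j * of_bool (a \<in> I j) * ln (l ?t a))" if j: "j \<in> {1..m}" for j
    proof -
      have "ln (det_on (F j) (U ?t j)) \<le> ln (fact (dim (F j))) - ln (G e' j / 2)
          + (\<Sum>a\<in>I j. ln (l ?t a) - ln (c (\<tau> ?t a) * d j))"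
      proof (rule ln_det_le[OF adm ad j Isub h[OF j] l(1) l(2)])
        show "0 < G e' j / 2" using Gpos[OF j] by simp
        show "G e' j / 2 \<le> opdet (\<lambda>x. x) (\<lambda>p. Bj j (e ?t (h j p))) (dim (F j))"
          using s0[of "s + s0" j] j unfolding G_def r'_def by simp
      qed
      also have "(\<Sum>a\<in>I j. ln (l ?t a) - ln (c (\<tau> ?t a) * d j)) = (\<Sum>a\<in>I j. ln (l ?t a)) - (\<Sum>a\<in>I j. ln (c (\<tau>' a) * d j))"
      proof -
        have "\<tau> ?t a = \<tau>' a" if "a \<in> I j" for a
          using \<tau>'[of a "s + s0"] that Isub unfolding r'_def by blast
        then show ?thesis by (simp add: sum_subtractf)
      qed
      finally have "d j * ln (det_on (F j) (U ?t j)) \<le> d j * (ln (fact (dim (F j))) - ln (G e' j / 2)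
          + ((\<Sum>a\<in>I j. ln (l ?t a)) - (\<Sum>a\<in>I j. ln (c (\<tau>' a) * d j))))"
        using dpos[OF j] by (intro mult_left_mono) simp_all
      moreover have "(\<Sum>a<?n. d j * of_bool (a \<in> I j) * ln (l ?t a)) = d j * (\<Sum>a\<in>I j. ln (l ?t a))"
      proof -
        have "(\<Sum>a\<in>I j. ln (l ?t a)) = (\<Sum>a\<in>{..<?n} \<inter> I j. ln (l ?t a))" using Iint[of j] by (simp add: Int_commute)
        also have "\<dots> = (\<Sum>a<?n. if a \<in> I j then ln (l ?t a) else 0)" by (rule sum.inter_restrict) simp
        finally show ?thesis
          by (simp only: sum_distrib_left) (rule sum.cong, auto)
      qed
      ultimately show ?thesis by (simp add: algebra_simps)
    qed
    then have "(\<Sum>j\<in>{1..m}. d j * ln (det_on (F j) (U ?t j))) \<le>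
      (\<Sum>j\<in>{1..m}. d j * (ln (fact (dim (F j))) - ln (G e' j / 2) - (\<Sum>a\<in>I j. ln (c (\<tau>' a) * d j)))
        + (\<Sum>a<?n. d j * of_bool (a \<in> I j) * ln (l ?t a)))" by (rule sum_mono)
    also have "\<dots> = C + (\<Sum>a<?n. \<Sum>j\<in>{1..m}. d j * of_bool (a \<in> I j) * ln (l ?t a))"
      unfolding sum.distrib C_def by (subst sum.swap) (rule refl)
    also have "\<dots> = C + (\<Sum>a<?n. (\<Sum>j\<in>{1..m}. d j * of_bool (a \<in> I j)) * ln (l ?t a))"
      unfolding sum_distrib_right ..
    finally have U: "(\<Sum>j\<in>{1..m}. d j * ln (det_on (F j) (U ?t j))) \<le>
        C + (\<Sum>a<?n. (\<Sum>j\<in>{1..m}. d j * of_bool (a \<in> I j)) * ln (l ?t a))" .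
    have "(\<Sum>a<?n. c (\<tau> ?t a) * ln (l ?t a)) = (\<Sum>a<?n. c (\<tau>' a) * ln (l ?t a))"
      using \<tau>'[of _ "s + s0"] unfolding r'_def by (intro sum.cong) auto
    with U sumV[of ?t] show ?thesis
      unfolding gaussian_functional_def weight_def I_def[symmetric]
      by (simp add: left_diff_distrib sum_subtractf)
  qed
  have "controlled (V (r' s)) (U (r' s)) C \<epsilon>" for s
  proof (cases "?n = 0")
    case True
    \<comment> \<open>When \<open>EE\<close> is zero there are no eigenvalues; both bounds are taken
      to be 1.\<close>
    have "x = 0" if "i \<in> {1..k}" "x \<in> E i" for i x
      using E_subset_EE[OF that] True by (simp add: dim_eq_0) blast
    moreover have "inner (V (r' s) i 0) 0 = 0" for i by simp
    ultimately show ?thesis using main[of s] True unfolding controlled_def by (intro exI[of _ 1]) force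
  next
    case False
    have n0: "0 < ?n" using False by (rule neq0_conv[THEN iffD1])
    have "(\<Sum>a<?n. weight \<tau>' e' a * ln (l (r' s) a)) \<le> - \<epsilon> * (ln (l (r' s) (?n - 1)) - ln (l (r' s) 0))"
    proof (rule Abel_sum_bound[OF _ eS weight_bounds(1)[OF sc dc ad']])
      fix a assume a: "Suc a < ?n"
      show "ln (l (r' s) a) \<le> ln (l (r' s) (Suc a))"
        using mono[of a "Suc a" "r' s"] l(2)[of a "r' s"] a by simp
    qed (assumption | rule n0)+
    then have "J (V (r' s)) (U (r' s)) \<le> C - \<epsilon> * (ln (l (r' s) (?n - 1)) - ln (l (r' s) 0))"
      using main[of s] by simp
    moreover have "0 < l (r' s) 0" "l (r' s) 0 \<le> l (r' s) (?n - 1)"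
      using l(2)[OF n0] mono[of 0 "?n - 1" "r' s"] n0 by simp_all
    ultimately show ?thesis
      using bounds[of _ _ "r' s"] unfolding controlled_def by (intro exI[of _ "l (r' s) 0"] exI[of _ "l (r' s) (?n - 1)"]) blast
  qed
  then show ?thesis using r' e0 by blast
qed

text \<open>On a sequence with functional above \<open>s\<close> at index \<open>s\<close>, some
  subsequence would be bounded by its constant \<open>C\<close>, while its values grow at least like
  the index.\<close>

lemma bounded_if_conditions:
  assumes sc: "scaling_condition k m E F c d" and dc: "dimension_condition k m E c d B"
  shows "\<exists>M. \<forall>V U. adm V U \<longrightarrow> J V U \<le> M"
proof (rule ccontr)
  assume "\<not> ?thesis"
  then have "\<forall>s::nat. \<exists>V U. adm V U \<and> real s < J V U" by (meson not_le)
  then obtain V U where adm: "\<And>s::nat. adm (V s) (U s)" and big: "\<And>s. real s < J (V s) (U s)"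
    unfolding choice_iff by blast
  obtain r :: "nat \<Rightarrow> nat" and C \<epsilon> where r: "strict_mono r" "0 \<le> \<epsilon>" and
    bd: "\<And>s. controlled (V (r s)) (U (r s)) C \<epsilon>"
    using subsequence_bound[of V U, OF sc dc adm] by blast
  obtain s :: nat where s: "C < real s" using reals_Archimedean2 by blast
  obtain l0 l1 where l: "0 < l0" "l0 \<le> l1" "J (V (r s)) (U (r s)) \<le> C - \<epsilon> * (ln l1 - ln l0)"
    using bd[of s] unfolding controlled_def by blast
  have "0 \<le> \<epsilon> * (ln l1 - ln l0)" using r(2) l by (intro mult_nonneg_nonneg) auto
  then have "J (V (r s)) (U (r s)) \<le> C" using l(3) by linarith
  moreover have "real s \<le> real (r s)" using seq_suble[OF r(1)] by simp
  ultimately show False using big[of "r s"] s by linarith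
qed

subsection \<open>Extremizers of simple data\<close>

text \<open>Since the functional is at least \<open>M\<close>, the penalty term bounds
  \<open>ln l1 - ln l0\<close> by (C - M) / \<epsilon>. Division by \<open>l0\<close> then preserves
  the functional by scaling and confines all eigenvalues to a fixed interval.\<close>

lemma normalized_bound:
  assumes sc: "scaling_condition k m E F c d" and adm: "adm V U" and ctl: "controlled V U C \<epsilon>"
    and e: "0 < \<epsilon>" and M: "M \<le> J V U"
  shows "\<exists>V' U'. adm V' U' \<and> J V' U' = J V U \<and>
    (\<forall>i\<in>{1..k}. \<forall>x\<in>E i. (norm x)\<^sup>2 \<le> inner (V' i x) x
       \<and> inner (V' i x) x \<le> exp ((C - M) / \<epsilon>) * (norm x)\<^sup>2)"
proof -
  obtain l0 l1 where l: "0 < l0" "l0 \<le> l1" "J V U \<le> C - \<epsilon> * (ln l1 - ln l0)"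
    and V: "\<And>i x. i \<in> {1..k} \<Longrightarrow> x \<in> E i \<Longrightarrow> l0 * (norm x)\<^sup>2 \<le> inner (V i x) x"
      "\<And>i x. i \<in> {1..k} \<Longrightarrow> x \<in> E i \<Longrightarrow> inner (V i x) x \<le> l1 * (norm x)\<^sup>2"
    using ctl unfolding controlled_def by blast
  let ?t = "1 / l0"
  have "\<epsilon> * (ln l1 - ln l0) \<le> C - M" using l(3) M by linarith
  then have "ln l1 - ln l0 \<le> (C - M) / \<epsilon>" using e by (simp add: field_simps)
  then have "exp (ln l1 - ln l0) \<le> exp ((C - M) / \<epsilon>)" by simp
  moreover have "exp (ln l1 - ln l0) = l1 / l0" using l by (simp add: exp_diff)
  ultimately have K: "l1 / l0 \<le> exp ((C - M) / \<epsilon>)" by simp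
  have t: "0 < ?t" using l by simp
  have "J (\<lambda>i x. ?t *\<^sub>R V i x) (\<lambda>j x. ?t *\<^sub>R U j x) = J V U"
    using functional_scaleR(2)[OF adm t] sc unfolding scaling_condition_def by simp
  moreover have "(norm x)\<^sup>2 \<le> inner (?t *\<^sub>R V i x) x" if "i \<in> {1..k}" "x \<in> E i" for i x
    using V(1)[OF that] l(1) by (simp add: field_simps)
  moreover have "inner (?t *\<^sub>R V i x) x \<le> exp ((C - M) / \<epsilon>) * (norm x)\<^sup>2" if "i \<in> {1..k}" "x \<in> E i" for i x
  proof -
    have "inner (?t *\<^sub>R V i x) x \<le> (l1 / l0) * (norm x)\<^sup>2"
      using V(2)[OF that] l(1) by (simp add: field_simps)
    also have "\<dots> \<le> exp ((C - M) / \<epsilon>) * (norm x)\<^sup>2" using K by (intro mult_right_mono) auto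
    finally show ?thesis .
  qed
  ultimately show ?thesis using functional_scaleR(1)[OF adm t] by blast
qed

text \<open>Every \<open>z\<close> in \<open>F j\<close> has a preimage \<open>y\<close> of norm at
  most \<open>R j * norm z\<close>; the constraint at \<open>y\<close> bounds the form of
  \<open>U j\<close> at \<open>z\<close>, and hence the norm of \<open>U j z\<close>.\<close>

lemma U_bounded:
  assumes sc: "scaling_condition k m E F c d" and dc: "dimension_condition k m E c d B" and K: "0 \<le> K"
  shows "\<exists>L. \<forall>V U. adm V U \<longrightarrow> (\<forall>i\<in>{1..k}. \<forall>x\<in>E i. inner (V i x) x \<le> K * (norm x)\<^sup>2) \<longrightarrow>
    (\<forall>j\<in>{1..m}. \<forall>z\<in>F j. norm (U j z) \<le> L j * norm z)"
proof -
  have "\<exists>R. \<forall>z\<in>Bj j ` EE. \<exists>y\<in>EE. Bj j y = z \<and> norm y \<le> R * norm z" if "j \<in> {1..m}" for j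
    by (rule bounded_right_inverse[OF linear_Bj[OF that] subspace_EE])
  then obtain R where R: "\<And>j z. j \<in> {1..m} \<Longrightarrow> z \<in> F j \<Longrightarrow> \<exists>y\<in>EE. Bj j y = z \<and> norm y \<le> R j * norm z"
    using Bj_surj[OF sc dc] by metis
  define C where "C = (\<Sum>i\<in>{1..k}. K / c i)"
  have C0: "0 \<le> C" unfolding C_def using K cpos by (intro sum_nonneg divide_nonneg_pos) auto
  define L where "L = (\<lambda>j. C * (R j)\<^sup>2 / d j)"
  have "norm (U j z) \<le> L j * norm z"
    if adm: "adm V U" and V: "\<forall>i\<in>{1..k}. \<forall>x\<in>E i. inner (V i x) x \<le> K * (norm x)\<^sup>2"
      and j: "j \<in> {1..m}" and z: "z \<in> F j" for V U j z
  proof (rule pos_semidef_on_norm_le[OF pos_def_on_imp_semidef[OF admissibleD(2)[OF adm j]] subF[OF j] _ _ z])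
    show "0 \<le> L j" unfolding L_def using C0 dpos[OF j] by (intro divide_nonneg_pos mult_nonneg_nonneg) auto
    fix w assume w: "w \<in> F j"
    obtain y where y: "y \<in> EE" "Bj j y = w" "norm y \<le> R j * norm w" using R[OF j w] by blast
    have nn: "0 \<le> inner (U j (Bj j y)) (Bj j y)" if "j \<in> {1..m}" for j
      using pos_def_on_imp_semidef[OF admissibleD(2)[OF adm that]] Bj_in[OF that] by (simp add: pos_semidef_on_def)
    have "d j * inner (U j w) w \<le> (\<Sum>j\<in>{1..m}. d j * inner (U j (Bj j y)) (Bj j y))"
      unfolding y(2)[symmetric]
      using nn dpos j by (intro member_le_sum) (auto intro: mult_nonneg_nonneg less_imp_le)
    also have "\<dots> \<le> (\<Sum>i\<in>{1..k}. inner (V i (proj i y)) (proj i y) / c i)"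
      by (rule admissibleD(3)[OF adm y(1)])
    also have "\<dots> \<le> (\<Sum>i\<in>{1..k}. K / c i * (norm y)\<^sup>2)"
    proof (rule sum_mono)
      fix i assume i: "i \<in> {1..k}"
      have "inner (V i (proj i y)) (proj i y) \<le> K * (norm (proj i y))\<^sup>2" using V i proj_in[OF i] by blast
      also have "\<dots> \<le> K * (norm y)\<^sup>2" by (rule mult_left_mono[OF norm_orth_proj_le(1)[OF subE[OF i]] K])
      finally show "inner (V i (proj i y)) (proj i y) / c i \<le> K / c i * (norm y)\<^sup>2"
        using cpos[OF i] by (simp add: divide_right_mono)
    qed
    also have "\<dots> = C * (norm y)\<^sup>2" unfolding C_def sum_distrib_right ..
    also have "\<dots> \<le> C * ((R j)\<^sup>2 * (norm w)\<^sup>2)"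
      using power_mono[OF y(3), of 2] C0 by (intro mult_left_mono) (auto simp: power_mult_distrib)
    finally show "inner (U j w) w \<le> L j * (norm w)\<^sup>2"
      unfolding L_def using dpos[OF j] by (simp add: field_simps)
  qed
  then show ?thesis by blast
qed

text \<open>The lower bound on \<open>V\<close> keeps its limit definite. For \<open>U\<close> there
  is no such bound, and definiteness of its limit is recovered from convergence of the
  functional.\<close>

lemma extremizer_limit:
  fixes V :: "nat \<Rightarrow> nat \<Rightarrow> 'a \<Rightarrow> 'a" and U :: "nat \<Rightarrow> nat \<Rightarrow> 'b \<Rightarrow> 'b"
  assumes adm: "\<And>s. adm (V s) (U s)" and lim: "(\<lambda>s. J (V s) (U s)) \<longlonglongrightarrow> M"
    and lower: "\<And>s i x. i \<in> {1..k} \<Longrightarrow> x \<in> E i \<Longrightarrow> (norm x)\<^sup>2 \<le> inner (V s i x) x"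
    and upper: "\<And>s i x. i \<in> {1..k} \<Longrightarrow> x \<in> E i \<Longrightarrow> inner (V s i x) x \<le> K * (norm x)\<^sup>2" and K: "0 \<le> K"
    and UL: "\<And>s j z. j \<in> {1..m} \<Longrightarrow> z \<in> F j \<Longrightarrow> norm (U s j z) \<le> L j * norm z"
  shows "\<exists>V' U'. adm V' U' \<and> J V' U' = M"
proof -
  note A = admissibleD[OF adm]
  have normV: "norm (V s i x) \<le> K * norm x" if "i \<in> {1..k}" "x \<in> E i" for s i x
    using pos_def_on_imp_semidef[OF A(1)[OF that(1)]] subE[OF that(1)] K upper[OF that(1)] that(2)
    by (rule pos_semidef_on_norm_le)
  obtain r1 G where r1: "strict_mono r1" and
    G1: "\<forall>i\<in>{1..k}. \<forall>x\<in>E i. (\<lambda>s. V (r1 s) i x) \<longlonglongrightarrow> G i x"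
    using operator_convergent_subsequence[of "{1..k}" E "\<lambda>i s. V s i" "\<lambda>_. K",
        OF _ subE pos_def_on_linear[OF A(1)] normV] by auto
  obtain r2 H where r2: "strict_mono r2" and
    H: "\<forall>j\<in>{1..m}. \<forall>z\<in>F j. (\<lambda>s. U (r1 (r2 s)) j z) \<longlonglongrightarrow> H j z"
    using operator_convergent_subsequence[of "{1..m}" F "\<lambda>j s. U (r1 s) j" L,
        OF _ subF pos_def_on_linear[OF A(2)] UL] by auto
  define r where "r = r1 \<circ> r2"
  have r: "strict_mono r" unfolding r_def by (rule strict_mono_o[OF r1 r2])
  have G: "(\<lambda>s. V (r s) i x) \<longlonglongrightarrow> G i x" if "i \<in> {1..k}" "x \<in> E i" for i x
    using LIMSEQ_subseq_LIMSEQ[OF G1[rule_format, OF that] r2] by (simp add: o_def r_def)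
  have H: "(\<lambda>s. U (r s) j z) \<longlonglongrightarrow> H j z" if "j \<in> {1..m}" "z \<in> F j" for j z
    using H that by (simp add: r_def)
  have Gsd: "pos_semidef_on (E i) (G i)" if i: "i \<in> {1..k}" for i
    using pos_semidef_on_limit[OF subE[OF i] pos_def_on_imp_semidef[OF A(1)[OF i]] G[OF i]] .
  have Hsd: "pos_semidef_on (F j) (H j)" if j: "j \<in> {1..m}" for j
    using pos_semidef_on_limit[OF subF[OF j] pos_def_on_imp_semidef[OF A(2)[OF j]] H[OF j]] .
  have Gpd: "pos_def_on (E i) (G i)" if i: "i \<in> {1..k}" for i
  proof -
    have "(norm x)\<^sup>2 \<le> inner (G i x) x" if "x \<in> E i" for x
    proof (rule LIMSEQ_le_const)
      show "(\<lambda>s. inner (V (r s) i x) x) \<longlonglongrightarrow> inner (G i x) x"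
        by (intro tendsto_inner tendsto_const G i that)
      show "\<exists>N. \<forall>s\<ge>N. (norm x)\<^sup>2 \<le> inner (V (r s) i x) x" using lower[OF i that] by blast
    qed
    then have "0 < inner (G i x) x" if "x \<in> E i" "x \<noteq> 0" for x
      using that by (metis less_le_trans zero_less_norm_iff zero_less_power)
    with Gsd[OF i] show ?thesis by (simp add: pos_def_on_def pos_semidef_on_def)
  qed
  have detG: "(\<lambda>s. det_on (E i) (V (r s) i)) \<longlonglongrightarrow> det_on (E i) (G i)" if i: "i \<in> {1..k}" for i
    by (rule det_on_tendsto[OF subE[OF i] pos_def_on_linear[OF A(1)[OF i]]
          pos_semidef_on_linear[OF Gsd[OF i]] G[OF i]])
  have detH: "(\<lambda>s. det_on (F j) (U (r s) j)) \<longlonglongrightarrow> det_on (F j) (H j)" if j: "j \<in> {1..m}" for j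
    by (rule det_on_tendsto[OF subF[OF j] pos_def_on_linear[OF A(2)[OF j]]
          pos_semidef_on_linear[OF Hsd[OF j]] H[OF j]])
  let ?SV = "\<lambda>s. \<Sum>i\<in>{1..k}. c i * ln (det_on (E i) (V (r s) i))"
  let ?SU = "\<lambda>s. \<Sum>j\<in>{1..m}. d j * ln (det_on (F j) (U (r s) j))"
  let ?SG = "\<Sum>i\<in>{1..k}. c i * ln (det_on (E i) (G i))"
  have SV: "?SV \<longlonglongrightarrow> ?SG"
  proof (intro tendsto_sum tendsto_mult tendsto_const tendsto_ln detG)
    fix i assume i: "i \<in> {1..k}"
    show "det_on (E i) (G i) \<noteq> 0" using det_on_pos_def[OF subE[OF i] Gpd[OF i]] by simp
  qed
  \<comment> \<open>Adding back the convergent part in \<open>V\<close> isolates the sum over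
    \<open>U\<close>, before anything is known about its individual terms.\<close>
  have "(\<lambda>s. J (V (r s)) (U (r s)) + ?SV s) \<longlonglongrightarrow> M + ?SG"
    using LIMSEQ_subseq_LIMSEQ[OF lim r] by (intro tendsto_add SV) (simp add: o_def)
  then have SU: "?SU \<longlonglongrightarrow> M + ?SG" by (simp add: gaussian_functional_def)
  have detU: "0 < det_on (F j) (U s j)" if j: "j \<in> {1..m}" for s j
    by (rule det_on_pos_def[OF subF[OF j] A(2)[OF j]])
  \<comment> \<open>Unlike \<open>ln\<close>, a positive power is continuous from the right at 0.
    The limit of this product is also an exponential, so no limiting determinant is 0.\<close>
  have "(\<lambda>s. \<Prod>j\<in>{1..m}. det_on (F j) (U (r s) j) powr d j) \<longlonglongrightarrow> (\<Prod>j\<in>{1..m}. det_on (F j) (H j) powr d j)"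
  proof (intro tendsto_prod tendsto_powr' detH tendsto_const)
    fix j assume j: "j \<in> {1..m}"
    show "det_on (F j) (H j) \<noteq> 0 \<or> 0 < d j \<and> (\<forall>\<^sub>F s in sequentially. 0 \<le> det_on (F j) (U (r s) j))"
      using dpos[OF j] detU[OF j] by (simp add: less_imp_le)
  qed
  moreover have "(\<Prod>j\<in>{1..m}. det_on (F j) (U (r s) j) powr d j) = exp (?SU s)" for s
    unfolding exp_sum[OF finite_atLeastAtMost]
  proof (rule prod.cong[OF refl])
    fix j assume j: "j \<in> {1..m}"
    show "det_on (F j) (U (r s) j) powr d j = exp (d j * ln (det_on (F j) (U (r s) j)))"
      using detU[OF j, of "r s"] by (simp add: powr_def)
  qed
  moreover have "(\<lambda>s. exp (?SU s)) \<longlonglongrightarrow> exp (M + ?SG)" by (intro tendsto_exp SU)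
  ultimately have "(\<Prod>j\<in>{1..m}. det_on (F j) (H j) powr d j) = exp (M + ?SG)"
    using LIMSEQ_unique by simp
  then have prod_nz: "(\<Prod>j\<in>{1..m}. det_on (F j) (H j) powr d j) \<noteq> 0" by simp
  have Hnz: "det_on (F j) (H j) \<noteq> 0" if j: "j \<in> {1..m}" for j
  proof
    assume "det_on (F j) (H j) = 0"
    then have "\<exists>j\<in>{1..m}. det_on (F j) (H j) powr d j = 0" using j by auto
    with prod_nz show False by (simp only: prod_zero[OF finite_atLeastAtMost])
  qed
  have Hpd: "pos_def_on (F j) (H j)" if j: "j \<in> {1..m}" for j
    by (rule pos_semidef_on_det_nonzero[OF subF[OF j] Hsd[OF j] Hnz[OF j]])
  have "?SU \<longlonglongrightarrow> (\<Sum>j\<in>{1..m}. d j * ln (det_on (F j) (H j)))"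
    by (intro tendsto_sum tendsto_mult tendsto_const tendsto_ln detH Hnz)
  from LIMSEQ_unique[OF this SU] have JM: "J G H = M" by (simp add: gaussian_functional_def)
  have "(\<Sum>j\<in>{1..m}. d j * inner (H j (Bj j y)) (Bj j y)) \<le> (\<Sum>i\<in>{1..k}. inner (G i (proj i y)) (proj i y) / c i)"
    if y: "y \<in> EE" for y
  proof (rule LIMSEQ_le)
    show "(\<lambda>s. \<Sum>j\<in>{1..m}. d j * inner (U (r s) j (Bj j y)) (Bj j y))
        \<longlonglongrightarrow> (\<Sum>j\<in>{1..m}. d j * inner (H j (Bj j y)) (Bj j y))"
      by (intro tendsto_sum tendsto_mult tendsto_inner tendsto_const H Bj_in)
    show "(\<lambda>s. \<Sum>i\<in>{1..k}. inner (V (r s) i (proj i y)) (proj i y) / c i)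
        \<longlonglongrightarrow> (\<Sum>i\<in>{1..k}. inner (G i (proj i y)) (proj i y) / c i)"
      by (intro tendsto_sum tendsto_divide tendsto_inner tendsto_const G proj_in less_imp_neq[OF cpos, symmetric])
    show "\<exists>N. \<forall>s\<ge>N. (\<Sum>j\<in>{1..m}. d j * inner (U (r s) j (Bj j y)) (Bj j y))
        \<le> (\<Sum>i\<in>{1..k}. inner (V (r s) i (proj i y)) (proj i y) / c i)"
      using A(3)[OF y] by blast
  qed
  then have "adm G H" unfolding admissible_iff using Gpd Hpd by blast
  with JM show ?thesis by blast
qed

lemma extremizable_if_simple:
  assumes sc: "scaling_condition k m E F c d" and dc: "dimension_condition k m E c d B"
    and simple: "simple_datum k m E c d B"
  shows "gaussian_extremizable k m E F c d B"
proof -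
  obtain M0 where M0: "\<And>V U. adm V U \<Longrightarrow> J V U \<le> M0" using bounded_if_conditions[OF sc dc] by blast
  define S where "S = {J V U | V U. adm V U}"
  define M where "M = Sup S"
  have bdd: "bdd_above S" unfolding S_def using M0 by (intro bdd_aboveI[of _ M0]) blast
  obtain V0 U0 where "adm V0 U0" using admissible_exists .
  then have ne: "S \<noteq> {}" unfolding S_def by blast
  have JM: "J V U \<le> M" if "adm V U" for V U
    unfolding M_def using that by (intro cSup_upper bdd) (auto simp: S_def)
  have "\<exists>V U. adm V U \<and> M - inverse (real (Suc s)) < J V U" for s
  proof -
    have "M - inverse (real (Suc s)) < Sup S" unfolding M_def by simp
    then obtain y where "y \<in> S" "M - inverse (real (Suc s)) < y" using less_cSupE[OF _ ne] by blast
    then show ?thesis unfolding S_def by blast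
  qed
  then obtain V U where adm: "\<And>s. adm (V s) (U s)" and JVU: "\<And>s. M - inverse (real (Suc s)) < J (V s) (U s)"
    by metis
  obtain r :: "nat \<Rightarrow> nat" and C \<epsilon> where r: "strict_mono r" and e: "0 < \<epsilon>"
    and ctl: "\<And>s. controlled (V (r s)) (U (r s)) C \<epsilon>"
    using subsequence_bound[of V U, OF sc dc adm] simple by blast
  have lowJ: "M - inverse (real (Suc s)) < J (V (r s)) (U (r s))" for s
  proof -
    have "inverse (real (Suc (r s))) \<le> inverse (real (Suc s))"
      using seq_suble[OF r, of s] by (intro le_imp_inverse_le) auto
    then show ?thesis using JVU[of "r s"] by linarith
  qed
  \<comment> \<open>The maximizing sequence stays within 1 of the supremum \<open>M\<close>, so
    \<open>M - 1\<close> is a uniform lower bound for the functional.\<close>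
  define K where "K = exp ((C - (M - 1)) / \<epsilon>)"
  have K: "0 \<le> K" unfolding K_def by simp
  have "\<exists>V' U'. adm V' U' \<and> J V' U' = J (V (r s)) (U (r s)) \<and>
    (\<forall>i\<in>{1..k}. \<forall>x\<in>E i. (norm x)\<^sup>2 \<le> inner (V' i x) x \<and> inner (V' i x) x \<le> K * (norm x)\<^sup>2)" for s
    unfolding K_def
  proof (rule normalized_bound[OF sc adm ctl e])
    have "inverse (real (Suc s)) \<le> 1" by (simp add: field_simps)
    then show "M - 1 \<le> J (V (r s)) (U (r s))" using lowJ[of s] by linarith
  qed
  then obtain V' U' where adm': "\<And>s. adm (V' s) (U' s)" and J': "\<And>s. J (V' s) (U' s) = J (V (r s)) (U (r s))"
    and V': "\<And>s. \<forall>i\<in>{1..k}. \<forall>x\<in>E i. (norm x)\<^sup>2 \<le> inner (V' s i x) x \<and> inner (V' s i x) x \<le> K * (norm x)\<^sup>2"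
    by metis
  obtain L where L: "\<And>V U. adm V U \<Longrightarrow> \<forall>i\<in>{1..k}. \<forall>x\<in>E i. inner (V i x) x \<le> K * (norm x)\<^sup>2 \<Longrightarrow>
    (\<forall>j\<in>{1..m}. \<forall>z\<in>F j. norm (U j z) \<le> L j * norm z)"
    using U_bounded[OF sc dc K] by blast
  have "(\<lambda>s. J (V' s) (U' s)) \<longlonglongrightarrow> M"
  proof (rule tendsto_sandwich[OF _ _ _ tendsto_const])
    show "\<forall>\<^sub>F s in sequentially. M - inverse (real (Suc s)) \<le> J (V' s) (U' s)"
      unfolding J' using lowJ by (intro always_eventually allI less_imp_le)
    show "\<forall>\<^sub>F s in sequentially. J (V' s) (U' s) \<le> M" by (intro always_eventually allI JM adm')
    show "(\<lambda>s. M - inverse (real (Suc s))) \<longlonglongrightarrow> M"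
      using tendsto_diff[OF tendsto_const LIMSEQ_inverse_real_of_nat, of M] by simp
  qed
  then have "\<exists>V U. adm V U \<and> J V U = M"
  proof (rule extremizer_limit[OF adm'])
    show "(norm x)\<^sup>2 \<le> inner (V' s i x) x" "inner (V' s i x) x \<le> K * (norm x)\<^sup>2"
      if "i \<in> {1..k}" "x \<in> E i" for s i x using V' that by blast+
    show "norm (U' s j z) \<le> L j * norm z" if "j \<in> {1..m}" "z \<in> F j" for s j z
      using L[OF adm'[of s]] V'[of s] that by blast
  qed (rule K)
  then obtain V'' U'' where "adm V'' U''" "J V'' U'' = M" by blast
  with JM show ?thesis by (intro gaussian_extremizableI) auto
qed

end

theorem theorem1p27:
  fixes k m :: nat
    and E :: "nat \<Rightarrow> 'a::euclidean_space set"
    and F :: "nat \<Rightarrow> 'b::euclidean_space set"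
    and c d :: "nat \<Rightarrow> real"
    and B :: "nat \<Rightarrow> nat \<Rightarrow> 'a \<Rightarrow> 'b"
  assumes "\<And>i. i \<in> {1..k} \<Longrightarrow> subspace (E i)"
    and "\<And>i i' x y. i \<in> {1..k} \<Longrightarrow> i' \<in> {1..k} \<Longrightarrow> i \<noteq> i' \<Longrightarrow>
           x \<in> E i \<Longrightarrow> y \<in> E i' \<Longrightarrow> inner x y = 0"
    and "\<And>j. j \<in> {1..m} \<Longrightarrow> subspace (F j)"
    and "\<And>i j. i \<in> {1..k} \<Longrightarrow> j \<in> {1..m} \<Longrightarrow> linear_map_on (E i) (F j) (B i j)"
    and "\<And>i. i \<in> {1..k} \<Longrightarrow> 0 < c i"
    and "\<And>j. j \<in> {1..m} \<Longrightarrow> 0 < d j"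
  shows "(\<bar>D_g k m E F c d B\<bar> \<noteq> \<infinity> \<longleftrightarrow>
            scaling_condition k m E F c d \<and> dimension_condition k m E c d B)
       \<and> (scaling_condition k m E F c d \<and> dimension_condition k m E c d B \<longrightarrow>
            (\<forall>j\<in>{1..m}. Bsum k E B j ` E0 k E = F j))
       \<and> (scaling_condition k m E F c d \<and> dimension_condition k m E c d B
            \<and> simple_datum k m E c d B \<longrightarrow> gaussian_extremizable k m E F c d B)"
proof -
  interpret fr_datum k m E F c d B
    by unfold_locales (use assms in blast)+
  show ?thesis
  proof (intro conjI impI iffI ballI)
    assume "\<bar>D_g k m E F c d B\<bar> \<noteq> \<infinity>"
    then have "\<exists>M. \<forall>V U. adm V U \<longrightarrow> J V U \<le> M" by (rule D_g_finite_iff[THEN iffD1])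
    then obtain M where "\<forall>V U. adm V U \<longrightarrow> J V U \<le> M" by (rule exE)
    then have M: "J V U \<le> M" if "adm V U" for V U using that by simp
    show "scaling_condition k m E F c d" by (rule scaling_condition_if_bounded[OF M])
    show "dimension_condition k m E c d B" by (rule dimension_condition_if_bounded[OF M])
  next
    assume C: "scaling_condition k m E F c d \<and> dimension_condition k m E c d B"
    show "\<bar>D_g k m E F c d B\<bar> \<noteq> \<infinity>"
      unfolding D_g_finite_iff by (rule bounded_if_conditions[OF conjunct1[OF C] conjunct2[OF C]])
  next
    fix j assume "scaling_condition k m E F c d \<and> dimension_condition k m E c d B" "j \<in> {1..m}"
    then show "Bj j ` EE = F j" by (elim conjE) (rule Bj_surj)
  next
    assume "scaling_condition k m E F c d \<and> dimension_condition k m E c d B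
        \<and> simple_datum k m E c d B"
    then show "gaussian_extremizable k m E F c d B"
      by (elim conjE) (rule extremizable_if_simple)
  qed
qed

end
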